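(* Let $n\ge1$, $N\ge1$, and let $F$ and $G$ be Siegel modular forms of degree $n$ and level $N$ which are Hecke eigenforms, of respective weights $(\lambda_1\ge\lambda_2\ge\dots\ge\lambda_n)$ and $(\mu_1\ge\mu_2\ge\dots\ge\mu_n)$, satisfying $\sum_{j=1}^n\lambda_j\ne\sum_{j=1}^n\mu_j$. If $p$ is a prime not dividing $N$, then $\mathcal{E}_F(p)\ne\mathcal{E}_G(p)$.
   Context: Let $J=\begin{pmatrix}0&I_n\\-I_n&0\end{pmatrix}$, $\Gamma_0(N)=\{\begin{pmatrix}A&B\\C&D\end{pmatrix}\in\mathrm{Sp}(2n,\mathbb{Z}) : C\equiv0 \pmod N\}$, and $\mathbb{H}^n$ the Siegel upper half space. For a polynomial representation $\rho\colon\mathrm{GL}_n(\mathbb{C})\to\mathrm{GL}(V)$ of highest weight $(\lambda_1\ge\dots\ge\lambda_n)$ (called the weight), a Siegel modular form of degree $n$, weight $\rho$ and level $N$ is a holomorphic $F\colon\mathbb{H}^n\to V$ with $F((Az+B)(Cz+D)^{-1})=\rho(Cz+D)F(z)$ for all $\begin{pmatrix}A&B\\C&D\end{pmatrix}\in\Gamma_0(N)$ (plus holomorphy at cusps if $n=1$). For $\gamma=\begin{pmatrix}A&B\\C&D\end{pmatrix}\in\mathrm{GSp}(2n,\mathbb{Q})$ with $\gamma J\gamma^t=\eta(\gamma)J$ and positive determinant, $F|_{\gamma,\rho}(z)=\eta(\gamma)^{\sum\lambda_j-n(n+1)/2}\rho(Cz+D)^{-1}F(\gamma\cdot z)$. For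 $p\nmid N$ and $K=\mathrm{Sp}(2n,\mathbb{Z}_p)$, a double coset $K\gamma K=\coprod_i K\gamma_i$ acts by $F\mapsto\sum_i F|_{\gamma_i,\rho}$. Hecke operators: $T(p)$ is the double coset of $\mathrm{diag}(1^{(n)},p^{(n)})$; $T_j(p^2)$ ($0\le j\le n$) is the double coset of $\mathrm{diag}(1^{(n-j)},p^{(j)},(p^2)^{(n-j)},p^{(j)})$ (multiplicities in parentheses); $T(p^2)$ is the sum of the distinct double cosets $K\gamma K$ with $\gamma^tJ\gamma=p^2J$. An eigenform $F$ has eigenvalue $a_F(T)$ for each such $T$, and $\mathcal{E}_F(p)=(a_F(T(p)),a_F(T(p^2)),a_F(T_1(p^2)),\dots,a_F(T_{n-1}(p^2)))$. *)

theory Defs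
  imports "HOL-Analysis.Analysis" "HOL-Computational_Algebra.Primes"
begin

text \<open>
  The degree is \<open>n = CARD('n)\<close>. The index type carries a linear order, which plays the role of the
  order on \<open>1,\<dots>,n\<close> in highest weights, upper triangular matrices and diagonal matrices with
  multiplicities. Matrices of size \<open>2n\<close> are indexed by \<open>'n + 'n\<close>, so that the constructors
  \<open>Inl\<close> and \<open>Inr\<close> select the \<open>n \<times> n\<close> blocks.
\<close>

subsection \<open>Block matrices, symplectic similitudes\<close>

type_synonym 'n cmat = "complex ^ 'n ^ 'n"
type_synonym ('a, 'n) mat_2n = "'a ^ ('n + 'n) ^ ('n + 'n)"

definition block_A :: "('a, 'n::finite) mat_2n \<Rightarrow> 'a ^ 'n ^ 'n" where
  "block_A g = (\<chi> i j. g $ Inl i $ Inl j)"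

definition block_B :: "('a, 'n::finite) mat_2n \<Rightarrow> 'a ^ 'n ^ 'n" where
  "block_B g = (\<chi> i j. g $ Inl i $ Inr j)"

definition block_C :: "('a, 'n::finite) mat_2n \<Rightarrow> 'a ^ 'n ^ 'n" where
  "block_C g = (\<chi> i j. g $ Inr i $ Inl j)"

definition block_D :: "('a, 'n::finite) mat_2n \<Rightarrow> 'a ^ 'n ^ 'n" where
  "block_D g = (\<chi> i j. g $ Inr i $ Inr j)"

definition scale_mat :: "'a::semiring_1 \<Rightarrow> 'a ^ 'm ^ 'k \<Rightarrow> 'a ^ 'm ^ 'k" where
  "scale_mat c = map_matrix (\<lambda>x. c * x)"

definition symp_J :: "('a::ring_1, 'n::finite) mat_2n" where
  "symp_J = (\<chi> i j. case (i, j) of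
       (Inl a, Inr b) \<Rightarrow> if a = b then 1 else 0
     | (Inr a, Inl b) \<Rightarrow> if a = b then - 1 else 0
     | _ \<Rightarrow> 0)"

definition similitude :: "(rat, 'n::finite) mat_2n \<Rightarrow> rat" where
  "similitude g = (THE e. g ** symp_J ** transpose g = scale_mat e symp_J)"

definition Sp_int :: "(int, 'n::finite) mat_2n set" where
  "Sp_int = {g. g ** symp_J ** transpose g = symp_J}"

definition Gamma0 :: "nat \<Rightarrow> (int, 'n::finite) mat_2n set" where
  "Gamma0 N = {g \<in> Sp_int. \<forall>i j. int N dvd block_C g $ i $ j}"

text \<open>
  The integral similitudes \<open>g\<close> with \<open>C \<equiv> 0 (mod N)\<close>. Positivity is imposed on the similitude
  factor \<open>e\<close> itself, since \<open>det g = e ^ n\<close> is positive for all \<open>e\<close> when \<open>n\<close> is even.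
\<close>

definition Delta0 :: "nat \<Rightarrow> (int, 'n::finite) mat_2n set" where
  "Delta0 N = {g. (\<exists>e > 0. g ** symp_J ** transpose g = scale_mat e symp_J) \<and>
                  (\<forall>i j. int N dvd block_C g $ i $ j)}"

subsection \<open>Siegel upper half space\<close>

definition siegel_space :: "('n::finite cmat) set" where
  "siegel_space = {z. transpose z = z \<and> (\<forall>y. y \<noteq> 0 \<longrightarrow> y \<bullet> (map_matrix Im z *v y) > 0)}"

definition auto_factor :: "(complex, 'n::finite) mat_2n \<Rightarrow> 'n cmat \<Rightarrow> 'n cmat" where
  "auto_factor g z = block_C g ** z + block_D g"

definition siegel_act :: "(complex, 'n::finite) mat_2n \<Rightarrow> 'n cmat \<Rightarrow> 'n cmat" where
  "siegel_act g z = (block_A g ** z + block_B g) ** matrix_inv (auto_factor g z)"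

text \<open>
  Complex differentiability on the Siegel space, which is open in the symmetric matrices but not in
  all matrices. Only the values of the derivative on symmetric matrices are determined, and these can
  always be extended to a complex linear map on all matrices.
\<close>

definition siegel_holomorphic :: "('n::finite cmat \<Rightarrow> complex ^ 'd) \<Rightarrow> bool" where
  "siegel_holomorphic F \<longleftrightarrow>
     (\<forall>z \<in> siegel_space. \<exists>F'. (F has_derivative F') (at z within siegel_space) \<and>
        (\<forall>c w. F' (scale_mat c w) = c *s F' w))"

subsection \<open>Polynomial representations of the general linear group\<close>

text \<open>
  The finite-dimensional space \<open>V\<close> is \<open>complex ^ 'd\<close>; a representation is a function on all
  matrices of which only the values at invertible ones matter.
\<close>

definition polynomial_fun :: "('n::finite cmat \<Rightarrow> complex) \<Rightarrow> bool" where
  "polynomial_fun f \<longleftrightarrow>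
     (\<exists>(E :: ('n \<Rightarrow> 'n \<Rightarrow> nat) set) c. finite E \<and>
        (\<forall>g. invertible g \<longrightarrow> f g = (\<Sum>e\<in>E. c e * (\<Prod>i\<in>UNIV. \<Prod>j\<in>UNIV. (g $ i $ j) ^ e i j))))"

definition polynomial_rep :: "('n::finite cmat \<Rightarrow> 'd::finite cmat) \<Rightarrow> bool" where
  "polynomial_rep \<rho> \<longleftrightarrow>
     \<rho> (mat 1) = mat 1 \<and>
     (\<forall>g h. invertible g \<longrightarrow> invertible h \<longrightarrow> \<rho> (g ** h) = \<rho> g ** \<rho> h) \<and>
     (\<forall>a b. polynomial_fun (\<lambda>g. \<rho> g $ a $ b))"

definition irreducible_rep :: "('n::finite cmat \<Rightarrow> 'd::finite cmat) \<Rightarrow> bool" where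
  "irreducible_rep \<rho> \<longleftrightarrow>
     (\<forall>W. vec.subspace W \<and> (\<forall>g. invertible g \<longrightarrow> (\<forall>w \<in> W. \<rho> g *v w \<in> W)) \<longrightarrow> W = {0} \<or> W = UNIV)"

definition upper_triangular_mat :: "'n::{finite,linorder} cmat \<Rightarrow> bool" where
  "upper_triangular_mat b \<longleftrightarrow> (\<forall>i j. j < i \<longrightarrow> b $ i $ j = 0)"

definition has_highest_weight ::
  "('n::{finite,linorder} cmat \<Rightarrow> 'd::finite cmat) \<Rightarrow> ('n \<Rightarrow> int) \<Rightarrow> bool" where
  "has_highest_weight \<rho> lam \<longleftrightarrow>
     irreducible_rep \<rho> \<and>
     (\<exists>v. v \<noteq> 0 \<and> (\<forall>b. invertible b \<longrightarrow> upper_triangular_mat b \<longrightarrow>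
        \<rho> b *v v = (\<Prod>i\<in>UNIV. (b $ i $ i) powi lam i) *s v))"

subsection \<open>Siegel modular forms\<close>

definition slash ::
  "('n::finite cmat \<Rightarrow> 'd::finite cmat) \<Rightarrow> ('n \<Rightarrow> int) \<Rightarrow> (rat, 'n) mat_2n \<Rightarrow>
   ('n cmat \<Rightarrow> complex ^ 'd) \<Rightarrow> 'n cmat \<Rightarrow> complex ^ 'd" where
  "slash \<rho> lam g F z =
     (of_rat (similitude g) powi ((\<Sum>i\<in>UNIV. lam i) - int (CARD('n) * (CARD('n) + 1) div 2))) *s
     (matrix_inv (\<rho> (auto_factor (map_matrix of_rat g) z)) *v F (siegel_act (map_matrix of_rat g) z))"

text \<open>
  For \<open>n = 1\<close>: at each cusp the form has an expansion in nonnegative powers of \<open>exp (2\<pi>iz/h)\<close>.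
  Here \<open>trace z\<close> is the only entry of \<open>z\<close>.
\<close>

definition holomorphic_at_cusps ::
  "('n::finite cmat \<Rightarrow> 'd::finite cmat) \<Rightarrow> ('n \<Rightarrow> int) \<Rightarrow>
   ('n cmat \<Rightarrow> complex ^ 'd) \<Rightarrow> bool" where
  "holomorphic_at_cusps \<rho> lam F \<longleftrightarrow>
     (\<forall>g \<in> Sp_int. \<exists>(h::nat) (a :: nat \<Rightarrow> complex ^ 'd). h > 0 \<and>
        (\<forall>z \<in> siegel_space.
           (\<lambda>m. exp (2 * of_real pi * \<i> * of_nat m * trace z / of_nat h) *s a m)
             sums slash \<rho> lam (map_matrix of_int g) F z))"

definition siegel_modular_form ::
  "nat \<Rightarrow> ('n::{finite,linorder} cmat \<Rightarrow> 'd::finite cmat) \<Rightarrow> ('n \<Rightarrow> int) \<Rightarrow>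
   ('n cmat \<Rightarrow> complex ^ 'd) \<Rightarrow> bool" where
  "siegel_modular_form N \<rho> lam F \<longleftrightarrow>
     polynomial_rep \<rho> \<and> has_highest_weight \<rho> lam \<and>
     siegel_holomorphic F \<and>
     (\<forall>g \<in> Gamma0 N. \<forall>z \<in> siegel_space.
        F (siegel_act (map_matrix of_int g) z) = \<rho> (auto_factor (map_matrix of_int g) z) *v F z) \<and>
     (CARD('n) = 1 \<longrightarrow> holomorphic_at_cusps \<rho> lam F)"

subsection \<open>Matrices over the p-adic integers\<close>

text \<open>
  A square matrix over the ring of p-adic integers, the inverse limit of the rings of integers
  modulo \<open>p ^ k\<close>, is the sequence of its reductions modulo \<open>p ^ k\<close>, each with entries in
  \<open>{0..<p ^ k}\<close>. All double cosets below consist of integral matrices, so the field of p-adic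
  numbers is not needed.
\<close>

type_synonym 'm padic_mat = "nat \<Rightarrow> int ^ 'm ^ 'm"

definition reduce_mat :: "int \<Rightarrow> int ^ 'm ^ 'm::finite \<Rightarrow> int ^ 'm ^ 'm" where
  "reduce_mat q = map_matrix (\<lambda>x. x mod q)"

definition padic_mats :: "nat \<Rightarrow> 'm::finite padic_mat set" where
  "padic_mats p = {X. \<forall>k. X k = reduce_mat (int p ^ k) (X (Suc k))}"

definition padic_of_int :: "nat \<Rightarrow> int ^ 'm ^ 'm::finite \<Rightarrow> 'm padic_mat" where
  "padic_of_int p g = (\<lambda>k. reduce_mat (int p ^ k) g)"

definition padic_mult :: "nat \<Rightarrow> 'm::finite padic_mat \<Rightarrow> 'm padic_mat \<Rightarrow> 'm padic_mat" where
  "padic_mult p X Y = (\<lambda>k. reduce_mat (int p ^ k) (X k ** Y k))"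

definition padic_transpose :: "'m::finite padic_mat \<Rightarrow> 'm padic_mat" where
  "padic_transpose X = (\<lambda>k. transpose (X k))"

definition Sp_padic :: "nat \<Rightarrow> ('n::finite + 'n) padic_mat set" where
  "Sp_padic p = {X \<in> padic_mats p.
     padic_mult p (padic_mult p X (padic_of_int p symp_J)) (padic_transpose X) = padic_of_int p symp_J}"

definition padic_left_coset :: "nat \<Rightarrow> ('n::finite + 'n) padic_mat \<Rightarrow> ('n + 'n) padic_mat set" where
  "padic_left_coset p X = {padic_mult p U X | U. U \<in> Sp_padic p}"

definition padic_double_coset :: "nat \<Rightarrow> ('n::finite + 'n) padic_mat \<Rightarrow> ('n + 'n) padic_mat set" where
  "padic_double_coset p X =
     {padic_mult p (padic_mult p U X) W | U W. U \<in> Sp_padic p \<and> W \<in> Sp_padic p}"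

subsection \<open>Hecke operators\<close>

text \<open>
  \<open>R\<close> is a set of representatives for the cosets \<open>K g\<close> in the double coset \<open>D\<close>. For the action on
  forms of level \<open>N\<close> to be independent of this choice, the representatives are global matrices which
  are integral and satisfy \<open>C \<equiv> 0 (mod N)\<close>: for these, \<open>K g\<close> determines the coset of \<open>g\<close> under
  \<open>Gamma0 N\<close>.
\<close>

definition hecke_reps ::
  "nat \<Rightarrow> nat \<Rightarrow> ('n::finite + 'n) padic_mat set \<Rightarrow> (int, 'n) mat_2n set \<Rightarrow> bool" where
  "hecke_reps N p D R \<longleftrightarrow>
     finite R \<and> R \<subseteq> Delta0 N \<and>
     D = (\<Union>g\<in>R. padic_left_coset p (padic_of_int p g)) \<and>
     (\<forall>g\<in>R. \<forall>h\<in>R. g \<noteq> h \<longrightarrow>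
        padic_left_coset p (padic_of_int p g) \<inter> padic_left_coset p (padic_of_int p h) = {})"

definition hecke_coset_op ::
  "nat \<Rightarrow> nat \<Rightarrow> ('n::finite cmat \<Rightarrow> 'd::finite cmat) \<Rightarrow> ('n \<Rightarrow> int) \<Rightarrow>
   ('n + 'n) padic_mat set \<Rightarrow>
   ('n cmat \<Rightarrow> complex ^ 'd) \<Rightarrow> 'n cmat \<Rightarrow> complex ^ 'd" where
  "hecke_coset_op N p \<rho> lam D F z =
     (\<Sum>g\<in>(SOME R. hecke_reps N p D R). slash \<rho> lam (map_matrix of_int g) F z)"

definition diag_mat_2n :: "('n + 'n \<Rightarrow> int) \<Rightarrow> (int, 'n::finite) mat_2n" where
  "diag_mat_2n d = (\<chi> i j. if i = j then d i else 0)"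

definition hecke_T ::
  "nat \<Rightarrow> nat \<Rightarrow> ('n::finite cmat \<Rightarrow> 'd::finite cmat) \<Rightarrow> ('n \<Rightarrow> int) \<Rightarrow>
   ('n cmat \<Rightarrow> complex ^ 'd) \<Rightarrow> 'n cmat \<Rightarrow> complex ^ 'd" where
  "hecke_T N p \<rho> lam =
     hecke_coset_op N p \<rho> lam (padic_double_coset p (padic_of_int p
       (diag_mat_2n (case_sum (\<lambda>i. 1) (\<lambda>i. int p)))))"

text \<open>The number of \<open>k < i\<close> is the (zero-based) position of \<open>i\<close> in the index type.\<close>

definition hecke_Tj ::
  "nat \<Rightarrow> nat \<Rightarrow> ('n::{finite,linorder} cmat \<Rightarrow> 'd::finite cmat) \<Rightarrow> ('n \<Rightarrow> int) \<Rightarrow>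
   nat \<Rightarrow> ('n cmat \<Rightarrow> complex ^ 'd) \<Rightarrow> 'n cmat \<Rightarrow> complex ^ 'd" where
  "hecke_Tj N p \<rho> lam j =
     hecke_coset_op N p \<rho> lam (padic_double_coset p (padic_of_int p (diag_mat_2n (case_sum
       (\<lambda>i. if card {k. k < i} < CARD('n) - j then 1 else int p)
       (\<lambda>i. if card {k. k < i} < CARD('n) - j then (int p)\<^sup>2 else int p)))))"

text \<open>The matrices are integral; without this there would be infinitely many double cosets.\<close>

definition similitude_p2_cosets :: "nat \<Rightarrow> ('n::finite + 'n) padic_mat set set" where
  "similitude_p2_cosets p =
     {padic_double_coset p X | X. X \<in> padic_mats p \<and>
        padic_mult p (padic_mult p (padic_transpose X) (padic_of_int p symp_J)) X
          = padic_of_int p (scale_mat ((int p)\<^sup>2) symp_J)}"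

definition hecke_Tp2 ::
  "nat \<Rightarrow> nat \<Rightarrow> ('n::finite cmat \<Rightarrow> 'd::finite cmat) \<Rightarrow> ('n \<Rightarrow> int) \<Rightarrow>
   ('n cmat \<Rightarrow> complex ^ 'd) \<Rightarrow> 'n cmat \<Rightarrow> complex ^ 'd" where
  "hecke_Tp2 N p \<rho> lam F z =
     (\<Sum>D\<in>similitude_p2_cosets p. hecke_coset_op N p \<rho> lam D F z)"

subsection \<open>Eigenforms and eigenvalues\<close>

definition is_eigenvalue ::
  "(('n::finite cmat \<Rightarrow> complex ^ 'd) \<Rightarrow> 'n cmat \<Rightarrow> complex ^ 'd::finite) \<Rightarrow>
   ('n cmat \<Rightarrow> complex ^ 'd) \<Rightarrow> complex \<Rightarrow> bool" where
  "is_eigenvalue T F a \<longleftrightarrow> (\<forall>z \<in> siegel_space. T F z = a *s F z)"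

definition hecke_eigenform ::
  "nat \<Rightarrow> ('n::{finite,linorder} cmat \<Rightarrow> 'd::finite cmat) \<Rightarrow> ('n \<Rightarrow> int) \<Rightarrow>
   ('n cmat \<Rightarrow> complex ^ 'd) \<Rightarrow> bool" where
  "hecke_eigenform N \<rho> lam F \<longleftrightarrow>
     siegel_modular_form N \<rho> lam F \<and> (\<exists>z \<in> siegel_space. F z \<noteq> 0) \<and>
     (\<forall>p. prime p \<and> \<not> p dvd N \<longrightarrow>
        (\<exists>a. is_eigenvalue (hecke_T N p \<rho> lam) F a) \<and>
        (\<exists>a. is_eigenvalue (hecke_Tp2 N p \<rho> lam) F a) \<and>
        (\<forall>j \<le> CARD('n). \<exists>a. is_eigenvalue (hecke_Tj N p \<rho> lam j) F a))"

definition eigenvalue ::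
  "(('n::finite cmat \<Rightarrow> complex ^ 'd) \<Rightarrow> 'n cmat \<Rightarrow> complex ^ 'd::finite) \<Rightarrow>
   ('n cmat \<Rightarrow> complex ^ 'd) \<Rightarrow> complex" where
  "eigenvalue T F = (THE a. is_eigenvalue T F a)"

definition eigenvalue_tuple ::
  "nat \<Rightarrow> ('n::{finite,linorder} cmat \<Rightarrow> 'd::finite cmat) \<Rightarrow> ('n \<Rightarrow> int) \<Rightarrow>
   ('n cmat \<Rightarrow> complex ^ 'd) \<Rightarrow> nat \<Rightarrow> complex list" where
  "eigenvalue_tuple N \<rho> lam F p =
     [eigenvalue (hecke_T N p \<rho> lam) F, eigenvalue (hecke_Tp2 N p \<rho> lam) F] @
     map (\<lambda>j. eigenvalue (hecke_Tj N p \<rho> lam j) F) [1..<CARD('n)]"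

end

(*
The double coset of diag(1,p) satisfies T(p)^2 = sum of c_D T_D over the double cosets D of similitude
p^2, where c_D counts the left cosets K Y in K diag(1,p) K which divide a given element of D on the
right with quotient in K diag(1,p) K.  Since T(p^2) = sum of T_D, the combination
T(p)^2 - c_0 T(p^2), with c_0 the multiplicity of T_0(p^2), is a combination of T_1(p^2), ...,
T_n(p^2) with coefficients depending on p and n only, and c_n > c_0.  As T_n(p^2), the class of the scalar
matrix p, acts by p^(sum lambda - n(n+1)), the eigenvalues in the tuple determine sum lambda.

That the T_j(p^2) exhaust the double cosets of similitude p^2, and that cosets have global
representatives in Delta0(N), both follow from one elimination: a similitude of factor p^e over Z_p is,
modulo p^e, a product t d s with d diagonal and t, s products of integral symplectic transvections which
are congruent to 1 modulo N, and its left coset under K depends only on its residue modulo p^e.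
*)

theory Submission
  imports Defs "HOL-Number_Theory.Cong"
begin

subsection \<open>The symplectic adjoint\<close>

text \<open>The tuple omits the eigenvalues of both T_0(p^2) and T_n(p^2), so one relation would not
  be enough: T(p^2) and T(p)^2 supply two, and c_n > c_0 says that they are independent modulo the
  known eigenvalues. The weight cannot enter the c_D: they only count cosets, because the slash
  operator is an exact right action. Inverses are replaced throughout by the symplectic adjoint
  \<open>sadj\<close>: a similitude X of factor c satisfies \<open>X ** sadj X = mat c\<close>.
  Everything stays integral, and a division by p^v becomes the cancellation of p^v in a congruence,
  at the price of p-adic precision. This loss shapes the elimination: its input must be known to a
  precision well above p^e, and 3e levels are set aside for each pivot.\<close>

definition sadj :: "('a::comm_ring_1, 'n::finite) mat_2n \<Rightarrow> ('a, 'n) mat_2n" where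
  "sadj X = symp_J ** transpose X ** transpose symp_J"

lemma scale_mat_nth [simp]: "scale_mat c A $ i $ j = c * A $ i $ j"
  by (simp add: scale_mat_def)

lemma scale_mat_mult_left: "scale_mat c A ** B = scale_mat c (A ** (B :: 'a::comm_ring_1^'k^'m))"
  by (simp add: vec_eq_iff matrix_matrix_mult_def sum_distrib_left mult.assoc)

lemma scale_mat_mult_right: "A ** scale_mat c B = scale_mat c (A ** (B :: 'a::comm_ring_1^'k^'m))"
  by (simp add: vec_eq_iff matrix_matrix_mult_def sum_distrib_left mult.left_commute)

lemma scale_mat_scale_mat: "scale_mat a (scale_mat b A) = scale_mat (a * b) (A :: 'a::comm_ring_1^'k^'m)"
  by (simp add: vec_eq_iff mult.assoc)

lemma scale_mat_1 [simp]: "scale_mat 1 A = A"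
  by (simp add: vec_eq_iff)

lemma scale_mat_vec: "scale_mat c A *v x = c *s (A *v (x :: 'a::comm_ring_1^'m))"
  by (simp add: vec_eq_iff matrix_vector_mult_def sum_distrib_left mult.assoc)

lemma matrix_minus_left: "(A - B) ** C = A ** C - B ** (C :: 'a::comm_ring_1^'k^'m)"
  by (simp add: vec_eq_iff matrix_matrix_mult_def left_diff_distrib sum_subtractf)

lemma matrix_minus_right: "C ** (A - B) = C ** A - C ** (B :: 'a::comm_ring_1^'k^'m)"
  by (simp add: vec_eq_iff matrix_matrix_mult_def right_diff_distrib sum_subtractf)

lemma symp_J_nth [simp]:
  "symp_J $ Inl i $ Inl j = 0" "symp_J $ Inr i $ Inr j = 0"
  "symp_J $ Inl i $ Inr j = (if i = j then 1 else 0)"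
  "symp_J $ Inr i $ Inl j = (if i = j then - 1 else 0)"
  by (simp_all add: symp_J_def)

lemma sum_UNIV_plus: "(\<Sum>i\<in>(UNIV :: ('n::finite + 'n) set). f i) = (\<Sum>i\<in>UNIV. f (Inl i)) + (\<Sum>i\<in>UNIV. f (Inr i))"
proof -
  have "(UNIV :: ('n + 'n) set) = range Inl \<union> range Inr"
    by (auto simp: UNIV_sum)
  moreover have "sum f (range Inl \<union> range Inr) = sum f (range Inl) + sum f (range Inr)"
    by (rule sum.union_disjoint) auto
  ultimately have "sum f UNIV = sum f (range Inl) + sum f (range Inr)"
    by simp
  then show ?thesis
    by (simp add: sum.reindex)
qed

lemma sum_delta_mult:
  fixes f :: "'n::finite \<Rightarrow> 'a::comm_ring_1"
  shows "(\<Sum>k\<in>UNIV. (if i = k then c else 0) * f k) = c * f i"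
    "(\<Sum>k\<in>UNIV. (if k = i then c else 0) * f k) = c * f i"
    "(\<Sum>k\<in>UNIV. f k * (if i = k then c else 0)) = c * f i"
    "(\<Sum>k\<in>UNIV. f k * (if k = i then c else 0)) = c * f i"
proof -
  have *: "(if b then c else 0) * x = (if b then c * x else 0)" "x * (if b then c else 0) = (if b then c * x else 0)"
    for b and x :: 'a
    by simp_all
  show "(\<Sum>k\<in>UNIV. (if i = k then c else 0) * f k) = c * f i"
    "(\<Sum>k\<in>UNIV. (if k = i then c else 0) * f k) = c * f i"
    "(\<Sum>k\<in>UNIV. f k * (if i = k then c else 0)) = c * f i"
    "(\<Sum>k\<in>UNIV. f k * (if k = i then c else 0)) = c * f i"
    unfolding * by simp_all
qed

lemma matrix_mult_nth: "(A ** B) $ i $ j = (\<Sum>k\<in>UNIV. A $ i $ k * B $ k $ j)"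
  by (simp add: matrix_matrix_mult_def)

lemma transpose_nth [simp]: "transpose A $ i $ j = A $ j $ i"
  by (simp add: transpose_def)

lemma mat_nth: "mat c $ i $ j = (if i = j then c else 0)"
  by (simp add: mat_def)

lemma sadj_nth [simp]:
  "sadj A $ Inl i $ Inl j = A $ Inr j $ Inr i"
  "sadj A $ Inl i $ Inr j = - A $ Inl j $ Inr i"
  "sadj A $ Inr i $ Inl j = - A $ Inr j $ Inl i"
  "sadj A $ Inr i $ Inr j = A $ Inl j $ Inl i"
  by (simp_all add: sadj_def matrix_mult_nth sum_UNIV_plus sum_delta_mult sum_negf)

lemma forall_plus: "(\<forall>x :: 'n + 'n. P x) \<longleftrightarrow> (\<forall>i. P (Inl i)) \<and> (\<forall>i. P (Inr i))"
  by (metis sum.exhaust)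

lemma sadj_sadj [simp]: "sadj (sadj A) = A"
  by (simp add: vec_eq_iff forall_plus)

lemma symp_J_mult_transpose: "symp_J ** transpose symp_J = (mat 1 :: ('a::comm_ring_1, 'n::finite) mat_2n)"
  "transpose symp_J ** symp_J = (mat 1 :: ('a::comm_ring_1, 'n::finite) mat_2n)"
  by (simp_all add: vec_eq_iff forall_plus matrix_mult_nth sum_UNIV_plus mat_nth sum_delta_mult sum_negf)

lemma sadj_mult: "sadj (A ** B) = sadj B ** sadj A"
proof -
  have "sadj B ** sadj A = symp_J ** transpose B ** (transpose symp_J ** symp_J) ** transpose A ** transpose symp_J"
    by (simp only: sadj_def matrix_mul_assoc)
  then show ?thesis
    by (simp add: symp_J_mult_transpose sadj_def matrix_transpose_mul matrix_mul_assoc)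
qed

lemma sadj_mat [simp]: "sadj (mat c) = mat c"
  by (simp add: vec_eq_iff forall_plus mat_def)

text \<open>J and its transpose are inverse to each other, so right multiplication by either one
  passes between the two equations.\<close>

lemma sim_iff_sadj: "X ** symp_J ** transpose X = scale_mat c symp_J \<longleftrightarrow> X ** sadj X = mat c"
proof -
  have "X ** sadj X = (X ** symp_J ** transpose X) ** transpose symp_J"
    by (simp add: sadj_def matrix_mul_assoc)
  moreover have "mat c = scale_mat c symp_J ** transpose symp_J"
    by (simp add: scale_mat_mult_left symp_J_mult_transpose) (simp add: vec_eq_iff mat_def)
  moreover have "A = B" if "A ** transpose symp_J = B ** transpose symp_J" for A B :: "('a, 'b) mat_2n"
    using arg_cong[OF that, of "\<lambda>x. x ** symp_J"]
    by (simp only: matrix_mul_assoc[symmetric] symp_J_mult_transpose matrix_mul_rid)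
  ultimately show ?thesis by metis
qed

subsection \<open>Congruences of matrices\<close>

lemma reduce_mat_nth [simp]: "reduce_mat q A $ i $ j = A $ i $ j mod q"
  by (simp add: reduce_mat_def)

lemma reduce_mat_eq_iff: "reduce_mat q A = reduce_mat q B \<longleftrightarrow> (\<forall>i j. q dvd A $ i $ j - B $ i $ j)"
  by (simp add: vec_eq_iff mod_eq_dvd_iff)

lemma reduce_mat_idem [simp]: "reduce_mat q (reduce_mat q A) = reduce_mat q A"
  by (simp add: vec_eq_iff)

lemma reduce_mat_reduce_mat: "q dvd q' \<Longrightarrow> reduce_mat q (reduce_mat q' A) = reduce_mat q A"
  by (simp add: vec_eq_iff mod_mod_cancel)

lemma reduce_mat_dvd: "reduce_mat q A = reduce_mat q B \<Longrightarrow> q' dvd q \<Longrightarrow> reduce_mat q' A = reduce_mat q' B"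
  by (metis reduce_mat_reduce_mat)

lemma reduce_mat_mult_cong:
  assumes "reduce_mat q A = reduce_mat q A'" "reduce_mat q B = reduce_mat q B'"
  shows "reduce_mat q (A ** B) = reduce_mat q (A' ** B')"
proof -
  have "[(\<Sum>k\<in>UNIV. A$i$k * B$k$j) = (\<Sum>k\<in>UNIV. A'$i$k * B'$k$j)] (mod q)" for i j
    using assms by (intro cong_sum cong_mult) (auto simp: vec_eq_iff cong_def)
  then show ?thesis
    by (simp add: vec_eq_iff matrix_matrix_mult_def cong_def)
qed

lemma reduce_mat_mult_left [simp]: "reduce_mat q (reduce_mat q A ** B) = reduce_mat q (A ** B)"
  by (rule reduce_mat_mult_cong) simp_all

lemma reduce_mat_mult_right [simp]: "reduce_mat q (A ** reduce_mat q B) = reduce_mat q (A ** B)"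
  by (rule reduce_mat_mult_cong) simp_all

lemma reduce_mat_transpose [simp]: "transpose (reduce_mat q A) = reduce_mat q (transpose A)"
  by (simp add: vec_eq_iff transpose_def)

lemma reduce_mat_sadj_cong: "reduce_mat q A = reduce_mat q B \<Longrightarrow> reduce_mat q (sadj A) = reduce_mat q (sadj B)"
  unfolding sadj_def by (intro reduce_mat_mult_cong) (auto simp flip: reduce_mat_transpose)

lemma reduce_mat_sadj [simp]: "reduce_mat q (sadj (reduce_mat q A)) = reduce_mat q (sadj A)"
  by (rule reduce_mat_sadj_cong) simp

lemma reduce_mat_scale_cancel:
  assumes "c \<noteq> 0"
  shows "reduce_mat (c * q) (scale_mat c A) = reduce_mat (c * q) (scale_mat c B) \<longleftrightarrow> reduce_mat q A = reduce_mat q B"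
  using assms by (simp add: reduce_mat_eq_iff flip: right_diff_distrib)

lemma det_cong:
  fixes A B :: "int^'m^'m"
  assumes "reduce_mat q A = reduce_mat q B"
  shows "[det A = det B] (mod q)"
  unfolding det_def using assms
  by (intro cong_sum cong_mult cong_prod) (auto simp: vec_eq_iff cong_def)

lemma det_map_of_int: "det (map_matrix of_int A :: rat^'m^'m) = of_int (det (A :: int^'m^'m))"
  by (simp add: det_def)

lemma det_mat: "det (mat c :: int^'m^'m) = c ^ CARD('m)"
  by (subst det_diagonal) (auto simp: mat_def)

text \<open>Cramer's rule: replacing row \<open>j\<close> of \<open>A\<close> by row
  \<open>i\<close> of \<open>Z ** A\<close>, a combination of the rows of \<open>A\<close>,
  multiplies the determinant by \<open>Z $ i $ j\<close>; and the new determinant is divisible by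
  \<open>q\<close> because a whole row is. The case \<open>q = 0\<close> is used as well.\<close>

lemma left_annihilator_dvd_det:
  fixes Z A :: "int^'m^'m"
  assumes "\<And>i j. q dvd (Z ** A) $ i $ j"
  shows "q dvd Z $ i $ j * det A"
proof -
  let ?h = "map_matrix of_int :: int^'m^'m \<Rightarrow> rat^'m^'m"
  define B :: "int^'m^'m" where "B = (\<chi> k. if k = j then (Z ** A) $ i else A $ k)"
  have *: "?h B = (\<chi> k. if k = j then sum (\<lambda>k. (?h Z $ i) $ k *s row k (?h A)) UNIV else row k (?h A))"
    by (simp add: vec_eq_iff B_def row_def matrix_matrix_mult_def sum_component)
  have "of_int (det B) = (of_int (Z $ i $ j * det A) :: rat)"
    unfolding det_map_of_int[symmetric] * cramer_lemma_transpose by (simp add: det_map_of_int)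
  then have "det B = Z $ i $ j * det A"
    by (simp only: of_int_eq_iff)
  moreover have "q dvd det B"
  proof -
    have "q dvd (\<Prod>k\<in>UNIV. B $ k $ \<pi> k)" for \<pi> :: "'m \<Rightarrow> 'm"
      using assms by (intro dvd_trans[OF _ dvd_prodI[of _ j]]) (auto simp: B_def)
    then show ?thesis
      unfolding det_def by (intro dvd_sum dvd_mult) auto
  qed
  ultimately show ?thesis by simp
qed

subsection \<open>Matrices over the p-adic integers\<close>

lemma padic_mats_reduce:
  assumes "X \<in> padic_mats p" "k \<le> m"
  shows "X k = reduce_mat (int p ^ k) (X m)"
  using assms(2)
proof (induction m rule: dec_induct)
  case base
  have "X k = reduce_mat (int p ^ k) (X (Suc k))"
    using assms(1) unfolding padic_mats_def by blast
  then show ?case by (metis reduce_mat_idem)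
next
  case (step m)
  have "X m = reduce_mat (int p ^ m) (X (Suc m))"
    using assms(1) unfolding padic_mats_def by blast
  then show ?case using step by (metis reduce_mat_reduce_mat le_imp_power_dvd)
qed

lemma padic_mats_self: "X \<in> padic_mats p \<Longrightarrow> reduce_mat (int p ^ k) (X k) = X k"
  using padic_mats_reduce[of X p k k] by simp

lemma padic_matsI:
  assumes "\<And>k. X k = reduce_mat (int p ^ k) (Y k)"
    and "\<And>k. reduce_mat (int p ^ k) (Y k) = reduce_mat (int p ^ k) (Y (Suc k))"
  shows "X \<in> padic_mats p"
  using assms(1) by (simp add: padic_mats_def reduce_mat_reduce_mat assms(2)[symmetric])

lemma padic_mats_Suc: "X \<in> padic_mats p \<Longrightarrow> reduce_mat (int p ^ k) (X (Suc k)) = reduce_mat (int p ^ k) (X k)"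
  by (metis padic_mats_self padic_mats_reduce le_SucI order_refl)

lemma padic_mult_in [simp, intro]:
  assumes "X \<in> padic_mats p" "Y \<in> padic_mats p"
  shows "padic_mult p X Y \<in> padic_mats p"
  by (rule padic_matsI[where Y = "\<lambda>k. X k ** Y k"])
    (use assms in \<open>auto simp: padic_mult_def intro: reduce_mat_mult_cong[OF padic_mats_Suc[symmetric] padic_mats_Suc[symmetric]]\<close>)

lemma padic_of_int_in [simp, intro]: "padic_of_int p g \<in> padic_mats p"
  by (rule padic_matsI[where Y = "\<lambda>k. g"]) (auto simp: padic_of_int_def)

lemma padic_mult_assoc: "padic_mult p (padic_mult p X Y) Z = padic_mult p X (padic_mult p Y Z)"
  by (simp add: padic_mult_def matrix_mul_assoc)

lemma padic_of_int_mult: "padic_mult p (padic_of_int p g) (padic_of_int p h) = padic_of_int p (g ** h)"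
  by (simp add: padic_mult_def padic_of_int_def)

lemma padic_mult_1 [simp]:
  "X \<in> padic_mats p \<Longrightarrow> padic_mult p (padic_of_int p (mat 1)) X = X"
  "X \<in> padic_mats p \<Longrightarrow> padic_mult p X (padic_of_int p (mat 1)) = X"
  by (simp_all add: padic_mult_def padic_of_int_def padic_mats_self)

text \<open>\<open>sadj\<close> changes signs, so the entries have to be brought back to residues in
  the standard range.\<close>

definition padj :: "nat \<Rightarrow> ('n::finite + 'n) padic_mat \<Rightarrow> ('n + 'n) padic_mat" where
  "padj p X = (\<lambda>k. reduce_mat (int p ^ k) (sadj (X k)))"

lemma padj_in [simp, intro]: "X \<in> padic_mats p \<Longrightarrow> padj p X \<in> padic_mats p"
  by (rule padic_matsI[where Y = "\<lambda>k. sadj (X k)"])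
    (auto simp: padj_def intro: reduce_mat_sadj_cong[OF padic_mats_Suc[symmetric]])

lemma padj_padj [simp]: "X \<in> padic_mats p \<Longrightarrow> padj p (padj p X) = X"
  by (simp add: padj_def padic_mats_self)

lemma padj_mult: "padj p (padic_mult p X Y) = padic_mult p (padj p Y) (padj p X)"
  by (simp add: padj_def padic_mult_def sadj_mult)

lemma padj_of_int: "padj p (padic_of_int p g) = padic_of_int p (sadj g)"
  by (simp add: padj_def padic_of_int_def)

text \<open>The factor is p^e itself, not a unit multiple of it; for e = 0 this is the group K
  (\<open>Sp_padic_eq\<close>).\<close>

definition Sim :: "nat \<Rightarrow> nat \<Rightarrow> ('n::finite + 'n) padic_mat set" where
  "Sim p e = {X \<in> padic_mats p. padic_mult p X (padj p X) = padic_of_int p (mat (int p ^ e))}"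

lemma mat_mult_eq: "mat c ** A = scale_mat c (A :: 'a::comm_ring_1^'k^'m)" "B ** mat c = scale_mat c (B :: 'a::comm_ring_1^'m^'k)"
  by (simp_all add: vec_eq_iff matrix_mult_nth mat_nth sum_delta_mult)

lemma padic_scalar_comm:
  assumes "X \<in> padic_mats p"
  shows "padic_mult p (padic_of_int p (mat c)) X = padic_mult p X (padic_of_int p (mat c))"
  by (simp add: padic_mult_def padic_of_int_def mat_mult_eq)

text \<open>The p-adic integers are torsion free: level k of X and Y is recovered from the
  hypothesis at level e + k, where p^e can be cancelled.\<close>

lemma padic_scalar_cancel:
  assumes "prime p" "X \<in> padic_mats p" "Y \<in> padic_mats p"
    and "padic_mult p (padic_of_int p (mat (int p ^ e))) X = padic_mult p (padic_of_int p (mat (int p ^ e))) Y"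
  shows "X = Y"
proof
  fix k
  have p0: "int p ^ e \<noteq> 0" using assms(1) by (simp add: prime_gt_0_nat)
  have "reduce_mat (int p ^ (e + k)) (scale_mat (int p ^ e) (X (e + k))) = reduce_mat (int p ^ (e + k)) (scale_mat (int p ^ e) (Y (e + k)))"
    using fun_cong[OF assms(4), of "e + k"] by (simp add: padic_mult_def padic_of_int_def mat_mult_eq)
  then have "reduce_mat (int p ^ k) (X (e + k)) = reduce_mat (int p ^ k) (Y (e + k))"
    unfolding power_add by (simp add: reduce_mat_scale_cancel[OF p0])
  then show "X k = Y k"
    using assms(2,3) padic_mats_reduce by (metis le_add2)
qed

text \<open>The defect Z = B A - p^e satisfies Z B = B (A B - p^e) = 0, so det B kills Z, and det A
  det B is a power of p, which can be cancelled.\<close>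

lemma padic_factor_commute:
  fixes A B :: "'m::finite padic_mat"
  assumes "prime p" "A \<in> padic_mats p" "B \<in> padic_mats p"
    and AB: "padic_mult p A B = padic_of_int p (mat (int p ^ e))"
  shows "padic_mult p B A = padic_of_int p (mat (int p ^ e))"
proof
  fix k
  \<comment> \<open>p^m is the determinant of the scalar matrix p^e. Cancelling it costs m levels,
    hence the computation at level m + k.\<close>
  define m where "m = e * CARD('m)"
  define l where "l = m + k"
  let ?q = "int p ^ l"
  have p0: "int p ^ m \<noteq> 0" using assms(1) by (simp add: prime_gt_0_nat)
  have ABl: "reduce_mat ?q (A l ** B l) = reduce_mat ?q (mat (int p ^ e))"
    using fun_cong[OF AB, of l] by (simp add: padic_mult_def padic_of_int_def)
  define Z where "Z = B l ** A l - mat (int p ^ e)"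
  have "Z ** B l = B l ** (A l ** B l) - B l ** mat (int p ^ e)"
    by (simp add: Z_def matrix_minus_left matrix_mul_assoc mat_mult_eq)
  also have "\<dots> = B l ** (A l ** B l - mat (int p ^ e))"
    by (simp add: matrix_minus_right)
  finally have "Z ** B l = B l ** (A l ** B l - mat (int p ^ e))" .
  moreover have "reduce_mat ?q (B l ** (A l ** B l - mat (int p ^ e))) = reduce_mat ?q (B l ** 0)"
    using ABl by (intro reduce_mat_mult_cong) (auto simp: reduce_mat_eq_iff)
  moreover have "B l ** 0 = 0"
    by (simp add: vec_eq_iff matrix_mult_nth)
  ultimately have *: "?q dvd (Z ** B l) $ i $ j" for i j
    by (simp add: reduce_mat_eq_iff)
  have dvd: "int p ^ m * int p ^ k dvd int p ^ m * Z $ i $ j" for i j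
  proof -
    have "[det (A l) * det (B l) = int p ^ m] (mod ?q)"
      using det_cong[OF ABl] by (simp add: det_mul det_mat m_def power_mult)
    then have "[Z $ i $ j * (det (A l) * det (B l)) = Z $ i $ j * int p ^ m] (mod ?q)"
      by (rule cong_mult[OF cong_refl])
    moreover have "?q dvd Z $ i $ j * (det (A l) * det (B l))"
      using left_annihilator_dvd_det[OF *, of i j] by (auto simp: mult.left_commute)
    ultimately have "?q dvd Z $ i $ j * int p ^ m"
      using cong_dvd_iff by blast
    then show ?thesis
      by (simp add: l_def power_add mult.commute)
  qed
  have "int p ^ k dvd Z $ i $ j" for i j
    using dvd[of i j] p0 by (metis dvd_mult_cancel_left)
  then have "reduce_mat (int p ^ k) (B l ** A l) = reduce_mat (int p ^ k) (mat (int p ^ e))"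
    by (simp add: reduce_mat_eq_iff Z_def)
  moreover have "reduce_mat (int p ^ k) (B l ** A l) = reduce_mat (int p ^ k) (B k ** A k)"
    using assms(2,3) by (intro reduce_mat_mult_cong)
      (metis l_def le_add2 padic_mats_reduce reduce_mat_idem)+
  ultimately show "padic_mult p B A k = padic_of_int p (mat (int p ^ e)) k"
    by (simp add: padic_mult_def padic_of_int_def)
qed

subsection \<open>The symplectic form on integral vectors\<close>

type_synonym 'n zvec = "int ^ ('n + 'n)"

abbreviation ee :: "'n \<Rightarrow> 'n::finite zvec" where "ee i \<equiv> axis (Inl i) 1"
abbreviation ff :: "'n \<Rightarrow> 'n::finite zvec" where "ff i \<equiv> axis (Inr i) 1"

definition omega :: "'n::finite zvec \<Rightarrow> 'n zvec \<Rightarrow> int" where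
  "omega x y = (\<Sum>i\<in>UNIV. x $ Inl i * y $ Inr i - x $ Inr i * y $ Inl i)"

lemma omega_bilinear:
  "omega (x + x') y = omega x y + omega x' y" "omega x (y + y') = omega x y + omega x y'"
  "omega (x - x') y = omega x y - omega x' y" "omega x (y - y') = omega x y - omega x y'"
  "omega (c *s x) y = c * omega x y" "omega x (c *s y) = c * omega x y"
  by (simp_all add: omega_def algebra_simps sum_distrib_left sum.distrib sum_subtractf)

lemma omega_sym: "omega x y = - omega y x"
  by (simp add: omega_def sum_negf[symmetric] mult.commute)

lemma omega_self [simp]: "omega x x = 0"
  by (simp add: omega_def mult.commute)

lemma axis_nth_if: "axis a c $ b = (if b = a then c else 0)"
  by (simp add: axis_def)

lemma omega_axis [simp]:
  "omega (ee i) x = x $ Inr i" "omega (ff i) x = - x $ Inl i"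
  "omega x (ff i) = x $ Inl i" "omega x (ee i) = - x $ Inr i"
  by (simp_all add: omega_def axis_nth_if sum_delta_mult sum_subtractf sum_negf)

lemma omega_eq_J: "omega x y = (\<Sum>b\<in>UNIV. x $ b * (symp_J *v y) $ b)"
  by (simp add: omega_def sum_UNIV_plus matrix_vector_mult_def sum_delta_mult sum.distrib sum_subtractf
      sum_negf)

lemma symp_J_sadj: "symp_J ** sadj A = transpose A ** symp_J"
  by (simp add: vec_eq_iff forall_plus matrix_mult_nth sum_UNIV_plus sum_delta_mult sum_negf)

text \<open>\<open>sadj A\<close> is the adjoint of \<open>A\<close> for the symplectic form, by
  \<open>symp_J_sadj\<close>. Applied to basis vectors this exchanges columns of \<open>A\<close>
  with rows of it.\<close>

lemma omega_mult: "omega (A *v x) y = omega x (sadj A *v y)"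
proof -
  define w where "w = symp_J *v y"
  have "omega (A *v x) y = (\<Sum>b\<in>UNIV. (A *v x) $ b * w $ b)"
    by (simp add: omega_eq_J w_def)
  also have "\<dots> = (\<Sum>b\<in>UNIV. \<Sum>c\<in>UNIV. x $ c * (A $ b $ c * w $ b))"
    by (simp add: matrix_vector_mult_def sum_distrib_left sum_distrib_right mult_ac)
  also have "\<dots> = (\<Sum>c\<in>UNIV. x $ c * (transpose A *v w) $ c)"
    by (subst sum.swap) (simp add: matrix_vector_mult_def[of "transpose A"] sum_distrib_left del: transpose_matrix_vector)
  also have "transpose A *v w = symp_J *v (sadj A *v y)"
    by (simp add: w_def matrix_vector_mul_assoc symp_J_sadj del: transpose_matrix_vector)
  finally show ?thesis by (simp add: omega_eq_J)
qed

section \<open>Congruences of integral vectors\<close>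

definition vcong :: "int \<Rightarrow> int ^ 'm::finite \<Rightarrow> int ^ 'm \<Rightarrow> bool" where
  "vcong q x y \<longleftrightarrow> (\<forall>b. q dvd x $ b - y $ b)"

lemma vcong_refl [simp, intro]: "vcong q x x"
  by (simp add: vcong_def)

lemma vcong_sym: "vcong q x y \<Longrightarrow> vcong q y x"
  by (simp add: vcong_def dvd_diff_commute)

lemma vcong_trans [trans]: "vcong q x y \<Longrightarrow> vcong q y z \<Longrightarrow> vcong q x z"
  unfolding vcong_def by (metis diff_add_cancel dvd_add add_diff_eq)

lemma vcong_dvd: "vcong q x y \<Longrightarrow> q' dvd q \<Longrightarrow> vcong q' x y"
  unfolding vcong_def by (meson dvd_trans)

lemma vcong_scale: "vcong q x y \<Longrightarrow> vcong q (c *s x) (c *s y)"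
  by (simp add: vcong_def flip: right_diff_distrib)

lemma vcong_mult: "vcong q x y \<Longrightarrow> vcong q (A *v x) (A *v y)"
  unfolding vcong_def matrix_vector_mult_def
  by (auto simp: right_diff_distrib[symmetric] sum_subtractf[symmetric] intro!: dvd_sum)

lemma vcong_matrix: "reduce_mat q A = reduce_mat q B \<Longrightarrow> vcong q (A *v x) (B *v x)"
  unfolding vcong_def matrix_vector_mult_def reduce_mat_eq_iff
  by (auto simp: left_diff_distrib[symmetric] sum_subtractf[symmetric] intro!: dvd_sum)

lemma vcong_matrixI:
  fixes A B :: "(int, 'n::finite) mat_2n"
  assumes "\<And>i. vcong q (A *v ee i) (B *v ee i)" "\<And>i. vcong q (A *v ff i) (B *v ff i)"
  shows "reduce_mat q A = reduce_mat q B"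
proof -
  have "(C *v axis b 1) $ a = C $ a $ b" for C :: "(int, 'n) mat_2n" and a b
    by (simp add: matrix_vector_mult_def axis_nth_if sum_delta_mult)
  then show ?thesis
    using assms by (simp add: reduce_mat_eq_iff forall_plus vcong_def)
qed

lemma omega_cong:
  assumes "vcong q x x'" "vcong q y y'"
  shows "[omega x y = omega x' y'] (mod q)"
  unfolding omega_def using assms
  by (intro cong_sum cong_diff cong_mult) (auto simp: vcong_def cong_iff_dvd_diff)

subsection \<open>Transvections\<close>

definition transvection :: "'n::finite zvec \<Rightarrow> int \<Rightarrow> (int, 'n) mat_2n" where
  "transvection v t = (\<chi> a b. (if a = b then 1 else 0) + t * v $ a * omega v (axis b 1))"

lemma omega_expand: "omega v x = (\<Sum>b\<in>UNIV. omega v (axis b 1) * x $ b)"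
  by (simp add: sum_UNIV_plus omega_def[of v x] sum_subtractf sum_negf)

lemma transvection_apply: "transvection v t *v x = x + (t * omega v x) *s v"
proof -
  have "(\<Sum>b\<in>UNIV. (t * v $ a * omega v (axis b 1)) * x $ b) = t * v $ a * omega v x" for a
    by (subst omega_expand) (simp add: sum_distrib_left mult.assoc)
  then show ?thesis
    by (simp add: vec_eq_iff transvection_def matrix_vector_mult_def distrib_right sum.distrib sum_delta_mult)
qed

lemma sadj_transvection: "sadj (transvection v t) = transvection v (- t)"
  by (simp add: vec_eq_iff forall_plus transvection_def)

lemma transvection_inverse: "transvection v t ** transvection v (- t) = mat 1"
  by (simp add: matrix_eq matrix_vector_mul_assoc[symmetric] transvection_apply omega_bilinear vector_smult_lneg)

inductive_set transv_group :: "nat \<Rightarrow> (int, 'n::finite) mat_2n set" for N where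
  one: "mat 1 \<in> transv_group N"
| step: "A \<in> transv_group N \<Longrightarrow> int N dvd t \<Longrightarrow> transvection v t ** A \<in> transv_group N"

lemma transv_group_mult: "A \<in> transv_group N \<Longrightarrow> B \<in> transv_group N \<Longrightarrow> A ** B \<in> transv_group N"
  by (induction rule: transv_group.induct) (auto simp: matrix_mul_assoc[symmetric] intro: transv_group.step)

lemma transvection_in_transv_group: "int N dvd t \<Longrightarrow> transvection v t \<in> transv_group N"
  using transv_group.step[OF transv_group.one] by simp

lemma transv_group_sadj: "A \<in> transv_group N \<Longrightarrow> sadj A \<in> transv_group N"
  by (induction rule: transv_group.induct) (auto simp: sadj_mult sadj_transvection intro: transv_group.one intro!: transv_group_mult transvection_in_transv_group)

lemma transv_group_inverse: "A \<in> transv_group N \<Longrightarrow> A ** sadj A = mat 1"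
proof (induction rule: transv_group.induct)
  case (step A t v)
  have "transvection v t ** A ** sadj (transvection v t ** A) = transvection v t ** (A ** sadj A) ** transvection v (- t)"
    by (simp add: sadj_mult sadj_transvection matrix_mul_assoc)
  then show ?case by (simp add: step transvection_inverse)
qed simp

lemma transv_group_inverse': "A \<in> transv_group N \<Longrightarrow> sadj A ** A = mat 1"
  using transv_group_inverse[OF transv_group_sadj] by simp

lemma transv_group_cong_1: "A \<in> transv_group N \<Longrightarrow> reduce_mat (int N) A = reduce_mat (int N) (mat 1)"
proof (induction rule: transv_group.induct)
  case (step A t v)
  have "reduce_mat (int N) (transvection v t) = reduce_mat (int N) (mat 1)"
    using step(2) by (simp add: reduce_mat_eq_iff transvection_def mat_nth)
  then show ?case using reduce_mat_mult_cong[OF _ step(3)] by fastforce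
qed simp

text \<open>Orthogonality modulo q to the hyperbolic planes spanned by e_i and f_i with i in S. The
  value \<open>q = 0\<close> stands for exact vanishing.\<close>

definition off :: "int \<Rightarrow> 'n set \<Rightarrow> 'n::finite zvec \<Rightarrow> bool" where
  "off q S x \<longleftrightarrow> (\<forall>i\<in>S. q dvd x $ Inl i \<and> q dvd x $ Inr i)"

definition transv_fix :: "nat \<Rightarrow> int \<Rightarrow> 'n set \<Rightarrow> (int, 'n::finite) mat_2n set" where
  "transv_fix N q S = {A \<in> transv_group N. \<forall>i\<in>S. vcong q (A *v ee i) (ee i) \<and> vcong q (A *v ff i) (ff i)}"

lemma transv_fix_transv_group: "A \<in> transv_fix N q S \<Longrightarrow> A \<in> transv_group N"
  by (simp add: transv_fix_def)

lemma vcong_mult_trans: "vcong q (B *v x) y \<Longrightarrow> vcong q (A *v y) z \<Longrightarrow> vcong q ((A ** B) *v x) z"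
  by (metis vcong_mult vcong_trans matrix_vector_mul_assoc)

lemma transv_fix_mult: "A \<in> transv_fix N q S \<Longrightarrow> B \<in> transv_fix N q S \<Longrightarrow> A ** B \<in> transv_fix N q S"
  unfolding transv_fix_def by (auto intro: transv_group_mult vcong_mult_trans)

lemma transv_group_fix_sadj:
  assumes "A \<in> transv_group N" "vcong q (A *v x) y"
  shows "vcong q (sadj A *v y) x"
proof -
  have "vcong q (sadj A *v (A *v x)) (sadj A *v y)"
    using assms(2) by (rule vcong_mult)
  then show ?thesis
    using transv_group_inverse'[OF assms(1)] by (simp add: matrix_vector_mul_assoc vcong_sym)
qed

lemma transv_fix_sadj: "A \<in> transv_fix N q S \<Longrightarrow> sadj A \<in> transv_fix N q S"
  unfolding transv_fix_def by (auto intro: transv_group_sadj transv_group_fix_sadj)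

text \<open>Up to sign, the coordinates of \<open>A *v x\<close> in a plane of S are its pairings
  with e_i and f_i; moving A across the form leaves its adjoint, which fixes e_i and f_i modulo
  q.\<close>

lemma off_transv_fix:
  assumes "A \<in> transv_fix N q S" "off q S x"
  shows "off q S (A *v x)"
  unfolding off_def
proof
  fix i assume i: "i \<in> S"
  have "[omega (sadj A *v ee i) x = omega (ee i) x] (mod q)" "[omega (sadj A *v ff i) x = omega (ff i) x] (mod q)"
    using transv_fix_sadj[OF assms(1)] i by (auto simp: transv_fix_def simp del: omega_axis intro!: omega_cong)
  then have "[(A *v x) $ Inr i = x $ Inr i] (mod q)" "[- (A *v x) $ Inl i = - x $ Inl i] (mod q)"
    by (simp_all add: omega_mult)
  then show "q dvd (A *v x) $ Inl i \<and> q dvd (A *v x) $ Inr i"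
    using assms(2) i unfolding off_def by (metis cong_dvd_iff dvd_minus_iff)
qed

text \<open>
  The transvection along \<open>y - x\<close> with parameter \<open>1 / omega y x\<close> maps \<open>x\<close> to \<open>y\<close>; modulo \<open>q\<close> the
  parameter can be taken divisible by \<open>N\<close>.
\<close>

lemma transvection_move:
  assumes "coprime (int N) q" "coprime (omega x y) q"
  obtains A where "A \<in> transv_group N" "vcong q (A *v x) y"
    "\<And>z. [omega z x = omega z y] (mod q) \<Longrightarrow> vcong q (A *v z) z"
proof -
  have "coprime (int N * omega y x) q"
    using assms omega_sym[of y x] by simp
  then obtain s where s: "[int N * omega y x * s = 1] (mod q)"
    using cong_solve_coprime_int by blast
  define A where "A = transvection (y - x) (int N * s)"
  have 1: "A \<in> transv_group N"
    by (simp add: A_def transvection_in_transv_group)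
  have "q dvd int N * s * omega (y - x) x - 1"
    using s by (simp add: omega_bilinear cong_iff_dvd_diff mult_ac)
  moreover have "(A *v x) $ b - y $ b = (int N * s * omega (y - x) x - 1) * (y - x) $ b" for b
    by (simp add: A_def transvection_apply algebra_simps)
  ultimately have 2: "vcong q (A *v x) y"
    by (simp add: vcong_def)
  have "vcong q (A *v z) z" if "[omega z x = omega z y] (mod q)" for z
  proof -
    have "q dvd omega (y - x) z"
      using that omega_sym[of z x] omega_sym[of z y]
      by (simp add: omega_bilinear cong_iff_dvd_diff)
    then show ?thesis
      by (simp add: vcong_def A_def transvection_apply)
  qed
  with 1 2 that show thesis by blast
qed

text \<open>Basis vectors of the planes in S pair to 0 modulo q with both x and y, so by the last
  property of \<open>transvection_move\<close> they are fixed.\<close>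

lemma transv_fix_move:
  assumes "coprime (int N) q" "off q S x" "off q S y" "coprime (omega x y) q"
  obtains A where "A \<in> transv_fix N q S" "vcong q (A *v x) y"
    "\<And>z. [omega z x = omega z y] (mod q) \<Longrightarrow> vcong q (A *v z) z"
proof -
  obtain A where A: "A \<in> transv_group N" "vcong q (A *v x) y"
    "\<And>z. [omega z x = omega z y] (mod q) \<Longrightarrow> vcong q (A *v z) z"
    using transvection_move[OF assms(1,4)] by blast
  have "[x $ Inr i = y $ Inr i] (mod q)" "[- x $ Inl i = - y $ Inl i] (mod q)" if "i \<in> S" for i
    using assms(2,3) that by (auto simp: off_def cong_iff_dvd_diff intro: dvd_diff)
  then have "A \<in> transv_fix N q S"
    using A(1) by (auto simp: transv_fix_def intro!: A(3))
  with A that show thesis by blast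
qed

text \<open>The transvection along y - x needs \<open>omega x y\<close> to be a unit. Where it is
  not, a detour through z uses two transvections; only the pairings of z with x and with y must be
  units.\<close>

lemma transv_fix_move2:
  assumes "coprime (int N) q" "off q S x" "off q S z" "off q S y"
    "coprime (omega x z) q" "coprime (omega z y) q"
  obtains A where "A \<in> transv_fix N q S" "vcong q (A *v x) y"
    "\<And>w. [omega w x = omega w z] (mod q) \<Longrightarrow> [omega w z = omega w y] (mod q) \<Longrightarrow> vcong q (A *v w) w"
proof -
  obtain A where A: "A \<in> transv_fix N q S" "vcong q (A *v x) z"
    "\<And>w. [omega w x = omega w z] (mod q) \<Longrightarrow> vcong q (A *v w) w"
    using transv_fix_move[OF assms(1-3,5)] by blast
  obtain B where B: "B \<in> transv_fix N q S" "vcong q (B *v z) y"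
    "\<And>w. [omega w z = omega w y] (mod q) \<Longrightarrow> vcong q (B *v w) w"
    using transv_fix_move[OF assms(1,3,4,6)] by blast
  show thesis
    by (rule that[of "B ** A"]) (use A B in \<open>auto intro: transv_fix_mult vcong_mult_trans\<close>)
qed

lemma coprime_prime_powerI: "prime p \<Longrightarrow> \<not> int p dvd a \<Longrightarrow> coprime a (int p ^ M)"
  by (metis coprime_commute coprime_power_right_iff prime_imp_coprime prime_nat_int_transfer)

text \<open>The direct move works if the f_i-coordinate of x is a unit. Otherwise the detour vector
  is f_i when the e_i-coordinate of x is a unit, and else f_i plus a basis vector of another plane
  that picks out a unit coordinate of x.\<close>

lemma transv_fix_to_ee:
  fixes x :: "'n::finite zvec"
  assumes p: "prime p" "\<not> p dvd N" and x: "off (int p ^ M) S x" "\<not> int p dvd x $ b" and M: "M > 0"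
    and i: "i \<notin> S"
  obtains A where "A \<in> transv_fix N (int p ^ M) S" "vcong (int p ^ M) (A *v x) (ee i)"
proof -
  note goal = that
  let ?q = "int p ^ M"
  have N: "coprime (int N) ?q"
    using p by (intro coprime_prime_powerI) auto
  have unit: "coprime a ?q" if "\<not> int p dvd a" for a
    using coprime_prime_powerI p(1) that .
  have off: "off ?q S (ee k)" "off ?q S (ff k)" if "k \<notin> S" for k
    using that by (auto simp: off_def axis_nth_if)
  have off_add: "off ?q S (y + z)" if "off ?q S y" "off ?q S z" for y z
    using that by (auto simp: off_def)
  have p1: "\<not> int p dvd 1" using p(1) not_prime_unit prime_nat_int_transfer by blast
  have via: thesis if "off ?q S z" "\<not> int p dvd omega x z" "\<not> int p dvd omega z (ee i)" for z
    by (rule transv_fix_move2[OF N x(1) that(1) off(1)[OF i] unit[OF that(2)] unit[OF that(3)]], rule goal)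
  have dvd_q: "int p dvd ?q" using M by simp
  \<comment> \<open>In the last two cases the e_i-coordinate of x is divisible by p, so the summand
    f_i of the detour vector does not spoil its unit pairing with x.\<close>
  consider "\<not> int p dvd x $ Inr i" | "\<not> int p dvd x $ Inl i"
    | k where "int p dvd x $ Inl i" "k \<noteq> i" "\<not> int p dvd x $ Inl k"
    | k where "int p dvd x $ Inl i" "k \<noteq> i" "\<not> int p dvd x $ Inr k"
    using x(2) by (cases b) metis+
  then show thesis
  proof cases
    case 1
    then have "coprime (omega x (ee i)) ?q"
      by (intro unit) simp
    then show thesis
      by (rule transv_fix_move[OF N x(1) off(1)[OF i]], intro goal)
  next
    case 2
    then show thesis
      using i p1 by (intro via[of "ff i"] off) (auto simp: axis_nth_if)
  next
    case (3 k)
    then have "k \<notin> S" using x(1) dvd_q by (auto simp: off_def dest: dvd_trans)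
    then show thesis
      using i p1 3 by (intro via[of "ff i + ff k"] off off_add)
        (auto simp: axis_nth_if omega_bilinear dvd_add_right_iff)
  next
    case (4 k)
    then have "k \<notin> S" using x(1) dvd_q by (auto simp: off_def dest: dvd_trans)
    then show thesis
      using i p1 4 by (intro via[of "ff i + ee k"] off off_add)
        (auto simp: axis_nth_if omega_bilinear dvd_diff_right_iff)
  qed
qed

text \<open>Completes a move of a hyperbolic pair without disturbing its first vector: e_i pairs to
  1 with u, with f_i and with the detour vector f_i + e_i, so each transvection used fixes e_i. The
  detour serves the case where the e_i-coordinate of u is not a unit.\<close>

lemma transv_fix_to_ff:
  fixes u :: "'n::finite zvec"
  assumes p: "prime p" "\<not> p dvd N" and u: "off (int p ^ M) S u" "[omega (ee i) u = 1] (mod int p ^ M)" and M: "M > 0"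
    and i: "i \<notin> S"
  obtains A where "A \<in> transv_fix N (int p ^ M) S" "vcong (int p ^ M) (A *v ee i) (ee i)" "vcong (int p ^ M) (A *v u) (ff i)"
proof -
  let ?q = "int p ^ M"
  have N: "coprime (int N) ?q"
    using p by (intro coprime_prime_powerI) auto
  have unit: "coprime a ?q" if "\<not> int p dvd a" for a
    using coprime_prime_powerI p(1) that .
  have off: "off ?q S (ff i)" "off ?q S (ff i + ee i)"
    using i by (auto simp: off_def axis_nth_if)
  have p1: "\<not> int p dvd 1" using p(1) not_prime_unit prime_nat_int_transfer by blast
  have dvd_q: "int p dvd ?q" using M by simp
  show thesis
  proof (cases "int p dvd u $ Inl i")
    case False
    then have "coprime (omega u (ff i)) ?q"
      by (intro unit) simp
    then obtain A where "A \<in> transv_fix N ?q S" "vcong ?q (A *v u) (ff i)"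
      "\<And>z. [omega z u = omega z (ff i)] (mod ?q) \<Longrightarrow> vcong ?q (A *v z) z"
      using transv_fix_move[OF N u(1) off(1)] by blast
    then show thesis
      using that u(2) by (simp add: axis_nth_if)
  next
    case True
    have "[u $ Inr i = 1] (mod int p)"
      using u(2) cong_dvd_modulus[OF _ dvd_q] by simp
    then have "\<not> int p dvd u $ Inr i"
      using p1 cong_dvd_iff by blast
    then have 1: "coprime (omega u (ff i + ee i)) ?q"
      using True by (intro unit) (simp add: omega_bilinear dvd_diff_right_iff)
    have 2: "coprime (omega (ff i + ee i) (ff i)) ?q"
      by (simp add: axis_nth_if)
    have 3: "omega (ee i) (ff i + ee i) = 1" "omega (ee i) (ff i) = 1"
      by (simp_all add: axis_nth_if)
    obtain A where A: "A \<in> transv_fix N ?q S" "vcong ?q (A *v u) (ff i)"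
      "\<And>w. [omega w u = omega w (ff i + ee i)] (mod ?q) \<Longrightarrow>
        [omega w (ff i + ee i) = omega w (ff i)] (mod ?q) \<Longrightarrow> vcong ?q (A *v w) w"
      by (rule transv_fix_move2[OF N u(1) off(2) off(1) 1 2]) blast
    have "vcong ?q (A *v ee i) (ee i)"
      by (rule A(3)) (use u(2) in \<open>unfold 3, auto\<close>)
    with A(1,2) show thesis by (intro that)
  qed
qed

subsection \<open>Reduction of similitudes to diagonal form\<close>

text \<open>The largest such w is the least valuation that X attains off the planes in S, that is,
  the exponent of the next pivot.\<close>

definition dvd_off :: "nat \<Rightarrow> nat \<Rightarrow> 'n set \<Rightarrow> (int, 'n::finite) mat_2n \<Rightarrow> bool" where
  "dvd_off p w S X \<longleftrightarrow> (\<forall>x. off 0 S x \<longrightarrow> (\<forall>b. int p ^ w dvd (X *v x) $ b))"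

lemma dvd_off_off:
  assumes "dvd_off p w S X" "off (int p ^ M) S x" "w \<le> M"
  shows "int p ^ w dvd (X *v x) $ b"
proof -
  define x0 :: "'a zvec" where "x0 = (\<chi> b. case b of Inl i \<Rightarrow> if i \<in> S then 0 else x $ b | Inr i \<Rightarrow> if i \<in> S then 0 else x $ b)"
  have "vcong (int p ^ M) x x0"
    using assms(2) by (auto simp: vcong_def forall_plus x0_def off_def)
  then have "vcong (int p ^ w) (X *v x) (X *v x0)"
    by (rule vcong_mult[OF vcong_dvd[OF _ le_imp_power_dvd[OF assms(3)]]])
  moreover have "int p ^ w dvd (X *v x0) $ b"
    using assms(1) by (auto simp: dvd_off_def off_def x0_def)
  ultimately show ?thesis
    unfolding vcong_def by (metis dvd_diff_left_iff)
qed

lemma dvd_off_transv_fix: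
  assumes "dvd_off p w S X" "\<sigma> \<in> transv_fix N (int p ^ M) S" "w \<le> M"
  shows "dvd_off p w S (\<tau> ** X ** \<sigma>)"
  unfolding dvd_off_def
proof (intro allI impI)
  fix x :: "'a zvec" and b assume "off 0 S x"
  then have "off (int p ^ M) S (\<sigma> *v x)"
    by (intro off_transv_fix[OF assms(2)]) (auto simp: off_def)
  from dvd_off_off[OF assms(1) this assms(3)] have "vcong (int p ^ w) (X *v (\<sigma> *v x)) 0"
    by (simp add: vcong_def)
  then have "vcong (int p ^ w) (\<tau> *v (X *v (\<sigma> *v x))) (\<tau> *v 0)"
    by (rule vcong_mult)
  then show "int p ^ w dvd ((\<tau> ** X ** \<sigma>) *v x) $ b"
    by (simp add: vcong_def matrix_vector_mul_assoc matrix_mul_assoc)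
qed

lemma dvd_off_mono: "dvd_off p w S X \<Longrightarrow> S \<subseteq> T \<Longrightarrow> dvd_off p w T X"
  by (auto simp: dvd_off_def off_def)

text \<open>Both orders are recorded, since commuting the factors as in
  \<open>padic_factor_commute\<close> would cost precision.\<close>

definition simmod :: "nat \<Rightarrow> nat \<Rightarrow> nat \<Rightarrow> (int, 'n::finite) mat_2n \<Rightarrow> bool" where
  "simmod p e M X \<longleftrightarrow> reduce_mat (int p ^ M) (X ** sadj X) = reduce_mat (int p ^ M) (mat (int p ^ e)) \<and>
     reduce_mat (int p ^ M) (sadj X ** X) = reduce_mat (int p ^ M) (mat (int p ^ e))"

text \<open>Since no inverses are available modulo \<open>p ^ M\<close>, the adjoint of \<open>X\<close> is carried along.\<close>

definition diagonal_on :: "nat \<Rightarrow> nat \<Rightarrow> nat \<Rightarrow> ('n \<Rightarrow> nat) \<Rightarrow> 'n set \<Rightarrow> (int, 'n::finite) mat_2n \<Rightarrow> bool" where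
  "diagonal_on p e M a S X \<longleftrightarrow> (\<forall>i\<in>S. 2 * a i \<le> e \<and>
     vcong (int p ^ M) (X *v ee i) (int p ^ a i *s ee i) \<and>
     vcong (int p ^ M) (X *v ff i) (int p ^ (e - a i) *s ff i) \<and>
     vcong (int p ^ M) (sadj X *v ee i) (int p ^ (e - a i) *s ee i) \<and>
     vcong (int p ^ M) (sadj X *v ff i) (int p ^ a i *s ff i) \<and>
     dvd_off p (a i) S X)"

lemma simmod_sadj: "simmod p e M X \<Longrightarrow> simmod p e M (sadj X)"
  by (simp add: simmod_def)

lemma mat_vec: "mat c *v x = c *s (x :: 'a::comm_ring_1^'m)"
  by (simp add: vec_eq_iff matrix_vector_mult_def mat_nth sum_delta_mult)

lemma matrix_vec_smult: "A *v (c *s x) = c *s (A *v (x :: 'a::comm_ring_1^'m))"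
  by (simp add: vec_eq_iff matrix_vector_mult_def sum_distrib_left mult.left_commute)

lemma simmod_transv_fix:
  fixes X \<tau> \<sigma> :: "(int, 'n::finite) mat_2n"
  assumes "simmod p e M X" "\<tau> \<in> transv_group N" "\<sigma> \<in> transv_group N"
  shows "simmod p e M (\<tau> ** X ** \<sigma>)"
proof -
  have *: "reduce_mat (int p ^ M) (\<tau> ** X ** \<sigma> ** sadj (\<tau> ** X ** \<sigma>)) = reduce_mat (int p ^ M) (mat (int p ^ e))"
    if X: "simmod p e M X" and t: "\<tau> ** sadj \<tau> = mat 1" and s: "\<sigma> ** sadj \<sigma> = mat 1" for X \<tau> \<sigma> :: "(int, 'n) mat_2n"
  proof -
    have "\<tau> ** X ** \<sigma> ** sadj (\<tau> ** X ** \<sigma>) = \<tau> ** X ** (\<sigma> ** sadj \<sigma>) ** sadj X ** sadj \<tau>"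
      by (simp add: sadj_mult matrix_mul_assoc)
    also have "\<dots> = \<tau> ** ((X ** sadj X) ** sadj \<tau>)"
      by (simp add: s matrix_mul_assoc)
    also have "reduce_mat (int p ^ M) \<dots> = reduce_mat (int p ^ M) (\<tau> ** (mat (int p ^ e) ** sadj \<tau>))"
      using X by (intro reduce_mat_mult_cong) (auto simp: simmod_def)
    also have "\<tau> ** (mat (int p ^ e) ** sadj \<tau>) = mat (int p ^ e)"
      by (simp add: mat_mult_eq scale_mat_mult_right t) (simp add: vec_eq_iff mat_nth)
    finally show ?thesis .
  qed
  have "sadj (\<tau> ** X ** \<sigma>) = sadj \<sigma> ** sadj X ** sadj \<tau>"
    by (simp add: sadj_mult matrix_mul_assoc)
  moreover from this have "sadj (sadj \<sigma> ** sadj X ** sadj \<tau>) = \<tau> ** X ** \<sigma>"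
    by (metis sadj_sadj)
  ultimately show ?thesis
    using *[OF assms(1) transv_group_inverse[OF assms(2)] transv_group_inverse[OF assms(3)]]
      *[OF simmod_sadj[OF assms(1)], of "sadj \<sigma>" "sadj \<tau>"] transv_group_inverse'[OF assms(2)] transv_group_inverse'[OF assms(3)]
    by (simp add: simmod_def)
qed

lemma simmod_le: "simmod p e M X \<Longrightarrow> M' \<le> M \<Longrightarrow> simmod p e M' X"
  unfolding simmod_def by (meson reduce_mat_dvd le_imp_power_dvd)

lemma simmod_apply:
  assumes "simmod p e M X"
  shows "vcong (int p ^ M) (X *v (sadj X *v x)) (int p ^ e *s x)" "vcong (int p ^ M) (sadj X *v (X *v x)) (int p ^ e *s x)"
  using assms
  by (auto simp: simmod_def matrix_vector_mul_assoc mat_vec[symmetric] intro: vcong_matrix)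

lemma diagonal_on_le: "diagonal_on p e M a S X \<Longrightarrow> M' \<le> M \<Longrightarrow> diagonal_on p e M' a S X"
  unfolding diagonal_on_def by (meson vcong_dvd le_imp_power_dvd)

lemma vcong_sandwich:
  assumes "vcong q (\<sigma> *v x) x" "vcong q (X *v x) (c *s x)" "vcong q (\<tau> *v x) x"
  shows "vcong q ((\<tau> ** X ** \<sigma>) *v x) (c *s x)"
proof -
  have "vcong q (\<tau> *v (X *v (\<sigma> *v x))) (\<tau> *v (X *v x))"
    by (intro vcong_mult assms)
  also have "vcong q (\<tau> *v (X *v x)) (\<tau> *v (c *s x))"
    by (intro vcong_mult assms)
  also have "\<tau> *v (c *s x) = c *s (\<tau> *v x)"
    by (rule matrix_vec_smult)
  also have "vcong q \<dots> (c *s x)"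
    by (intro vcong_scale assms)
  finally show ?thesis by (simp add: matrix_vector_mul_assoc matrix_mul_assoc)
qed

lemma diagonal_on_transv_fix:
  assumes "diagonal_on p e M a S X" "\<tau> \<in> transv_fix N (int p ^ M) S" "\<sigma> \<in> transv_fix N (int p ^ M) S" "e \<le> M"
  shows "diagonal_on p e M a S (\<tau> ** X ** \<sigma>)"
proof -
  have "sadj (\<tau> ** X ** \<sigma>) = sadj \<sigma> ** sadj X ** sadj \<tau>"
    by (simp add: sadj_mult matrix_mul_assoc)
  moreover have "a i \<le> M" if "i \<in> S" for i
    using assms(1,4) that unfolding diagonal_on_def by fastforce
  ultimately show ?thesis
    using assms(1-3) transv_fix_sadj[OF assms(2)] transv_fix_sadj[OF assms(3)] dvd_off_transv_fix[OF _ assms(3)]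
    unfolding diagonal_on_def by (auto simp: transv_fix_def intro!: vcong_sandwich)
qed

text \<open>Moving X across the form gives \<open>omega (X *v ee i) (X *v ff i)\<close> = p^e modulo
  p^M, while p^(2w) divides the left side. Thus the exponent of a pivot is bounded, and it lies in
  the lower half of 0, ..., e.\<close>

lemma dvd_off_bound:
  assumes "prime p" "simmod p e M X" "e < M" "dvd_off p w S X" "i \<notin> S"
  shows "2 * w \<le> e"
proof -
  have o: "off 0 S (ee i)" "off 0 S (ff i)"
    using assms(5) by (auto simp: off_def axis_nth_if)
  have "[omega (ee i) (sadj X *v (X *v ff i)) = omega (ee i) (int p ^ e *s ff i)] (mod int p ^ M)"
    by (intro omega_cong simmod_apply assms) auto
  then have "[omega (X *v ee i) (X *v ff i) = int p ^ e] (mod int p ^ M)"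
    by (simp add: omega_mult axis_nth_if)
  moreover have "int p ^ (2 * w) dvd omega (X *v ee i) (X *v ff i)"
    using assms(4) o unfolding omega_def mult_2 power_add dvd_off_def
    by (intro dvd_sum dvd_diff mult_dvd_mono) auto
  ultimately have *: "int p ^ min (2 * w) M dvd int p ^ e"
    by (meson cong_dvd_iff cong_dvd_modulus dvd_trans le_imp_power_dvd min.cobounded1 min.cobounded2)
  have "\<not> is_unit (int p)" "int p \<noteq> 0"
    using assms(1) by (auto simp: prime_gt_0_nat)
  then have "min (2 * w) M \<le> e"
    using * dvd_power_iff by blast
  then show ?thesis using assms(3) by linarith
qed

text \<open>Bookkeeping of precision: dividing by p^v with v <= k loses at most k levels.\<close>

lemma dvd_cancel_power:
  assumes "int p ^ (M + k) dvd int p ^ v * a" "v \<le> k" "p \<noteq> 0"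
  shows "int p ^ M dvd a"
proof -
  have "int p ^ v * int p ^ M dvd int p ^ v * a"
    using assms(1) le_imp_power_dvd[of "v + M" "M + k" "int p"] assms(2)
    by (metis add.commute add_le_cancel_left dvd_trans power_add)
  then show ?thesis
    using assms(3) dvd_mult_cancel_left by simp
qed

lemma vcong_cancel_power:
  assumes "vcong (int p ^ (M + k)) (int p ^ v *s x) (int p ^ v *s y)" "v \<le> k" "p \<noteq> 0"
  shows "vcong (int p ^ M) x y"
  unfolding vcong_def
proof
  fix b
  have "int p ^ (M + k) dvd int p ^ v * (x $ b - y $ b)"
    using assms(1) by (simp add: vcong_def right_diff_distrib)
  then show "int p ^ M dvd x $ b - y $ b"
    by (rule dvd_cancel_power) (use assms in auto)
qed

text \<open>The least valuation must be attained at a primitive vector, because only such a vector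
  can be moved to a basis vector. If neither e_i nor the witness x0 qualifies, then X e_i is
  divisible by p^(v+1) and x0 by p, so x0 + e_i is primitive and its image has the same valuation as
  that of x0.\<close>

lemma exists_primitive_pivot:
  assumes p: "prime p" and D: "dvd_off p v S X" "\<not> dvd_off p (Suc v) S X" and i: "i \<notin> S"
  obtains x y c b where "off 0 S x" "\<not> int p dvd x $ c" "X *v x = int p ^ v *s y" "\<not> int p dvd y $ b"
proof -
  have p1: "\<not> is_unit (int p)" and p0: "p \<noteq> 0"
    using p by (auto simp: prime_gt_0_nat)
  obtain x0 b0 where x0: "off 0 S x0" "\<not> int p ^ Suc v dvd (X *v x0) $ b0"
    using D(2) by (auto simp: dvd_off_def)
  have ei: "off 0 S (ee i)"
    using i by (auto simp: off_def axis_nth_if)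
  obtain x b c where x: "off 0 S x" "\<not> int p ^ Suc v dvd (X *v x) $ b" "\<not> int p dvd x $ c"
  proof (cases "\<exists>b. \<not> int p ^ Suc v dvd (X *v ee i) $ b")
    case True
    then show ?thesis using that[OF ei, of _ "Inl i"] p1 by auto
  next
    case False
    show ?thesis
    proof (cases "\<exists>c. \<not> int p dvd x0 $ c")
      case True
      then show ?thesis using that[OF x0] by blast
    next
      case F: False
      have "off 0 S (x0 + ee i)"
        using x0(1) ei by (auto simp: off_def)
      moreover have "\<not> int p ^ Suc v dvd (X *v (x0 + ee i)) $ b0"
        using False x0(2) by (simp add: matrix_vector_right_distrib dvd_add_left_iff del: power_Suc)
      moreover have "\<not> int p dvd (x0 + ee i) $ Inl i"
        using F p1 by (simp add: dvd_add_right_iff)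
      ultimately show ?thesis using that by blast
    qed
  qed
  define y where "y = (\<chi> b. (X *v x) $ b div int p ^ v)"
  have y: "X *v x = int p ^ v *s y"
    using D(1) x(1) by (auto simp: vec_eq_iff y_def dvd_off_def)
  moreover have "\<not> int p dvd y $ b"
  proof
    assume "int p dvd y $ b"
    then have "int p ^ v * int p dvd int p ^ v * y $ b" by (rule mult_dvd_mono[OF dvd_refl])
    with x(2) y show False by (simp add: mult.commute)
  qed
  ultimately show thesis using that x by blast
qed

text \<open>One pivot of a symplectic Smith normal form. With v the least valuation off S, X is made
  to send e_i to p^v e_i, then its adjoint to send f_i to p^v f_i; the other two columns follow from
  the similitude relation. Three successive divisions by p^v, with v <= e, take the precision from M
  + 3e through M + 2e and M + e to M.\<close>

lemma diagonal_step:
  fixes X :: "(int, 'n::finite) mat_2n"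
  assumes p: "prime p" "\<not> p dvd N" and X: "simmod p e (M + 3 * e) X" "diagonal_on p e (M + 3 * e) a S X"
    and M: "e < M" and i: "i \<notin> S"
  obtains \<tau> \<sigma> v where "\<tau> \<in> transv_group N" "\<sigma> \<in> transv_group N" "\<And>j. j \<in> S \<Longrightarrow> a j \<le> v"
    "diagonal_on p e M (a(i := v)) (insert i S) (\<tau> ** X ** \<sigma>)"
proof -
  have p0: "p \<noteq> 0" using p(1) by (auto simp: prime_gt_0_nat)
  define W where "W = {w. dvd_off p w S X}"
  have W: "W \<subseteq> {..e}" "0 \<in> W"
    using dvd_off_bound[OF p(1) X(1) _ _ i] M by (force simp: W_def dvd_off_def)+
  then have fin: "finite W" using finite_subset by blast
  define v where "v = Max W"
  have v: "dvd_off p v S X" "\<not> dvd_off p (Suc v) S X"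
    using Max_in[OF fin] Max_ge[OF fin, of "Suc v"] W(2) by (auto simp: v_def W_def)
  have v2: "2 * v \<le> e"
    using dvd_off_bound[OF p(1) X(1) _ v(1) i] M by simp
  \<comment> \<open>The last clause of \<open>diagonal_on\<close> puts \<open>a j\<close> into
    \<open>W\<close>. This is why the exponents never decrease from one pivot to the next.\<close>
  have av: "a j \<le> v" if "j \<in> S" for j
    using Max_ge[OF fin, of "a j"] X(2) that by (auto simp: v_def W_def diagonal_on_def)
  obtain x y c b where x: "off 0 S x" "\<not> int p dvd x $ c" and y: "X *v x = int p ^ v *s y" "\<not> int p dvd y $ b"
    by (rule exists_primitive_pivot[OF p(1) v i])
  let ?q2 = "int p ^ (M + 2 * e)" and ?q1 = "int p ^ (M + e)"
  have ve: "v \<le> e" using v2 by simp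
  have offI: "off (int p ^ m) S z"
    if "\<And>j. j \<in> S \<Longrightarrow> int p ^ (m + e) dvd int p ^ v * z $ Inl j"
      "\<And>j. j \<in> S \<Longrightarrow> int p ^ (m + e) dvd int p ^ v * z $ Inr j" for m z
    unfolding off_def using dvd_cancel_power[OF that(1) ve p0] dvd_cancel_power[OF that(2) ve p0] by blast
  \<comment> \<open>The coordinates of X x in the planes of S are pairings with basis vectors; with
    X moved across the form, where its adjoint is diagonal on S, they become multiples of
    coordinates of x, which vanish. First division by p^v.\<close>
  have y_off: "off ?q2 S y"
  proof (rule offI)
    fix j assume j: "j \<in> S"
    then have 1: "vcong (int p ^ (M + 3 * e)) (sadj X *v ee j) (int p ^ (e - a j) *s ee j)"
      "vcong (int p ^ (M + 3 * e)) (sadj X *v ff j) (int p ^ a j *s ff j)"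
      using X(2) by (auto simp: diagonal_on_def)
    have "[omega (sadj X *v ee j) x = omega (int p ^ (e - a j) *s ee j) x] (mod int p ^ (M + 3 * e))"
      "[omega (sadj X *v ff j) x = omega (int p ^ a j *s ff j) x] (mod int p ^ (M + 3 * e))"
      by (intro omega_cong 1 vcong_refl)+
    then show "int p ^ (M + 2 * e + e) dvd int p ^ v * y $ Inl j" "int p ^ (M + 2 * e + e) dvd int p ^ v * y $ Inr j"
      using x(1) j by (simp_all add: omega_mult y(1) omega_bilinear off_def cong_iff_dvd_diff add.commute)
  qed
  have M2: "0 < M + 2 * e" "0 < M + e" using M by auto
  have x_off: "off ?q2 S x"
    using x(1) by (auto simp: off_def)
  obtain \<sigma> where \<sigma>: "\<sigma> \<in> transv_fix N ?q2 S" "vcong ?q2 (\<sigma> *v x) (ee i)"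
    by (rule transv_fix_to_ee[OF p x_off x(2) M2(1) i])
  obtain \<tau> where \<tau>: "\<tau> \<in> transv_fix N ?q2 S" "vcong ?q2 (\<tau> *v y) (ee i)"
    by (rule transv_fix_to_ee[OF p y_off y(2) M2(1) i])
  define X1 where "X1 = \<tau> ** X ** sadj \<sigma>"
  have X1: "simmod p e (M + 2 * e) X1" "diagonal_on p e (M + 2 * e) a S X1" "dvd_off p v S X1"
    unfolding X1_def using X v2
    by (auto intro!: simmod_transv_fix diagonal_on_transv_fix[OF _ \<tau>(1) transv_fix_sadj[OF \<sigma>(1)]] dvd_off_transv_fix[OF v(1) transv_fix_sadj[OF \<sigma>(1)]]
        transv_group_sadj transv_fix_transv_group[OF \<tau>(1)] transv_fix_transv_group[OF \<sigma>(1)] intro: simmod_le diagonal_on_le)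
  have "vcong ?q2 (\<tau> *v (X *v (sadj \<sigma> *v ee i))) (\<tau> *v (X *v x))"
    by (intro vcong_mult transv_group_fix_sadj[OF transv_fix_transv_group[OF \<sigma>(1)] \<sigma>(2)])
  also have "\<tau> *v (X *v x) = int p ^ v *s (\<tau> *v y)"
    by (simp add: y matrix_vec_smult)
  also have "vcong ?q2 \<dots> (int p ^ v *s ee i)"
    by (intro vcong_scale \<tau>)
  finally have X1_ee: "vcong ?q2 (X1 *v ee i) (int p ^ v *s ee i)"
    by (simp add: X1_def matrix_vector_mul_assoc matrix_mul_assoc)
  have ne: "j \<noteq> i" if "j \<in> S" for j using that i by auto
  have row_S: "?q2 dvd (X1 *v ff j) $ Inl i \<and> ?q2 dvd (X1 *v ee j) $ Inl i" if j: "j \<in> S" for j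
  proof -
    have "vcong ?q2 (X1 *v ee j) (int p ^ a j *s ee j)" "vcong ?q2 (X1 *v ff j) (int p ^ (e - a j) *s ff j)"
      using X1(2) j by (auto simp: diagonal_on_def)
    from this[unfolded vcong_def, rule_format, of "Inl i"] show ?thesis
      using ne[OF j] by (simp add: axis_nth_if)
  qed
  have row: "int p ^ v dvd (X1 *v ff j) $ Inl i \<and> int p ^ v dvd (X1 *v ee j) $ Inl i" for j
  proof (cases "j \<in> S")
    case True
    have "int p ^ v dvd ?q2" using v2 by (simp add: le_imp_power_dvd)
    then show ?thesis using row_S[OF True] by (meson dvd_trans)
  next
    case False
    then have "off 0 S (ff j)" "off 0 S (ee j)"
      by (auto simp: off_def axis_nth_if)
    then show ?thesis
      using X1(3) unfolding dvd_off_def by blast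
  qed
  \<comment> \<open>Up to sign and order, the adjoint of X1 applied to f_i is the row
    \<open>Inl i\<close> of X1, which is divisible by p^v; the quotient \<open>u\<close> is the
    second division.\<close>
  have sadj_row: "(sadj X1 *v ff i) $ Inl j = - (X1 *v ff j) $ Inl i" "(sadj X1 *v ff i) $ Inr j = (X1 *v ee j) $ Inl i" for j
    using omega_mult[of X1 "ff j" "ff i"] omega_mult[of X1 "ee j" "ff i"] by simp_all
  define u where "u = (\<chi> b. (sadj X1 *v ff i) $ b div int p ^ v)"
  have u: "sadj X1 *v ff i = int p ^ v *s u"
    using row by (auto simp: vec_eq_iff u_def forall_plus sadj_row)
  have u_nth: "int p ^ v * u $ b = (sadj X1 *v ff i) $ b" for b
    by (simp add: u)
  have u_off: "off ?q1 S u"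
    by (rule offI) (use row_S in \<open>simp_all add: u_nth sadj_row add.assoc flip: mult_2\<close>)
  have "?q2 dvd (X1 *v ee i) $ Inl i - int p ^ v"
    using X1_ee[unfolded vcong_def, rule_format, of "Inl i"] by simp
  then have "int p ^ (M + e + e) dvd int p ^ v * (u $ Inr i - 1)"
    by (simp add: right_diff_distrib u_nth sadj_row add.assoc flip: mult_2)
  from dvd_cancel_power[OF this ve p0] have u1: "[omega (ee i) u = 1] (mod ?q1)"
    by (simp add: cong_iff_dvd_diff)
  \<comment> \<open>Since \<open>\<kappa>\<close> fixes e_i, the column of X1 that is already
    normalised survives.\<close>
  obtain \<kappa> where \<kappa>: "\<kappa> \<in> transv_fix N ?q1 S" "vcong ?q1 (\<kappa> *v ee i) (ee i)" "vcong ?q1 (\<kappa> *v u) (ff i)"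
    by (rule transv_fix_to_ff[OF p u_off u1 M2(2) i])
  define X2 where "X2 = X1 ** sadj \<kappa>"
  have X2': "X2 = mat 1 ** X1 ** sadj \<kappa>" by (simp add: X2_def)
  have one: "mat 1 \<in> transv_fix N ?q1 S" by (simp add: transv_fix_def transv_group.one)
  have X2: "simmod p e (M + e) X2" "diagonal_on p e (M + e) a S X2" "dvd_off p v S X2"
    unfolding X2' using X1 v2
    by (auto intro!: simmod_transv_fix diagonal_on_transv_fix[OF _ one transv_fix_sadj[OF \<kappa>(1)]] dvd_off_transv_fix[OF _ transv_fix_sadj[OF \<kappa>(1)]]
        transv_group_sadj transv_group.one transv_fix_transv_group[OF \<kappa>(1)] simp del: matrix_mul_lid intro: simmod_le diagonal_on_le)
  have q12: "?q1 dvd ?q2" by (simp add: le_imp_power_dvd)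
  have c1: "vcong ?q1 (X2 *v ee i) (int p ^ v *s ee i)"
    unfolding X2_def
    by (rule vcong_mult_trans[OF transv_group_fix_sadj[OF transv_fix_transv_group[OF \<kappa>(1)] \<kappa>(2)] vcong_dvd[OF X1_ee q12]])
  have c2: "vcong ?q1 (sadj X2 *v ff i) (int p ^ v *s ff i)"
    using vcong_scale[OF \<kappa>(3), of "int p ^ v"]
    by (simp add: X2_def sadj_mult matrix_vector_mul_assoc[symmetric] u matrix_vec_smult)
  have ev: "int p ^ e *s z = int p ^ v *s (int p ^ (e - v) *s z)" for z :: "'n zvec"
    using v2 by (simp add: vector_smult_assoc flip: power_add)
  \<comment> \<open>X2 times its adjoint is p^e, and the adjoint sends f_i to p^v f_i; cancelling
    p^v, the third division, yields the column of f_i. The adjoint at e_i is found in the same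
    way.\<close>
  have "vcong ?q1 (int p ^ v *s (X2 *v ff i)) (X2 *v (sadj X2 *v ff i))"
    using vcong_mult[OF vcong_sym[OF c2], of X2] by (simp add: matrix_vec_smult)
  also have "vcong ?q1 \<dots> (int p ^ e *s ff i)"
    by (rule simmod_apply[OF X2(1)])
  finally have c3: "vcong (int p ^ M) (X2 *v ff i) (int p ^ (e - v) *s ff i)"
    unfolding ev by (rule vcong_cancel_power) (use v2 p0 in auto)
  have "vcong ?q1 (int p ^ v *s (sadj X2 *v ee i)) (sadj X2 *v (X2 *v ee i))"
    using vcong_mult[OF vcong_sym[OF c1], of "sadj X2"] by (simp add: matrix_vec_smult)
  also have "vcong ?q1 \<dots> (int p ^ e *s ee i)"
    by (rule simmod_apply[OF X2(1)])
  finally have c4: "vcong (int p ^ M) (sadj X2 *v ee i) (int p ^ (e - v) *s ee i)"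
    unfolding ev by (rule vcong_cancel_power) (use v2 p0 in auto)
  have qM: "int p ^ M dvd ?q1" by (simp add: le_imp_power_dvd)
  have "diagonal_on p e M (a(i := v)) (insert i S) X2"
    using diagonal_on_le[OF X2(2), of M] ne vcong_dvd[OF c1 qM] vcong_dvd[OF c2 qM] c3 c4 v2
      dvd_off_mono[OF X2(3) subset_insertI] dvd_off_mono[OF _ subset_insertI[of S i]]
    unfolding diagonal_on_def by auto
  moreover have "X2 = \<tau> ** X ** (sadj \<sigma> ** sadj \<kappa>)"
    by (simp add: X2_def X1_def matrix_mul_assoc)
  ultimately show thesis
    using that[of \<tau> "sadj \<sigma> ** sadj \<kappa>" v] av transv_fix_transv_group transv_group_mult transv_group_sadj \<tau>(1) \<sigma>(1) \<kappa>(1) by metis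
qed

definition diag_sim :: "nat \<Rightarrow> nat \<Rightarrow> ('n \<Rightarrow> nat) \<Rightarrow> (int, 'n::finite) mat_2n" where
  "diag_sim p e a = diag_mat_2n (case_sum (\<lambda>i. int p ^ a i) (\<lambda>i. int p ^ (e - a i)))"

lemma diag_sim_apply:
  "diag_sim p e a *v ee i = int p ^ a i *s ee i" "diag_sim p e a *v ff i = int p ^ (e - a i) *s ff i"
  by (simp_all add: vec_eq_iff forall_plus diag_sim_def diag_mat_2n_def matrix_vector_mult_def axis_nth_if sum_delta_mult)

text \<open>Pivots are taken in increasing order of the index, so that the nondecreasing exponents
  form a monotone function, as in the diagonal matrices that define T_j(p^2). In the induction
  \<open>card (- S)\<close> counts the pivots still to come, with 3e levels in reserve for
  each.\<close>

theorem reduction_to_diagonal: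
  fixes X :: "(int, 'n::{finite,linorder}) mat_2n"
  assumes p: "prime p" "\<not> p dvd N" and X: "simmod p e (M + 3 * e * CARD('n)) X" and M: "e < M"
  obtains \<tau> \<sigma> a where "\<tau> \<in> transv_group N" "\<sigma> \<in> transv_group N" "mono a" "\<And>i. 2 * a i \<le> e"
    "reduce_mat (int p ^ M) X = reduce_mat (int p ^ M) (\<tau> ** diag_sim p e a ** \<sigma>)"
proof -
  have "\<exists>\<tau> \<sigma> a. \<tau> \<in> transv_group N \<and> \<sigma> \<in> transv_group N \<and> mono_on S a \<and> diagonal_on p e (M + 3 * e * card (- S)) a S (\<tau> ** X ** \<sigma>)"
    for S :: "'n set"
    using finite[of S]
  proof (induction S rule: finite_linorder_max_induct)
    case empty
    then show ?case
      by (intro exI[of _ "mat 1"]) (auto simp: transv_group.one diagonal_on_def mono_on_def)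
  next
    case (insert i S)
    then obtain \<tau> \<sigma> a where IH: "\<tau> \<in> transv_group N" "\<sigma> \<in> transv_group N" "mono_on S a"
      "diagonal_on p e (M + 3 * e * card (- S)) a S (\<tau> ** X ** \<sigma>)" by blast
    have i: "i \<notin> S" using insert by auto
    have card: "card (- S) = Suc (card (- insert i S))"
      using i by (metis Compl_insert Compl_iff card_Suc_Diff1 finite)
    let ?M = "M + 3 * e * card (- insert i S)"
    have le: "?M + 3 * e \<le> M + 3 * e * CARD('n)"
      using card card_mono[of "UNIV :: 'n set" "- S"] mult_le_mono2[of "card (- S)" "CARD('n)" "3 * e"] by (simp add: algebra_simps)
    have 1: "simmod p e (?M + 3 * e) (\<tau> ** X ** \<sigma>)"
      using simmod_le[OF X le] IH by (intro simmod_transv_fix) 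
    have 2: "diagonal_on p e (?M + 3 * e) a S (\<tau> ** X ** \<sigma>)"
      using IH(4) card by (simp add: algebra_simps)
    have 3: "e < ?M" using M by simp
    obtain \<tau>' \<sigma>' v where *: "\<tau>' \<in> transv_group N" "\<sigma>' \<in> transv_group N" "\<And>j. j \<in> S \<Longrightarrow> a j \<le> v"
      "diagonal_on p e ?M (a(i := v)) (insert i S) (\<tau>' ** (\<tau> ** X ** \<sigma>) ** \<sigma>')"
      by (rule diagonal_step[OF p 1 2 3 i], rule that)
    have "mono_on (insert i S) (a(i := v))"
      using IH(3) insert(2) *(3) by (fastforce simp: mono_on_def)
    moreover have "\<tau>' ** (\<tau> ** X ** \<sigma>) ** \<sigma>' = (\<tau>' ** \<tau>) ** X ** (\<sigma> ** \<sigma>')"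
      by (simp add: matrix_mul_assoc)
    ultimately show ?case using * IH transv_group_mult by metis
  qed
  from this[of UNIV] obtain \<tau> \<sigma> a where *: "\<tau> \<in> transv_group N" "\<sigma> \<in> transv_group N" "mono a" "diagonal_on p e M a UNIV (\<tau> ** X ** \<sigma>)"
    by auto
  have "reduce_mat (int p ^ M) (\<tau> ** X ** \<sigma>) = reduce_mat (int p ^ M) (diag_sim p e a)"
    using *(4) by (intro vcong_matrixI) (auto simp: diagonal_on_def diag_sim_apply)
  then have "reduce_mat (int p ^ M) (sadj \<tau> ** ((\<tau> ** X ** \<sigma>) ** sadj \<sigma>)) = reduce_mat (int p ^ M) (sadj \<tau> ** (diag_sim p e a ** sadj \<sigma>))"
    by (intro reduce_mat_mult_cong) auto
  moreover have "sadj \<tau> ** ((\<tau> ** X ** \<sigma>) ** sadj \<sigma>) = (sadj \<tau> ** \<tau>) ** X ** (\<sigma> ** sadj \<sigma>)"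
    by (simp add: matrix_mul_assoc)
  moreover have "\<dots> = X"
    using *(1,2) transv_group_inverse transv_group_inverse' by (simp add: transv_group_inverse[of \<sigma>] transv_group_inverse'[of \<tau>])
  ultimately show thesis
    using that[of "sadj \<tau>" "sadj \<sigma>" a] * transv_group_sadj
    by (metis UNIV_I diagonal_on_def matrix_mul_assoc)
qed

subsection \<open>Cosets of similitudes\<close>

lemma reduce_sim_iff:
  fixes X :: "(int, 'n::finite) mat_2n"
  shows "reduce_mat q (X ** symp_J ** transpose X) = reduce_mat q (scale_mat c symp_J)
    \<longleftrightarrow> reduce_mat q (X ** sadj X) = reduce_mat q (mat c)"
    "reduce_mat q (transpose X ** symp_J ** X) = reduce_mat q (scale_mat c symp_J)
    \<longleftrightarrow> reduce_mat q (sadj X ** X) = reduce_mat q (mat c)"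
proof -
  have c: "mat c ** symp_J = scale_mat c symp_J" "scale_mat c symp_J ** transpose symp_J = (mat c :: (int, 'n) mat_2n)"
    "symp_J ** mat c = scale_mat c symp_J" "transpose symp_J ** scale_mat c symp_J = (mat c :: (int, 'n) mat_2n)"
    by (simp_all add: mat_mult_eq scale_mat_mult_left scale_mat_mult_right symp_J_mult_transpose)
      (simp_all add: vec_eq_iff mat_nth)
  have 1: "X ** sadj X ** symp_J = X ** symp_J ** transpose X" "(X ** symp_J ** transpose X) ** transpose symp_J = X ** sadj X"
    by (simp_all add: sadj_def matrix_mul_assoc[symmetric] symp_J_mult_transpose)
  have "sadj X = transpose symp_J ** transpose X ** symp_J"
    by (simp add: vec_eq_iff forall_plus matrix_mult_nth sum_UNIV_plus sum_delta_mult sum_negf)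
  then have 2: "symp_J ** (sadj X ** X) = transpose X ** symp_J ** X" "transpose symp_J ** (transpose X ** symp_J ** X) = sadj X ** X"
    by (simp_all add: matrix_mul_assoc symp_J_mult_transpose)
  show "reduce_mat q (X ** symp_J ** transpose X) = reduce_mat q (scale_mat c symp_J)
    \<longleftrightarrow> reduce_mat q (X ** sadj X) = reduce_mat q (mat c)"
    using reduce_mat_mult_cong[of q "X ** sadj X" "mat c" symp_J symp_J]
      reduce_mat_mult_cong[of q "X ** symp_J ** transpose X" "scale_mat c symp_J" "transpose symp_J" "transpose symp_J"]
    unfolding 1 c by blast
  show "reduce_mat q (transpose X ** symp_J ** X) = reduce_mat q (scale_mat c symp_J)
    \<longleftrightarrow> reduce_mat q (sadj X ** X) = reduce_mat q (mat c)"
    using reduce_mat_mult_cong[of q symp_J symp_J "sadj X ** X" "mat c"]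
      reduce_mat_mult_cong[of q "transpose symp_J" "transpose symp_J" "transpose X ** symp_J ** X" "scale_mat c symp_J"]
    unfolding 2 c by blast
qed

lemma Sp_padic_eq: "(Sp_padic p :: ('n::finite + 'n) padic_mat set) = Sim p 0"
proof -
  have "padic_mult p (padic_mult p X (padic_of_int p symp_J)) (padic_transpose X) = padic_of_int p symp_J \<longleftrightarrow>
    padic_mult p X (padj p X) = padic_of_int p (mat (int p ^ 0))" for X :: "('n + 'n) padic_mat"
    unfolding fun_eq_iff using reduce_sim_iff(1)[of _ "X _" 1]
    by (simp add: padic_mult_def padic_of_int_def padic_transpose_def padj_def)
  then show ?thesis by (simp add: Sp_padic_def Sim_def)
qed

text \<open>\<open>similitude_p2_cosets\<close> puts the transpose first, which corresponds to the
  adjoint on the left; \<open>Sim_iff_left\<close> reconciles this with \<open>Sim\<close>.\<close>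

lemma transpose_sim_iff:
  "padic_mult p (padic_mult p (padic_transpose X) (padic_of_int p symp_J)) X = padic_of_int p (scale_mat c symp_J)
    \<longleftrightarrow> padic_mult p (padj p X) X = padic_of_int p (mat c)"
  unfolding fun_eq_iff using reduce_sim_iff(2)[of _ "X _" c]
  by (simp add: padic_mult_def padic_of_int_def padic_transpose_def padj_def)

lemma Sim_in: "X \<in> Sim p e \<Longrightarrow> X \<in> padic_mats p"
  by (simp add: Sim_def)

lemma Sim_padj_left:
  assumes "prime p" "X \<in> Sim p e"
  shows "padic_mult p (padj p X) X = padic_of_int p (mat (int p ^ e))"
  using assms padic_factor_commute[of p X "padj p X" e] by (simp add: Sim_def)

lemma Sim_padj: "prime p \<Longrightarrow> X \<in> Sim p e \<Longrightarrow> padj p X \<in> Sim p e"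
  using Sim_padj_left[of p X e] by (simp add: Sim_def)

lemma Sim_iff_left:
  assumes "prime p" "X \<in> padic_mats p"
  shows "padic_mult p (padj p X) X = padic_of_int p (mat (int p ^ e)) \<longleftrightarrow> X \<in> Sim p e"
  using assms Sim_padj_left padic_factor_commute[of p "padj p X" X e] by (auto simp: Sim_def)

lemma Sim_mult:
  assumes "X \<in> Sim p e" "Y \<in> Sim p f"
  shows "padic_mult p X Y \<in> Sim p (e + f)"
proof -
  have "padic_mult p (padic_mult p X Y) (padj p (padic_mult p X Y)) =
    padic_mult p X (padic_mult p (padic_mult p Y (padj p Y)) (padj p X))"
    by (simp add: padj_mult padic_mult_assoc)
  also have "\<dots> = padic_mult p (padic_mult p X (padj p X)) (padic_of_int p (mat (int p ^ f)))"
    using assms by (simp add: Sim_def padic_scalar_comm[OF padj_in] padic_mult_assoc[symmetric])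
  also have "\<dots> = padic_of_int p (mat (int p ^ (e + f)))"
    using assms by (simp add: Sim_def padic_of_int_mult mat_mult_eq power_add)
      (simp add: padic_of_int_def vec_eq_iff mat_nth fun_eq_iff mult.commute)
  finally show ?thesis using assms by (simp add: Sim_def)
qed

lemma Sim_of_int: "g ** sadj g = mat (int p ^ e) \<Longrightarrow> padic_of_int p g \<in> Sim p e"
  by (simp add: Sim_def padj_of_int padic_of_int_mult)

lemma Sim_0_of_int: "g ** sadj g = mat 1 \<Longrightarrow> padic_of_int p g \<in> Sim p 0"
  by (rule Sim_of_int) simp

lemma all_powers_dvd_imp_0:
  assumes "prime p" "\<And>k. int p ^ k dvd d"
  shows "d = 0"
proof (rule ccontr)
  assume "d \<noteq> 0"
  then have "int p ^ nat \<bar>d\<bar> \<le> \<bar>d\<bar>"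
    using dvd_imp_le_int[OF _ assms(2)[of "nat \<bar>d\<bar>"]] by (simp add: assms(1) prime_gt_0_nat)
  moreover have "nat \<bar>d\<bar> < p ^ nat \<bar>d\<bar>"
    using assms(1) by (intro power_gt_expt) (simp add: prime_gt_Suc_0_nat)
  then have "int (nat \<bar>d\<bar>) < int (p ^ nat \<bar>d\<bar>)"
    by (simp only: of_nat_less_iff)
  ultimately show False by simp
qed

text \<open>The integers embed into the p-adic integers: c and p^e agree modulo every power of p,
  hence are equal.\<close>

lemma Sim_factor_unique:
  assumes "prime p" "padic_of_int p g \<in> Sim p e" "g ** sadj g = mat c"
  shows "c = int p ^ e"
proof -
  have "int p ^ k dvd c - int p ^ e" for k
  proof -
    have "padic_of_int p (mat c) k = padic_of_int p (mat (int p ^ e) :: (int, 'a) mat_2n) k"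
      using assms(2,3) by (simp add: Sim_def padj_of_int padic_of_int_mult)
    then have "int p ^ k dvd mat c $ i $ i - (mat (int p ^ e) :: (int, 'a) mat_2n) $ i $ i" for i
      unfolding padic_of_int_def reduce_mat_eq_iff by blast
    then show ?thesis by (simp add: mat_nth)
  qed
  from all_powers_dvd_imp_0[OF assms(1) this] show ?thesis by simp
qed

lemma int_factor_commute:
  fixes A B :: "int^'m^'m"
  assumes "A ** B = mat c" "c \<noteq> 0"
  shows "B ** A = mat c"
proof -
  define Z where "Z = B ** A - mat c"
  have "Z ** B = B ** (A ** B) - mat c ** B"
    by (simp add: Z_def matrix_minus_left matrix_mul_assoc)
  then have "Z ** B = 0"
    by (simp add: assms(1) mat_mult_eq)
  then have "0 dvd Z $ i $ j * det B" for i j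
    by (intro left_annihilator_dvd_det) simp
  moreover have "det A * det B \<noteq> 0"
    using assms by (simp add: det_mul[symmetric] det_mat)
  ultimately show ?thesis by (simp add: Z_def vec_eq_iff)
qed

text \<open>Take \<open>V = X Y\<^sup>* / p ^ e\<close>, with \<open>Y\<^sup>*\<close> the symplectic adjoint.\<close>

lemma Sim_eq_level:
  assumes p: "prime p" and X: "X \<in> Sim p e" and Y: "Y \<in> Sim p e" and XY: "X e = Y e"
  obtains V where "V \<in> Sim p 0" "X = padic_mult p V Y"
proof -
  let ?s = "padic_of_int p (mat (int p ^ e)) :: ('a + 'a) padic_mat"
  define W where "W = padic_mult p X (padj p Y)"
  have W: "W \<in> padic_mats p" using X Y by (simp add: W_def Sim_in)
  have "W e = padic_mult p Y (padj p Y) e"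
    by (simp add: W_def padic_mult_def padj_def XY)
  also have "\<dots> = 0"
    using Y by (simp add: Sim_def padic_of_int_def) (simp add: vec_eq_iff mat_nth)
  finally have We: "W e = 0" .
  have dvd: "int p ^ e dvd W (k + e) $ i $ j" for k i j
  proof -
    have "reduce_mat (int p ^ e) (W (k + e)) = 0"
      using padic_mats_reduce[OF W, of e "k + e"] We by simp
    then show ?thesis by (simp add: vec_eq_iff dvd_eq_mod_eq_0)
  qed
  define Q where "Q = (\<lambda>k. map_matrix (\<lambda>x. x div int p ^ e) (W (k + e)))"
  have WQ: "W (k + e) = scale_mat (int p ^ e) (Q k)" for k
    using dvd by (simp add: vec_eq_iff Q_def)
  define V where "V = (\<lambda>k. reduce_mat (int p ^ k) (Q k))"
  have p0: "int p ^ e \<noteq> 0" using p by (simp add: prime_gt_0_nat)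
  have V: "V \<in> padic_mats p"
  proof (rule padic_matsI[OF fun_cong[OF V_def]])
    fix k
    have "reduce_mat (int p ^ e * int p ^ k) (W (k + e)) = reduce_mat (int p ^ e * int p ^ k) (W (Suc k + e))"
      using padic_mats_Suc[OF W, of "k + e"] by (simp add: add.commute flip: power_add)
    then show "reduce_mat (int p ^ k) (Q k) = reduce_mat (int p ^ k) (Q (Suc k))"
      unfolding WQ reduce_mat_scale_cancel[OF p0] .
  qed
  have sV: "padic_mult p ?s V = W"
  proof
    fix k
    have "padic_mult p ?s V k = reduce_mat (int p ^ k) (W (k + e))"
      by (simp add: padic_mult_def padic_of_int_def V_def mat_mult_eq WQ)
    also have "\<dots> = W k"
      using padic_mats_reduce[OF W, of k "k + e"] by simp
    finally show "padic_mult p ?s V k = W k" .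
  qed
  have "padic_mult p ?s (padic_mult p V Y) = padic_mult p X (padic_mult p (padj p Y) Y)"
    by (simp add: padic_mult_assoc[symmetric] sV W_def)
  also have "\<dots> = padic_mult p ?s X"
    using Sim_padj_left[OF p Y] X by (simp add: padic_scalar_comm[OF Sim_in[OF X]])
  finally have XV: "padic_mult p V Y = X"
    by (rule padic_scalar_cancel[OF p padic_mult_in[OF V Sim_in[OF Y]] Sim_in[OF X]])
  have "padic_mult p ?s (padic_mult p V (padj p V)) = padic_mult p V (padic_mult p (padic_mult p Y (padj p Y)) (padj p V))"
    using Y by (simp add: Sim_def padic_mult_assoc[symmetric] padic_scalar_comm[OF V])
  also have "\<dots> = padic_mult p X (padj p X)"
    by (simp add: XV[symmetric] padj_mult padic_mult_assoc)
  also have "\<dots> = padic_mult p ?s (padic_of_int p (mat 1))"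
    using X by (simp add: Sim_def)
  finally have "padic_mult p V (padj p V) = padic_of_int p (mat 1)"
    by (rule padic_scalar_cancel[OF p padic_mult_in[OF V padj_in[OF V]] padic_of_int_in])
  then have "V \<in> Sim p 0" using V by (simp add: Sim_def)
  then show thesis using that XV by metis
qed

lemma Sim_cancel_right:
  assumes "prime p" "X \<in> padic_mats p" "X' \<in> padic_mats p" "Y \<in> Sim p e" "padic_mult p X Y = padic_mult p X' Y"
  shows "X = X'"
proof (rule padic_scalar_cancel[OF assms(1-3)])
  have "padic_mult p (padic_mult p X Y) (padj p Y) = padic_mult p (padic_mult p X' Y) (padj p Y)"
    by (simp add: assms(5))
  then show "padic_mult p (padic_of_int p (mat (int p ^ e))) X = padic_mult p (padic_of_int p (mat (int p ^ e))) X'"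
    using assms(2-4) by (simp add: padic_mult_assoc Sim_def padic_scalar_comm[OF assms(2)] padic_scalar_comm[OF assms(3)])
qed

section \<open>Left and double cosets of K\<close>

abbreviation LC :: "nat \<Rightarrow> ('n::finite + 'n) padic_mat \<Rightarrow> ('n + 'n) padic_mat set" where
  "LC \<equiv> padic_left_coset"

abbreviation DC :: "nat \<Rightarrow> ('n::finite + 'n) padic_mat \<Rightarrow> ('n + 'n) padic_mat set" where
  "DC \<equiv> padic_double_coset"

lemma LC_iff: "Y \<in> LC p X \<longleftrightarrow> (\<exists>U\<in>Sim p 0. Y = padic_mult p U X)"
  by (auto simp: padic_left_coset_def Sp_padic_eq)

lemma DC_iff: "Y \<in> DC p X \<longleftrightarrow> (\<exists>U\<in>Sim p 0. \<exists>W\<in>Sim p 0. Y = padic_mult p (padic_mult p U X) W)"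
  by (auto simp: padic_double_coset_def Sp_padic_eq)

lemma one_in_Sim: "padic_of_int p (mat 1) \<in> Sim p 0"
  by (rule Sim_0_of_int) simp

lemma LC_self: "X \<in> padic_mats p \<Longrightarrow> X \<in> LC p X"
  unfolding LC_iff using one_in_Sim by (metis padic_mult_1(1))

lemma DC_self: "X \<in> padic_mats p \<Longrightarrow> X \<in> DC p X"
  unfolding DC_iff using one_in_Sim by (metis padic_mult_1)

lemma Sim_0_inverse:
  assumes "prime p" "U \<in> Sim p 0"
  shows "padic_mult p U (padj p U) = padic_of_int p (mat 1)" "padic_mult p (padj p U) U = padic_of_int p (mat 1)"
    "padj p U \<in> Sim p 0"
  using assms Sim_padj_left[OF assms] Sim_padj[OF assms] by (auto simp: Sim_def)

lemma LC_sym: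
  assumes "prime p" "X \<in> padic_mats p" "Y \<in> LC p X"
  shows "X \<in> LC p Y"
proof -
  obtain U where U: "U \<in> Sim p 0" "Y = padic_mult p U X" using assms(3) LC_iff by blast
  then have "X = padic_mult p (padj p U) Y"
    using Sim_0_inverse(2)[OF assms(1) U(1)] assms(2) by (simp add: padic_mult_assoc[symmetric])
  then show ?thesis using Sim_0_inverse(3)[OF assms(1) U(1)] LC_iff by blast
qed

lemma Sim_0_mult: "U \<in> Sim p 0 \<Longrightarrow> V \<in> Sim p 0 \<Longrightarrow> padic_mult p U V \<in> Sim p 0"
  using Sim_mult[of U p 0 V 0] by simp

lemma LC_trans: "Y \<in> LC p X \<Longrightarrow> Z \<in> LC p Y \<Longrightarrow> Z \<in> LC p X"
  unfolding LC_iff by (metis Sim_0_mult padic_mult_assoc)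

lemma LC_eq_iff:
  assumes "prime p" "X \<in> padic_mats p" "Y \<in> padic_mats p"
  shows "LC p Y = LC p X \<longleftrightarrow> Y \<in> LC p X"
  using LC_self[OF assms(3)] LC_sym[OF assms(1,2)] LC_trans by blast

lemma LC_in: "X \<in> padic_mats p \<Longrightarrow> Y \<in> LC p X \<Longrightarrow> Y \<in> padic_mats p"
  unfolding LC_iff by (auto simp: Sim_in)

lemma LC_disjoint:
  assumes "prime p" "X \<in> padic_mats p" "Y \<in> padic_mats p" "LC p X \<inter> LC p Y \<noteq> {}"
  shows "LC p X = LC p Y"
  using assms LC_eq_iff LC_in by (metis disjoint_iff)

lemma DC_mult_left: "Y \<in> DC p X \<Longrightarrow> U \<in> Sim p 0 \<Longrightarrow> padic_mult p U Y \<in> DC p X"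
  unfolding DC_iff by (metis Sim_0_mult padic_mult_assoc)

lemma DC_mult_right: "Y \<in> DC p X \<Longrightarrow> U \<in> Sim p 0 \<Longrightarrow> padic_mult p Y U \<in> DC p X"
  unfolding DC_iff by (metis Sim_0_mult padic_mult_assoc)

lemma DC_sym:
  assumes "prime p" "X \<in> padic_mats p" "Y \<in> DC p X"
  shows "X \<in> DC p Y"
proof -
  obtain U W where U: "U \<in> Sim p 0" "W \<in> Sim p 0" "Y = padic_mult p (padic_mult p U X) W" using assms(3) DC_iff by blast
  have "padic_mult p (padic_mult p (padj p U) Y) (padj p W) =
    padic_mult p (padic_mult p (padic_mult p (padj p U) U) X) (padic_mult p W (padj p W))"
    by (simp add: U(3) padic_mult_assoc)
  also have "\<dots> = X"
    using Sim_0_inverse(2)[OF assms(1) U(1)] Sim_0_inverse(1)[OF assms(1) U(2)] assms(2) by simp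
  finally show ?thesis using Sim_0_inverse(3)[OF assms(1)] U(1,2) DC_iff by metis
qed

lemma DC_subset: "Y \<in> DC p X \<Longrightarrow> DC p Y \<subseteq> DC p X"
  using DC_mult_left DC_mult_right DC_iff by (metis subsetI)

lemma DC_eq:
  assumes "prime p" "X \<in> padic_mats p" "Y \<in> DC p X"
  shows "DC p Y = DC p X"
  using DC_subset[OF assms(3)] DC_subset[OF DC_sym[OF assms]] by blast

lemma DC_Sim: "X \<in> Sim p e \<Longrightarrow> DC p X \<subseteq> Sim p e"
  using Sim_mult[OF Sim_mult, of _ p 0 X e _ 0] by (auto simp: DC_iff)

lemma LC_subset_DC: "Y \<in> DC p X \<Longrightarrow> LC p Y \<subseteq> DC p X"
  using DC_mult_left by (auto simp: LC_iff)

subsection \<open>Global representatives\<close>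

lemma scale_mat_eq_iff: "c \<noteq> 0 \<Longrightarrow> scale_mat c A = scale_mat c B \<longleftrightarrow> A = (B :: int^'k^'m)"
  by (simp add: vec_eq_iff)

lemma Delta0_iff:
  "g \<in> Delta0 N \<longleftrightarrow> (\<exists>c>0. g ** sadj g = mat c) \<and> (\<forall>i j. int N dvd g $ Inr i $ Inl j)"
  by (simp add: Delta0_def sim_iff_sadj block_C_def)

lemma Gamma0_iff:
  "g \<in> Gamma0 N \<longleftrightarrow> g ** sadj g = mat 1 \<and> (\<forall>i j. int N dvd g $ Inr i $ Inl j)"
  using sim_iff_sadj[of g 1] by (simp add: Gamma0_def Sp_int_def block_C_def)

lemma lower_left_dvd_mult:
  assumes "\<And>i j. N dvd g $ Inr i $ Inl j" "\<And>i j. N dvd h $ Inr i $ Inl j"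
  shows "N dvd ((g :: (int, 'n::finite) mat_2n) ** h) $ Inr i $ Inl j"
  using assms by (simp add: matrix_mult_nth sum_UNIV_plus) (intro dvd_add dvd_sum, auto)

lemma sim_mult:
  assumes "g ** sadj g = mat c" "h ** sadj h = mat d"
  shows "(g ** h) ** sadj (g ** h) = mat (c * d)"
proof -
  have "(g ** h) ** sadj (g ** h) = g ** (h ** sadj h) ** sadj g"
    by (simp add: sadj_mult matrix_mul_assoc)
  also have "\<dots> = scale_mat d (g ** sadj g)"
    by (simp add: assms(2) mat_mult_eq scale_mat_mult_left)
  finally show ?thesis
    by (simp add: assms(1)) (simp add: vec_eq_iff mat_nth mult.commute)
qed

lemma Delta0_mult: "g \<in> Delta0 N \<Longrightarrow> h \<in> Delta0 N \<Longrightarrow> g ** h \<in> Delta0 N"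
  unfolding Delta0_iff using sim_mult[of g _ h] by (metis lower_left_dvd_mult zero_less_mult_iff)

text \<open>\<open>\<gamma>\<close> is g times the adjoint of h, divided by p^e. It is integral
  because U is p-adically integral, symplectic because g and h have the same factor, and its lower
  left block is divisible by N because p is prime to N. Hence sums over representatives do not
  depend on their choice.\<close>

lemma Gamma0_of_LC_eq:
  fixes g h :: "(int, 'n::finite) mat_2n"
  assumes p: "prime p" "\<not> p dvd N" and g: "g \<in> Delta0 N" "g ** sadj g = mat (int p ^ e)"
    and h: "h \<in> Delta0 N" "h ** sadj h = mat (int p ^ e)"
    and LC: "padic_of_int p g \<in> LC p (padic_of_int p h)"
  obtains \<gamma> where "\<gamma> \<in> Gamma0 N" "g = \<gamma> ** h"
proof -
  have p0: "int p ^ e \<noteq> 0" using p(1) by (simp add: prime_gt_0_nat)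
  obtain U where U: "padic_of_int p g = padic_mult p U (padic_of_int p h)"
    using LC LC_iff by blast
  have "padic_of_int p (g ** sadj h) = padic_mult p (padic_of_int p g) (padic_of_int p (sadj h))"
    by (simp add: padic_of_int_mult)
  also have "\<dots> = padic_mult p U (padic_of_int p (mat (int p ^ e)))"
    by (simp add: U padic_mult_assoc padic_of_int_mult h(2))
  finally have "padic_of_int p (g ** sadj h) e = padic_mult p U (padic_of_int p (mat (int p ^ e))) e"
    by simp
  then have dvd: "int p ^ e dvd (g ** sadj h) $ i $ j" for i j
    by (simp add: padic_of_int_def padic_mult_def mat_mult_eq vec_eq_iff dvd_eq_mod_eq_0)
  define \<gamma> where "\<gamma> = map_matrix (\<lambda>x. x div int p ^ e) (g ** sadj h)"
  have \<gamma>: "g ** sadj h = scale_mat (int p ^ e) \<gamma>"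
    using dvd by (simp add: vec_eq_iff \<gamma>_def)
  have hh: "sadj h ** h = mat (int p ^ e)"
    using int_factor_commute[OF h(2) p0] .
  have "scale_mat (int p ^ e) (\<gamma> ** h) = g ** (sadj h ** h)"
    by (simp add: scale_mat_mult_left[symmetric] \<gamma>[symmetric] matrix_mul_assoc)
  then have gh: "g = \<gamma> ** h"
    using p0 by (simp add: hh mat_mult_eq scale_mat_eq_iff)
  have "scale_mat (int p ^ e) (\<gamma> ** sadj \<gamma>) = \<gamma> ** (h ** sadj h) ** sadj \<gamma>"
    by (simp add: h(2) mat_mult_eq scale_mat_mult_left)
  also have "\<dots> = g ** sadj g"
    by (simp add: gh sadj_mult matrix_mul_assoc)
  also have "\<dots> = scale_mat (int p ^ e) (mat 1)"
    by (simp add: g(2) vec_eq_iff mat_nth)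
  finally have "\<gamma> ** sadj \<gamma> = mat 1"
    using p0 by (simp add: scale_mat_eq_iff)
  moreover have "int N dvd \<gamma> $ Inr i $ Inl j" for i j
  proof -
    have "int N dvd (g ** sadj h) $ Inr i $ Inl j"
      using g(1) h(1) by (intro lower_left_dvd_mult) (auto simp: Delta0_iff)
    then have "int N dvd int p ^ e * \<gamma> $ Inr i $ Inl j"
      by (simp add: \<gamma>)
    moreover have "coprime (int N) (int p ^ e)"
      using p by (intro coprime_prime_powerI) auto
    ultimately show ?thesis
      by (simp add: coprime_dvd_mult_right_iff)
  qed
  ultimately show thesis using that gh by (auto simp: Gamma0_iff)
qed

lemma diag_mat_2n_nth [simp]: "diag_mat_2n d $ i $ j = (if i = j then d i else 0)"
  by (simp add: diag_mat_2n_def)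

lemma sadj_diag_mat_2n: "sadj (diag_mat_2n (case_sum x y)) = diag_mat_2n (case_sum y x)"
  by (simp add: vec_eq_iff forall_plus)

lemma diag_mat_2n_mult: "diag_mat_2n d ** diag_mat_2n d' = diag_mat_2n (\<lambda>i. d i * d' i)"
  by (simp add: vec_eq_iff matrix_mult_nth sum_delta_mult)

lemma diag_sim_sim:
  assumes "\<And>i. a i \<le> e"
  shows "diag_sim p e a ** sadj (diag_sim p e a) = mat (int p ^ e)"
  using assms
  by (simp add: diag_sim_def sadj_diag_mat_2n diag_mat_2n_mult vec_eq_iff forall_plus mat_nth flip: power_add)

lemma simmod_padic:
  assumes "prime p" "X \<in> Sim p e"
  shows "simmod p e k (X k)"
proof -
  have "padic_mult p X (padj p X) k = padic_of_int p (mat (int p ^ e)) k"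
    using assms(2) by (simp add: Sim_def)
  moreover have "padic_mult p (padj p X) X k = padic_of_int p (mat (int p ^ e)) k"
    using Sim_padj_left[OF assms] by simp
  ultimately show ?thesis
    by (simp add: simmod_def padic_mult_def padj_def padic_of_int_def)
qed

text \<open>X is diagonalised modulo a power of p, and the same product of integral matrices is read
  globally: g agrees with X modulo p^e, which suffices by \<open>Sim_eq_level\<close>. Modulo N, g
  is the diagonal matrix, so its lower left block vanishes.\<close>

theorem coset_representative:
  fixes X :: "('n::{finite,linorder} + 'n) padic_mat"
  assumes p: "prime p" "\<not> p dvd N" and X: "X \<in> Sim p e"
  obtains g a where "g \<in> Delta0 N" "g ** sadj g = mat (int p ^ e)" "X \<in> LC p (padic_of_int p g)"
    "mono a" "\<And>i. 2 * a i \<le> e" "padic_of_int p g \<in> DC p (padic_of_int p (diag_sim p e a))"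
proof -
  \<comment> \<open>The elimination needs a final precision strictly above e, hence
    \<open>Suc e\<close>; the second summand is what the pivots consume.\<close>
  define k where "k = Suc e + 3 * e * CARD('n)"
  have sm: "simmod p e (Suc e + 3 * e * CARD('n)) (X k)"
    using simmod_padic[OF p(1) X, of k] by (simp add: k_def)
  obtain \<tau> \<sigma> a where r: "\<tau> \<in> transv_group N" "\<sigma> \<in> transv_group N" "mono a" "\<And>i. 2 * a i \<le> e"
    "reduce_mat (int p ^ Suc e) (X k) = reduce_mat (int p ^ Suc e) (\<tau> ** diag_sim p e a ** \<sigma>)"
    by (rule reduction_to_diagonal[OF p sm lessI], rule that)
  define g where "g = \<tau> ** diag_sim p e a ** \<sigma>"
  have ae: "a i \<le> e" for i using r(4)[of i] by simp
  have sg: "g ** sadj g = mat (int p ^ e)"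
    using sim_mult[OF sim_mult[OF transv_group_inverse[OF r(1)] diag_sim_sim[of a e p, OF ae]] transv_group_inverse[OF r(2)]]
    by (simp add: g_def)
  have "X e = reduce_mat (int p ^ e) (X k)"
    using X by (intro padic_mats_reduce) (auto simp: Sim_def k_def)
  also have "\<dots> = reduce_mat (int p ^ e) g"
    unfolding g_def by (rule reduce_mat_dvd[OF r(5)]) (simp add: le_imp_power_dvd)
  finally have "X e = padic_of_int p g e"
    by (simp add: padic_of_int_def)
  then have XL: "X \<in> LC p (padic_of_int p g)"
    using Sim_eq_level[OF p(1) X Sim_of_int[OF sg]] by (metis LC_iff)
  have "reduce_mat (int N) g = reduce_mat (int N) (mat 1 ** diag_sim p e a ** mat 1)"
    unfolding g_def by (intro reduce_mat_mult_cong transv_group_cong_1 r refl)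
  then have "int N dvd g $ Inr i $ Inl j - diag_sim p e a $ Inr i $ Inl j" for i j
    by (simp only: reduce_mat_eq_iff matrix_mul_lid matrix_mul_rid)
  then have "int N dvd g $ Inr i $ Inl j" for i j
    by (simp add: diag_sim_def)
  then have gD: "g \<in> Delta0 N"
    using sg p(1) unfolding Delta0_iff by (intro conjI exI[of _ "int p ^ e"]) (auto simp: prime_gt_0_nat)
  have "padic_of_int p g \<in> DC p (padic_of_int p (diag_sim p e a))"
    unfolding DC_iff g_def
    using Sim_0_of_int[OF transv_group_inverse[OF r(1)]] Sim_0_of_int[OF transv_group_inverse[OF r(2)]] by (metis padic_of_int_mult)
  then show thesis using that gD sg XL r(3,4) by blast
qed

lemma finite_vec_components:
  assumes "finite A"
  shows "finite {v :: 'a^'m. \<forall>i. v $ i \<in> A}"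
proof (rule finite_subset)
  show "{v :: 'a^'m. \<forall>i. v $ i \<in> A} \<subseteq> vec_lambda ` (PiE UNIV (\<lambda>_. A))"
    by (auto simp: image_iff intro!: bexI[of _ "vec_nth _"])
  show "finite ((vec_lambda :: _ \<Rightarrow> 'a^'m) ` (PiE UNIV (\<lambda>_. A)))"
    using assms by (intro finite_imageI finite_PiE) auto
qed

text \<open>Guarantees that the choice by \<open>SOME\<close> in \<open>hecke_coset_op\<close>
  yields genuine representatives. They are finite in number because a left coset in
  \<open>Sim p e\<close> is determined by a residue modulo p^e of any of its elements.\<close>

lemma hecke_reps_exists:
  fixes D :: "('n::{finite,linorder} + 'n) padic_mat set"
  assumes p: "prime p" "\<not> p dvd N" and D: "D \<subseteq> Sim p e" "\<And>X. X \<in> D \<Longrightarrow> LC p X \<subseteq> D"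
  shows "\<exists>R. hecke_reps N p D R"
proof -
  have "\<exists>g. g \<in> Delta0 N \<and> g ** sadj g = mat (int p ^ e) \<and> LC p X = LC p (padic_of_int p g)" if "X \<in> D" for X
    using coset_representative[OF p, of X e] that D(1) LC_eq_iff[OF p(1)] Sim_in padic_of_int_in by (metis subsetD)
  then obtain rep where rep: "\<And>X. X \<in> D \<Longrightarrow> rep X \<in> Delta0 N \<and> rep X ** sadj (rep X) = mat (int p ^ e) \<and> LC p X = LC p (padic_of_int p (rep X))"
    by metis
  define f where "f = (\<lambda>C. rep (SOME X. X \<in> D \<and> LC p X = C))"
  define R where "R = f ` (LC p ` D)"
  have f: "f C \<in> Delta0 N \<and> f C ** sadj (f C) = mat (int p ^ e) \<and> LC p (padic_of_int p (f C)) = C" if "C \<in> LC p ` D" for C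
  proof -
    have "\<exists>X. X \<in> D \<and> LC p X = C" using that by auto
    from someI_ex[OF this] show ?thesis
      using rep by (auto simp: f_def)
  qed
  have "finite R"
  proof (rule inj_on_finite)
    show "inj_on (\<lambda>g. reduce_mat (int p ^ e) g) R"
    proof (rule inj_onI)
      fix g h assume gh: "g \<in> R" "h \<in> R" "reduce_mat (int p ^ e) g = reduce_mat (int p ^ e) h"
      then have s: "padic_of_int p g \<in> Sim p e" "padic_of_int p h \<in> Sim p e"
        using f Sim_of_int unfolding R_def by blast+
      have "padic_of_int p g \<in> LC p (padic_of_int p h)"
        using Sim_eq_level[OF p(1) s] gh(3) LC_iff unfolding padic_of_int_def by metis
      then have "LC p (padic_of_int p g) = LC p (padic_of_int p h)"
        by (simp add: LC_eq_iff p(1))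
      then show "g = h" using gh(1,2) f unfolding R_def by auto
    qed
    show "reduce_mat (int p ^ e) ` R \<subseteq> {A. \<forall>i. A $ i \<in> {r. \<forall>j. r $ j \<in> {0..<int p ^ e}}}"
      using p(1) by (auto simp: prime_gt_0_nat)
    show "finite {A :: (int, 'n) mat_2n. \<forall>i. A $ i \<in> {r. \<forall>j. r $ j \<in> {0..<int p ^ e}}}"
      by (intro finite_vec_components) simp
  qed
  moreover have "R \<subseteq> Delta0 N"
    using f by (auto simp: R_def)
  moreover have "D = (\<Union>g\<in>R. LC p (padic_of_int p g))"
  proof -
    have "(\<Union>g\<in>R. LC p (padic_of_int p g)) = (\<Union>X\<in>D. LC p X)"
      using f by (simp add: R_def)
    also have "\<dots> = D"
      using D(2) LC_self[OF Sim_in[OF subsetD[OF D(1)]]] by blast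
    finally show ?thesis by simp
  qed
  moreover have "LC p (padic_of_int p g) \<inter> LC p (padic_of_int p h) = {}" if "g \<in> R" "h \<in> R" "g \<noteq> h" for g h
  proof (rule ccontr)
    assume "\<not> ?thesis"
    then have "LC p (padic_of_int p g) = LC p (padic_of_int p h)"
      by (rule LC_disjoint[OF p(1) padic_of_int_in padic_of_int_in])
    then show False using that f unfolding R_def by auto
  qed
  ultimately show ?thesis unfolding hecke_reps_def by blast
qed

section \<open>The double cosets of T(p) and T_j(p^2)\<close>

definition coset_Tp :: "nat \<Rightarrow> ('n::finite + 'n) padic_mat set" where
  "coset_Tp p = DC p (padic_of_int p (diag_mat_2n (case_sum (\<lambda>i. 1) (\<lambda>i. int p))))"

definition coset_Tj :: "nat \<Rightarrow> nat \<Rightarrow> ('n::{finite,linorder} + 'n) padic_mat set" where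
  "coset_Tj p j = DC p (padic_of_int p (diag_mat_2n (case_sum
       (\<lambda>i. if card {k. k < i} < CARD('n) - j then 1 else int p)
       (\<lambda>i. if card {k. k < i} < CARD('n) - j then (int p)\<^sup>2 else int p))))"

lemma coset_Tp_Sim: "coset_Tp p \<subseteq> Sim p 1"
  unfolding coset_Tp_def by (intro DC_Sim Sim_of_int)
    (simp add: sadj_diag_mat_2n diag_mat_2n_mult vec_eq_iff forall_plus mat_nth)

lemma coset_Tj_Sim: "coset_Tj p j \<subseteq> Sim p 2"
  unfolding coset_Tj_def by (intro DC_Sim Sim_of_int)
    (simp add: sadj_diag_mat_2n diag_mat_2n_mult vec_eq_iff forall_plus mat_nth power2_eq_square)

text \<open>Only the exponents 0 and 1 occur, and by monotonicity the zeros occupy the first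
  \<open>card Z\<close> positions; therefore j is n minus \<open>card Z\<close>.\<close>

lemma mono_diag_in_coset_Tj:
  fixes a :: "'n::{finite,linorder} \<Rightarrow> nat"
  assumes "mono a" "\<And>i. 2 * a i \<le> 2"
  shows "\<exists>j\<le>CARD('n). DC p (padic_of_int p (diag_sim p 2 a)) = coset_Tj p j"
proof -
  define Z where "Z = {i. a i = 0}"
  have Z: "card Z \<le> CARD('n)" by (rule card_mono) auto
  have *: "card {k. k < i} < card Z \<longleftrightarrow> a i = 0" for i
  proof
    assume "a i = 0"
    then have "{k. k \<le> i} \<subseteq> Z"
      using monoD[OF assms(1)] by (force simp: Z_def)
    moreover have "{k. k < i} \<subset> {k. k \<le> i}" by auto
    ultimately show "card {k. k < i} < card Z"
      by (meson finite psubset_card_mono card_mono order_less_le_trans)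
  next
    assume lt: "card {k. k < i} < card Z"
    show "a i = 0"
    proof (rule ccontr)
      assume ai: "a i \<noteq> 0"
      have "Z \<subseteq> {k. k < i}"
      proof
        fix k assume "k \<in> Z"
        then show "k \<in> {k. k < i}"
          using monoD[OF assms(1), of i k] ai by (force simp: Z_def not_less)
      qed
      then show False using lt card_mono[of "{k. k < i}" Z] by simp
    qed
  qed
  have a1: "a i = 0 \<or> a i = 1" for i using assms(2)[of i] by linarith
  have a2: "int p ^ a i = (if a i = 0 then 1 else int p)" "int p ^ (2 - a i) = (if a i = 0 then (int p)\<^sup>2 else int p)" for i
    using a1[of i] by auto
  have "diag_sim p 2 a = diag_mat_2n (case_sum
       (\<lambda>i. if card {k. k < i} < card Z then 1 else int p)
       (\<lambda>i. if card {k. k < i} < card Z then (int p)\<^sup>2 else int p))"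
    unfolding * diag_sim_def a2 ..
  then have "DC p (padic_of_int p (diag_sim p 2 a)) = coset_Tj p (CARD('n) - card Z)"
    using Z by (simp add: coset_Tj_def)
  then show ?thesis by (intro exI[of _ "CARD('n) - card Z"]) auto
qed

lemma similitude_p2_cosets_eq:
  assumes "prime p"
  shows "similitude_p2_cosets p = (\<lambda>X. DC p X) ` Sim p 2"
proof -
  have "X \<in> padic_mats p \<and> padic_mult p (padic_mult p (padic_transpose X) (padic_of_int p symp_J)) X
          = padic_of_int p (scale_mat ((int p)\<^sup>2) symp_J) \<longleftrightarrow> X \<in> Sim p 2" for X
    unfolding transpose_sim_iff using Sim_iff_left[OF assms, of X 2] Sim_in by blast
  then show ?thesis
    by (auto simp: similitude_p2_cosets_def)
qed

lemma similitude_p2_cosets_subset: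
  assumes "prime p"
  shows "similitude_p2_cosets p \<subseteq> (coset_Tj p :: nat \<Rightarrow> ('n::{finite,linorder} + 'n) padic_mat set) ` {..CARD('n)}"
proof
  fix D :: "('n + 'n) padic_mat set" assume "D \<in> similitude_p2_cosets p"
  then obtain X where X: "X \<in> Sim p 2" "D = DC p X"
    using similitude_p2_cosets_eq[OF assms] by blast
  \<comment> \<open>Double cosets do not involve the level, so representatives of level 1
    serve.\<close>
  have "\<not> p dvd 1" using assms not_prime_unit by blast
  then obtain g a where *: "X \<in> LC p (padic_of_int p g)"
    "mono a" "\<And>i. 2 * a i \<le> 2" "padic_of_int p g \<in> DC p (padic_of_int p (diag_sim p 2 a))"
    using coset_representative[OF assms _ X(1), of 1] by metis
  then have "X \<in> DC p (padic_of_int p (diag_sim p 2 a))"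
    using LC_subset_DC by blast
  then have "D = DC p (padic_of_int p (diag_sim p 2 a))"
    using DC_eq[OF assms] X(2) by blast
  then show "D \<in> coset_Tj p ` {..CARD('n)}"
    using mono_diag_in_coset_Tj[OF *(2,3)] by fastforce
qed

subsection \<open>The action on the Siegel upper half space\<close>

lemma matrix_add_right_distrib: "(A + B) ** C = A ** C + B ** (C :: 'a::comm_ring_1^'k^'m)"
  by (simp add: vec_eq_iff matrix_mult_nth distrib_right sum.distrib)

lemma matrix_inv_mult:
  assumes "invertible A"
  shows "A ** matrix_inv A = mat 1" "matrix_inv A ** A = mat 1"
proof -
  have "\<exists>B. A ** B = mat 1 \<and> B ** A = mat 1"
    using assms by (simp add: invertible_def)
  from someI_ex[OF this] show "A ** matrix_inv A = mat 1" "matrix_inv A ** A = mat 1"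
    by (simp_all add: matrix_inv_def)
qed

lemma matrix_inv_unique:
  assumes "A ** B = mat 1" "B ** A = mat 1"
  shows "matrix_inv A = B"
proof -
  have "invertible A" using assms by (auto simp: invertible_def)
  then have "matrix_inv A = matrix_inv A ** (A ** B)"
    by (simp add: assms)
  also have "\<dots> = B"
    by (simp add: matrix_mul_assoc matrix_inv_mult[OF \<open>invertible A\<close>])
  finally show ?thesis .
qed

lemma map_matrix_of_int_mult: "map_matrix of_int (A ** B) = map_matrix of_int A ** (map_matrix of_int B :: 'a::comm_ring_1^'k^'m)"
  by (simp add: vec_eq_iff matrix_mult_nth)

lemma map_matrix_of_int_sadj: "map_matrix of_int (sadj A) = sadj (map_matrix of_int A)"
  by (simp add: vec_eq_iff forall_plus)

lemma map_matrix_of_rat_of_int [simp]: "map_matrix of_rat (map_matrix of_int g) = map_matrix of_int g"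
  by (simp add: vec_eq_iff)

lemma map_matrix_sim:
  assumes "g ** sadj g = mat c"
  shows "map_matrix of_int g ** sadj (map_matrix of_int g) = (mat (of_int c) :: ('a::comm_ring_1, 'n::finite) mat_2n)"
proof -
  have "map_matrix of_int g ** sadj (map_matrix of_int g) = map_matrix of_int (g ** sadj g)"
    by (simp only: map_matrix_of_int_mult map_matrix_of_int_sadj)
  also have "map_matrix of_int (g ** sadj g) = (mat (of_int c) :: ('a, 'n) mat_2n)"
    unfolding assms by (simp add: vec_eq_iff mat_nth)
  finally show ?thesis .
qed

lemma field_factor_commute:
  fixes A B :: "'a::field^'m^'m"
  assumes "A ** B = mat c" "c \<noteq> 0"
  shows "B ** A = mat c"
proof -
  have "A ** scale_mat (1 / c) B = scale_mat (1 / c) (A ** B)"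
    by (rule scale_mat_mult_right)
  also have "\<dots> = mat 1"
    using assms(2) by (simp add: assms(1)) (simp add: vec_eq_iff mat_nth)
  finally have "scale_mat (1 / c) B ** A = mat 1"
    by (rule matrix_left_right_inverse1)
  then have "scale_mat (1 / c) (B ** A) = mat 1"
    by (simp add: scale_mat_mult_left)
  then have "scale_mat c (scale_mat (1 / c) (B ** A)) = scale_mat c (mat 1)"
    by simp
  then show ?thesis
    using assms(2) by (simp add: scale_mat_scale_mat) (simp add: vec_eq_iff mat_nth)
qed

lemma similitude_of_int:
  assumes "g ** sadj g = mat c"
  shows "similitude (map_matrix of_int g :: (rat, 'n::finite) mat_2n) = of_int c"
proof -
  have "(map_matrix of_int g :: (rat, 'n) mat_2n) ** sadj (map_matrix of_int g) = mat e \<longleftrightarrow> e = of_int c" for e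
    unfolding map_matrix_sim[OF assms] by (auto simp: vec_eq_iff mat_nth)
  then show ?thesis
    by (simp add: similitude_def sim_iff_sadj)
qed

lemma block_mult:
  "block_A (G ** H) = block_A G ** block_A H + block_B G ** block_C H"
  "block_B (G ** H) = block_A G ** block_B H + block_B G ** block_D H"
  "block_C (G ** H) = block_C G ** block_A H + block_D G ** block_C H"
  "block_D (G ** H) = block_C G ** block_B H + block_D G ** block_D H"
  by (simp_all add: vec_eq_iff block_A_def block_B_def block_C_def block_D_def matrix_mult_nth sum_UNIV_plus)

lemma block_sadj:
  "block_A (sadj G) = transpose (block_D G)" "block_B (sadj G) = - transpose (block_B G)"
  "block_C (sadj G) = - transpose (block_C G)" "block_D (sadj G) = transpose (block_A G)"
  by (simp_all add: vec_eq_iff block_A_def block_B_def block_C_def block_D_def)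

lemma block_mat:
  "block_A (mat c) = mat c" "block_B (mat c) = 0" "block_C (mat c) = 0" "block_D (mat c) = mat c"
  by (simp_all add: vec_eq_iff block_A_def block_B_def block_C_def block_D_def mat_nth)

lemma matrix_uminus_left: "(- A) ** B = - (A ** (B :: 'a::comm_ring_1^'k^'m))"
  by (simp add: vec_eq_iff matrix_mult_nth sum_negf)

definition num_factor :: "(complex, 'n::finite) mat_2n \<Rightarrow> 'n cmat \<Rightarrow> 'n cmat" where
  "num_factor g z = block_A g ** z + block_B g"

lemma transpose_add: "transpose (A + B) = transpose A + transpose (B :: 'a::comm_ring_1^'k^'m)"
  by (simp add: vec_eq_iff)

text \<open>These are the four block equations of the hypothesis, combined. With w = z the relation
  gives the symmetry of the image point, with w the complex conjugate of z its positivity.\<close>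

lemma auto_num_relation:
  fixes G :: "(complex, 'n::finite) mat_2n"
  assumes "sadj G ** G = mat c"
  shows "transpose (auto_factor G w) ** num_factor G z - transpose (num_factor G w) ** auto_factor G z
    = scale_mat c (z - transpose w)"
proof -
  let ?A = "block_A G" and ?B = "block_B G" and ?C = "block_C G" and ?D = "block_D G" and ?w = "transpose w"
  have r: "transpose ?D ** ?A - transpose ?B ** ?C = mat c" "transpose ?D ** ?B - transpose ?B ** ?D = 0"
    "transpose ?A ** ?C - transpose ?C ** ?A = 0" "transpose ?A ** ?D - transpose ?C ** ?B = mat c"
    using arg_cong[OF assms, of block_A] arg_cong[OF assms, of block_B] arg_cong[OF assms, of block_C] arg_cong[OF assms, of block_D]
    by (simp_all add: block_mult block_sadj block_mat matrix_uminus_left)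
  have "transpose (auto_factor G w) ** num_factor G z - transpose (num_factor G w) ** auto_factor G z =
    (transpose ?D ** ?A - transpose ?B ** ?C) ** z + (transpose ?D ** ?B - transpose ?B ** ?D)
    - ?w ** (transpose ?A ** ?C - transpose ?C ** ?A) ** z - ?w ** (transpose ?A ** ?D - transpose ?C ** ?B)"
    by (simp add: auto_factor_def num_factor_def transpose_add matrix_transpose_mul matrix_add_ldistrib
        matrix_add_right_distrib matrix_minus_left matrix_minus_right matrix_mul_assoc)
  also have "?w ** (transpose ?A ** ?C - transpose ?C ** ?A) ** z = 0"
    unfolding r by (simp add: vec_eq_iff matrix_mult_nth)
  finally show ?thesis
    unfolding r mat_mult_eq by (simp add: vec_eq_iff right_diff_distrib)
qed

section \<open>Positivity of the imaginary part, and stability of the half space under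
  similitudes\<close>

definition herm :: "complex^'m \<Rightarrow> complex^'m \<Rightarrow> complex" where
  "herm u w = (\<Sum>i\<in>UNIV. cnj (u $ i) * w $ i)"

lemma herm_simps:
  "herm u (w - w') = herm u w - herm u w'" "herm u (c *s w) = c * herm u w" "herm u 0 = 0" "herm 0 w = 0"
  by (simp_all add: herm_def right_diff_distrib sum_subtractf sum_distrib_left mult.left_commute)

lemma herm_adjoint: "herm (M *v u) w = herm u (transpose (map_matrix cnj M) *v w)"
proof -
  have "herm (M *v u) w = (\<Sum>i\<in>UNIV. \<Sum>j\<in>UNIV. cnj (u $ j) * (cnj (M $ i $ j) * w $ i))"
    by (simp add: herm_def matrix_vector_mult_def sum_distrib_left sum_distrib_right mult_ac)
  also have "\<dots> = (\<Sum>j\<in>UNIV. cnj (u $ j) * (\<Sum>i\<in>UNIV. cnj (M $ i $ j) * w $ i))"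
    by (subst sum.swap) (simp add: sum_distrib_left)
  finally show ?thesis
    by (simp add: herm_def matrix_vector_mult_def[of "transpose _"] del: transpose_matrix_vector)
qed

text \<open>z minus its conjugate is 2i Im z, and the real part of
  \<open>cnj (v $ i) * v $ j\<close> splits into products of real parts and of imaginary parts. So
  positivity on real vectors passes to complex ones.\<close>

lemma Im_herm:
  "Im (herm v ((z - map_matrix cnj z) *v v)) =
    2 * ((\<chi> i. Re (v $ i)) \<bullet> (map_matrix Im z *v (\<chi> i. Re (v $ i))) + (\<chi> i. Im (v $ i)) \<bullet> (map_matrix Im z *v (\<chi> i. Im (v $ i))))"
proof -
  have "herm v ((z - map_matrix cnj z) *v v) = (\<Sum>i\<in>UNIV. \<Sum>j\<in>UNIV. cnj (v $ i) * ((z $ i $ j - cnj (z $ i $ j)) * v $ j))"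
    by (simp add: herm_def matrix_vector_mult_def sum_distrib_left)
  then have "Im (herm v ((z - map_matrix cnj z) *v v)) = (\<Sum>i\<in>UNIV. \<Sum>j\<in>UNIV. Im (cnj (v $ i) * ((z $ i $ j - cnj (z $ i $ j)) * v $ j)))"
    by simp
  also have "\<dots> = (\<Sum>i\<in>UNIV. \<Sum>j\<in>UNIV. 2 * (Re (v $ i) * (Im (z $ i $ j) * Re (v $ j))) + 2 * (Im (v $ i) * (Im (z $ i $ j) * Im (v $ j))))"
    by (intro sum.cong refl) (simp add: algebra_simps)
  finally show ?thesis
    by (simp add: inner_vec_def matrix_vector_mult_def sum.distrib sum_distrib_left distrib_left)
qed

lemma siegel_pos:
  assumes "z \<in> siegel_space" "v \<noteq> 0"
  shows "Im (herm v ((z - map_matrix cnj z) *v v)) > 0"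
proof -
  let ?q = "\<lambda>y. y \<bullet> (map_matrix Im z *v y)"
  have q: "?q y > 0" if "y \<noteq> 0" for y
    using assms(1) that by (simp add: siegel_space_def)
  then have q0: "?q y \<ge> 0" for y
    by (cases "y = 0") (auto simp: less_imp_le)
  have "(\<chi> i. Re (v $ i)) \<noteq> 0 \<or> (\<chi> i. Im (v $ i)) \<noteq> 0"
    using assms(2) by (auto simp: vec_eq_iff complex_eq_iff)
  then have "?q (\<chi> i. Re (v $ i)) + ?q (\<chi> i. Im (v $ i)) > 0"
    using q q0 by (metis add_pos_nonneg add_nonneg_pos)
  then show ?thesis by (simp add: Im_herm)
qed

locale real_similitude =
  fixes g :: "(int, 'n::finite) mat_2n" and c :: int
  assumes sim: "g ** sadj g = mat c" and c_pos: "c > 0"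
begin

abbreviation "G \<equiv> (map_matrix of_int g :: (complex, 'n) mat_2n)"

lemma sadj_G: "sadj G ** G = mat (of_int c)"
  using field_factor_commute[OF map_matrix_sim[OF sim, where 'a = complex]] c_pos by simp

lemma herm_auto_num:
  assumes z: "z \<in> siegel_space"
  shows "herm (auto_factor G z *v v) (num_factor G z *v v) - herm (num_factor G z *v v) (auto_factor G z *v v)
    = of_int c * herm v ((z - map_matrix cnj z) *v v)"
proof -
  have cnj_mult: "map_matrix cnj (A ** B) = map_matrix cnj A ** map_matrix cnj B" for A B :: "'n cmat"
    by (simp add: vec_eq_iff matrix_mult_nth)
  have cnj_add: "map_matrix cnj (A + B) = map_matrix cnj A + map_matrix cnj B" for A B :: "'n cmat"
    by (simp add: vec_eq_iff)
  have cnj_block: "map_matrix cnj (block_A G) = block_A G" "map_matrix cnj (block_B G) = block_B G"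
    "map_matrix cnj (block_C G) = block_C G" "map_matrix cnj (block_D G) = block_D G"
    by (simp_all add: vec_eq_iff block_A_def block_B_def block_C_def block_D_def)
  have c1: "map_matrix cnj (auto_factor G z) = auto_factor G (map_matrix cnj z)"
    "map_matrix cnj (num_factor G z) = num_factor G (map_matrix cnj z)"
    by (simp_all add: auto_factor_def num_factor_def cnj_add cnj_mult cnj_block)
  have zz: "transpose (map_matrix cnj z) = map_matrix cnj z"
    using z by (simp add: siegel_space_def vec_eq_iff)
  have "herm (auto_factor G z *v v) (num_factor G z *v v) - herm (num_factor G z *v v) (auto_factor G z *v v) =
    herm v ((transpose (auto_factor G (map_matrix cnj z)) ** num_factor G z - transpose (num_factor G (map_matrix cnj z)) ** auto_factor G z) *v v)"
    by (simp add: herm_adjoint c1 herm_simps matrix_vector_mul_assoc matrix_vector_mult_diff_rdistrib del: transpose_matrix_vector)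
  also have "\<dots> = of_int c * herm v ((z - map_matrix cnj z) *v v)"
    unfolding auto_num_relation[OF sadj_G] zz by (simp add: scale_mat_vec herm_simps)
  finally show ?thesis .
qed

text \<open>A nonzero kernel vector of C z + D would make the left side of
  \<open>herm_auto_num\<close> vanish, against \<open>siegel_pos\<close>.\<close>

lemma auto_factor_invertible:
  assumes z: "z \<in> siegel_space"
  shows "invertible (auto_factor G z)"
proof -
  have "v = 0" if "auto_factor G z *v v = 0" for v
  proof (rule ccontr)
    assume "v \<noteq> 0"
    have "of_int c * herm v ((z - map_matrix cnj z) *v v) = 0"
      using herm_auto_num[OF z, of v] that by (simp add: herm_simps)
    then show False
      using siegel_pos[OF z \<open>v \<noteq> 0\<close>] c_pos by simp
  qed
  then show ?thesis
    using invertible_left_inverse matrix_left_invertible_ker by blast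
qed

lemma siegel_act_in:
  assumes z: "z \<in> siegel_space"
  shows "siegel_act G z \<in> siegel_space"
proof -
  let ?Q = "auto_factor G z" and ?P = "num_factor G z" and ?Z = "siegel_act G z"
  define R where "R = matrix_inv ?Q"
  have R: "?Q ** R = mat 1" "R ** ?Q = mat 1"
    using matrix_inv_mult[OF auto_factor_invertible[OF z]] by (simp_all add: R_def)
  have Z: "?Z = ?P ** R"
    by (simp add: siegel_act_def num_factor_def R_def)
  have "transpose z = z" using z by (simp add: siegel_space_def)
  then have "transpose ?Q ** ?P - transpose ?P ** ?Q = 0"
    using auto_num_relation[OF sadj_G, of z z] by (simp add: vec_eq_iff)
  then have QP: "transpose ?Q ** ?P = transpose ?P ** ?Q" by simp
  have "transpose ?Z = transpose R ** transpose ?P ** (?Q ** R)"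
    by (simp add: Z matrix_transpose_mul R)
  also have "\<dots> = transpose R ** (transpose ?P ** ?Q) ** R"
    by (simp only: matrix_mul_assoc)
  also have "\<dots> = transpose (?Q ** R) ** ?P ** R"
    by (simp only: QP[symmetric] matrix_mul_assoc matrix_transpose_mul)
  finally have sym: "transpose ?Z = ?Z"
    by (simp add: R Z)
  have "y \<bullet> (map_matrix Im ?Z *v y) > 0" if "y \<noteq> 0" for y
  proof -
    define y' :: "complex^'n" where "y' = (\<chi> i. of_real (y $ i))"
    \<comment> \<open>With this v, C z + D sends v to the real vector y', and A z + B sends it to
      the image point applied to y'; positivity at z then transfers to the image point.\<close>
    define v where "v = R *v y'"
    have Qv: "?Q *v v = y'"
      by (simp add: v_def matrix_vector_mul_assoc R)
    have Pv: "?P *v v = ?Z *v y'"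
      by (simp add: v_def matrix_vector_mul_assoc Z)
    have "y' \<noteq> 0"
      using that by (auto simp: y'_def vec_eq_iff)
    then have "v \<noteq> 0"
      using Qv by (metis matrix_vector_mult_0_right)
    have cZ: "transpose (map_matrix cnj ?Z) = map_matrix cnj ?Z"
      using sym by (simp add: vec_eq_iff)
    have "herm y' ((?Z - map_matrix cnj ?Z) *v y') = herm y' (?Z *v y') - herm (?Z *v y') y'"
      by (simp add: herm_adjoint[of ?Z] cZ matrix_vector_mult_diff_rdistrib herm_simps del: transpose_matrix_vector)
    also have "\<dots> = of_int c * herm v ((z - map_matrix cnj z) *v v)"
      using herm_auto_num[OF z, of v] by (simp only: Qv Pv)
    finally have "Im (herm y' ((?Z - map_matrix cnj ?Z) *v y')) = of_int c * Im (herm v ((z - map_matrix cnj z) *v v))"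
      by simp
    also have "\<dots> > 0"
      using siegel_pos[OF z \<open>v \<noteq> 0\<close>] c_pos by simp
    finally show ?thesis
      unfolding Im_herm by (simp add: y'_def inner_vec_def)
  qed
  then show ?thesis
    using sym by (simp add: siegel_space_def)
qed

end

lemma auto_factor_cocycle:
  assumes "invertible (auto_factor H z)"
  shows "auto_factor (G ** H) z = auto_factor G (siegel_act H z) ** auto_factor H z"
    and "num_factor (G ** H) z = num_factor G (siegel_act H z) ** auto_factor H z"
proof -
  have "siegel_act H z ** auto_factor H z = num_factor H z ** (matrix_inv (auto_factor H z) ** auto_factor H z)"
    by (simp add: siegel_act_def num_factor_def matrix_mul_assoc)
  then have *: "siegel_act H z ** auto_factor H z = num_factor H z"
    by (simp add: matrix_inv_mult[OF assms])
  have **: "(M ** siegel_act H z + L) ** auto_factor H z = M ** num_factor H z + L ** auto_factor H z" for M L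
    by (simp add: matrix_add_right_distrib matrix_mul_assoc[symmetric] *)
  then show "auto_factor (G ** H) z = auto_factor G (siegel_act H z) ** auto_factor H z"
    "num_factor (G ** H) z = num_factor G (siegel_act H z) ** auto_factor H z"
    unfolding auto_factor_def[of G] num_factor_def[of G] **
    by (simp_all add: auto_factor_def num_factor_def block_mult matrix_add_ldistrib matrix_add_right_distrib matrix_mul_assoc add_ac)
qed

lemma siegel_act_mult:
  assumes H: "invertible (auto_factor H z)" and G: "invertible (auto_factor G (siegel_act H z))"
  shows "siegel_act (G ** H) z = siegel_act G (siegel_act H z)"
proof -
  let ?Q = "auto_factor H z" and ?Q' = "auto_factor G (siegel_act H z)"
  note i = matrix_inv_mult[OF H] matrix_inv_mult[OF G]
  have a: "(A ** B) ** (C ** D) = A ** (B ** C) ** D" for A B C D :: "'a cmat"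
    by (simp add: matrix_mul_assoc)
  have inv: "matrix_inv (?Q' ** ?Q) = matrix_inv ?Q ** matrix_inv ?Q'"
    by (rule matrix_inv_unique) (simp_all add: a i)
  have "siegel_act (G ** H) z = (num_factor G (siegel_act H z) ** ?Q) ** (matrix_inv ?Q ** matrix_inv ?Q')"
    by (simp only: siegel_act_def[of "G ** H"] num_factor_def[symmetric] auto_factor_cocycle[OF H] inv)
  then show ?thesis
    by (simp add: a i siegel_act_def[of G] num_factor_def)
qed

section \<open>The slash operator as a right action\<close>

lemma polynomial_rep_mult:
  "polynomial_rep \<rho> \<Longrightarrow> invertible g \<Longrightarrow> invertible h \<Longrightarrow> \<rho> (g ** h) = \<rho> g ** \<rho> h"
  by (simp add: polynomial_rep_def)

lemma polynomial_rep_invertible: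
  assumes "polynomial_rep \<rho>" "invertible g"
  shows "invertible (\<rho> g)"
proof -
  have "invertible (matrix_inv g)"
    using matrix_inv_mult[OF assms(2)] by (auto simp: invertible_def)
  then have "\<rho> g ** \<rho> (matrix_inv g) = mat 1" "\<rho> (matrix_inv g) ** \<rho> g = mat 1"
    using assms matrix_inv_mult[OF assms(2)] polynomial_rep_mult[OF assms(1), symmetric] by (simp_all add: polynomial_rep_def)
  then show ?thesis by (auto simp: invertible_def)
qed

text \<open>The automorphy factor is a cocycle and the similitude factor is multiplicative, so
  nothing is left over; being a right action, it reverses the order of the product.\<close>

lemma slash_slash:
  assumes \<rho>: "polynomial_rep \<rho>" and g: "g ** sadj g = mat c" "c > 0" and h: "h ** sadj h = mat d" "d > 0"
    and z: "z \<in> siegel_space"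
  shows "slash \<rho> lam (map_matrix of_int g) (slash \<rho> lam (map_matrix of_int h) F) z = slash \<rho> lam (map_matrix of_int (h ** g)) F z"
proof -
  interpret g: real_similitude g c by unfold_locales (use g in auto)
  interpret h: real_similitude h d by unfold_locales (use h in auto)
  let ?G = "map_matrix of_int g :: (complex, 'a) mat_2n" and ?H = "map_matrix of_int h :: (complex, 'a) mat_2n"
  let ?w = "siegel_act ?G z"
  note hg = sim_mult[OF h(1) g(1)]
  have w: "?w \<in> siegel_space" by (rule g.siegel_act_in[OF z])
  have ig: "invertible (auto_factor ?G z)" by (rule g.auto_factor_invertible[OF z])
  have ih: "invertible (auto_factor ?H ?w)" by (rule h.auto_factor_invertible[OF w])
  have act: "siegel_act (?H ** ?G) z = siegel_act ?H ?w"
    by (rule siegel_act_mult[OF ig ih])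
  have rho: "\<rho> (auto_factor (?H ** ?G) z) = \<rho> (auto_factor ?H ?w) ** \<rho> (auto_factor ?G z)"
    unfolding auto_factor_cocycle[OF ig] by (rule polynomial_rep_mult[OF \<rho> ih ig])
  note i = matrix_inv_mult[OF polynomial_rep_invertible[OF \<rho> ig]] matrix_inv_mult[OF polynomial_rep_invertible[OF \<rho> ih]]
  have a: "(A ** B) ** (C ** D) = A ** (B ** C) ** D" for A B C D :: "'b cmat"
    by (simp add: matrix_mul_assoc)
  have inv: "matrix_inv (\<rho> (auto_factor ?H ?w) ** \<rho> (auto_factor ?G z)) = matrix_inv (\<rho> (auto_factor ?G z)) ** matrix_inv (\<rho> (auto_factor ?H ?w))"
    by (rule matrix_inv_unique) (simp_all add: a i)
  have hgm: "map_matrix of_int (h ** g) = ?H ** ?G"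
    by (rule map_matrix_of_int_mult)
  show ?thesis
    by (simp add: slash_def similitude_of_int[OF g(1)] similitude_of_int[OF h(1)] similitude_of_int[OF hg]
        hgm act rho inv matrix_vec_smult vector_smult_assoc matrix_vector_mul_assoc power_int_mult_distrib of_rat_mult mult.commute)
qed

lemma slash_smult:
  assumes g: "g ** sadj g = mat c" "c > 0" and z: "z \<in> siegel_space"
    and F: "\<And>w. w \<in> siegel_space \<Longrightarrow> F w = a *s F' w"
  shows "slash \<rho> lam (map_matrix of_int g) F z = a *s slash \<rho> lam (map_matrix of_int g) F' z"
proof -
  interpret g: real_similitude g c by unfold_locales (use g in auto)
  show ?thesis
    by (simp add: slash_def F[OF g.siegel_act_in[OF z]] matrix_vec_smult vector_smult_assoc mult.commute)
qed

lemma slash_sum: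
  assumes "finite R"
  shows "slash \<rho> lam g (\<lambda>w. \<Sum>h\<in>R. F h w) z = (\<Sum>h\<in>R. slash \<rho> lam g (F h) z)"
  using assms by (induction R) (simp_all add: slash_def matrix_vector_right_distrib vector_add_ldistrib)

lemma slash_Gamma0:
  assumes F: "siegel_modular_form N \<rho> lam F" and g: "g \<in> Gamma0 N" and z: "z \<in> siegel_space"
  shows "slash \<rho> lam (map_matrix of_int g) F z = F z"
proof -
  have s: "g ** sadj g = mat 1"
    using g sim_iff_sadj[of g 1] by (simp add: Gamma0_def Sp_int_def)
  interpret g: real_similitude g 1 by unfold_locales (use s in auto)
  have "polynomial_rep \<rho>" using F by (simp add: siegel_modular_form_def)
  note i = matrix_inv_mult[OF polynomial_rep_invertible[OF this g.auto_factor_invertible[OF z]]]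
  show ?thesis
    using F g z by (simp add: slash_def siegel_modular_form_def similitude_of_int[OF s] matrix_vector_mul_assoc i)
qed

section \<open>The action of scalar matrices\<close>

lemma prod_power_int:
  assumes "finite A" "(c :: 'a::field) \<noteq> 0"
  shows "(\<Prod>i\<in>A. c powi f i) = c powi (\<Sum>i\<in>A. f i)"
  using assms by (induction A) (simp_all add: power_int_add)

text \<open>Schur's argument: the eigenspace for this value is invariant since scalars are central,
  and it contains the highest weight vector since scalar matrices are upper triangular.
  Irreducibility makes it the whole space.\<close>

lemma central_character:
  assumes \<rho>: "polynomial_rep \<rho>" and hw: "has_highest_weight \<rho> lam" and c: "c \<noteq> 0"
  shows "\<rho> (mat c) *v w = c powi (\<Sum>i\<in>UNIV. lam i) *s w"
proof -
  let ?k = "c powi (\<Sum>i\<in>UNIV. lam i)"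
  let ?W = "{w. \<rho> (mat c) *v w = ?k *s w}"
  have inv: "invertible (mat c :: 'a cmat)"
    unfolding invertible_def using c
    by (intro exI[of _ "mat (1 / c)"]) (simp add: mat_mult_eq vec_eq_iff mat_nth)
  have "vec.subspace ?W"
    by (simp add: vec.subspace_def matrix_vector_right_distrib vector_add_ldistrib matrix_vec_smult vector_smult_assoc mult.commute)
  moreover have "\<rho> g *v w \<in> ?W" if "invertible g" "w \<in> ?W" for g w
  proof -
    have "mat c ** g = g ** mat c"
      by (simp add: mat_mult_eq)
    then have "\<rho> (mat c) ** \<rho> g = \<rho> g ** \<rho> (mat c)"
      using polynomial_rep_mult[OF \<rho>] inv that(1) by metis
    then show ?thesis
      using that(2) by (simp add: matrix_vector_mul_assoc) (simp add: matrix_vector_mul_assoc[symmetric] matrix_vec_smult)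
  qed
  ultimately have "?W = {0} \<or> ?W = UNIV"
    using hw by (auto simp: has_highest_weight_def irreducible_rep_def)
  moreover obtain v where v: "v \<noteq> 0" "\<And>b. invertible b \<Longrightarrow> upper_triangular_mat b \<Longrightarrow> \<rho> b *v v = (\<Prod>i\<in>UNIV. (b $ i $ i) powi lam i) *s v"
    using hw by (auto simp: has_highest_weight_def)
  have "v \<in> ?W"
    using v(2)[OF inv] c by (simp add: upper_triangular_mat_def mat_nth prod_power_int)
  ultimately have "?W = UNIV" using v(1) by blast
  then show ?thesis by blast
qed

text \<open>The factor of \<open>mat c\<close> is c^2. With s the sum of the weight, the
  normalisation contributes c^(2s - n(n+1)) and the inverse of the representation c^(-s).\<close>

lemma slash_scalar:
  fixes \<rho> :: "'n::{finite,linorder} cmat \<Rightarrow> 'd::finite cmat"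
  assumes \<rho>: "polynomial_rep \<rho>" and hw: "has_highest_weight \<rho> lam" and c: "c > 0"
  shows "slash \<rho> lam (map_matrix of_int (mat c)) F z =
    of_int c powi ((\<Sum>i\<in>UNIV. lam i) - int (CARD('n) * (CARD('n) + 1))) *s F z"
proof -
  let ?s = "\<Sum>i\<in>UNIV. lam i" and ?c = "of_int c :: complex"
  have c0: "?c \<noteq> 0" using c by simp
  have m: "map_matrix of_int (mat c) = (mat ?c :: (complex, 'n) mat_2n)"
    by (simp add: vec_eq_iff mat_nth)
  have s: "(mat c :: (int, 'n) mat_2n) ** sadj (mat c) = mat (c\<^sup>2)"
    by (simp add: mat_mult_eq) (simp add: vec_eq_iff mat_nth power2_eq_square)
  have af: "auto_factor (mat ?c) z = mat ?c"
    by (simp add: auto_factor_def block_mat vec_eq_iff matrix_mult_nth)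
  have inv: "invertible (mat ?c :: 'n cmat)"
    unfolding invertible_def using c0
    by (intro exI[of _ "mat (1 / ?c)"]) (simp add: mat_mult_eq vec_eq_iff mat_nth)
  have act: "siegel_act (mat ?c) z = z"
  proof -
    have "siegel_act (mat ?c) z = (mat ?c ** z) ** matrix_inv (mat ?c)"
      by (simp add: siegel_act_def af block_mat)
    also have "mat ?c ** z = z ** mat ?c" by (simp add: mat_mult_eq)
    finally show ?thesis
      by (simp add: matrix_mul_assoc[symmetric] matrix_inv_mult[OF inv])
  qed
  let ?R = "matrix_inv (\<rho> (mat ?c))"
  have "?R *v (\<rho> (mat ?c) *v w) = w" for w
    by (simp add: matrix_vector_mul_assoc matrix_inv_mult[OF polynomial_rep_invertible[OF \<rho> inv]])
  then have R: "?R *v (?c powi ?s *s w) = w" for w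
    unfolding central_character[OF \<rho> hw c0] .
  have "w = ?c powi ?s *s (?c powi (- ?s) *s w)" for w :: "complex^'d"
    using c0 by (simp add: vector_smult_assoc power_int_minus)
  then have R': "?R *v w = ?c powi (- ?s) *s w" for w
    using R by metis
  let ?n = "CARD('n)"
  have "even (?n * (?n + 1))" by simp
  then have n2: "2 * int (?n * (?n + 1) div 2) = int (?n * (?n + 1))"
    by (metis dvd_mult_div_cancel of_nat_mult of_nat_numeral)
  have "?c\<^sup>2 powi k * ?c powi (- ?s) = ?c powi (2 * k + (- ?s))" for k
    using c0 by (simp add: power_int_add power_int_mult del: add_uminus_conv_diff)
  moreover have ar: "2 * b = m \<Longrightarrow> 2 * (a - b) + - a = a - m" for a b m :: int
    by simp
  have "2 * (?s - int (?n * (?n + 1) div 2)) + (- ?s) = ?s - int (?n * (?n + 1))"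
    by (rule ar[OF n2])
  ultimately have pw: "?c\<^sup>2 powi (?s - int (?n * (?n + 1) div 2)) * ?c powi (- ?s) = ?c powi (?s - int (?n * (?n + 1)))"
    by metis
  show ?thesis
    unfolding slash_def similitude_of_int[OF s] map_matrix_of_rat_of_int m af act R' pw[symmetric]
    by (simp add: vector_smult_assoc of_rat_power)
qed

subsection \<open>Products of double cosets\<close>

text \<open>The left cosets K Y in the coset of T(p) for which X Y^(-1) lies there too, expressed
  without inverses. Their number is the multiplicity of K X K in T(p)^2.\<close>

definition factor_cosets :: "nat \<Rightarrow> ('n::finite + 'n) padic_mat \<Rightarrow> ('n + 'n) padic_mat set set" where
  "factor_cosets p X = {LC p Y | Y. Y \<in> coset_Tp p \<and> (\<exists>Z\<in>coset_Tp p. X = padic_mult p Z Y)}"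

lemma coset_Tp_mult: "Y \<in> coset_Tp p \<Longrightarrow> U \<in> Sim p 0 \<Longrightarrow> padic_mult p U Y \<in> coset_Tp p"
  "Y \<in> coset_Tp p \<Longrightarrow> U \<in> Sim p 0 \<Longrightarrow> padic_mult p Y U \<in> coset_Tp p"
  unfolding coset_Tp_def by (fact DC_mult_left DC_mult_right)+

lemma coset_Tp_in: "Y \<in> coset_Tp p \<Longrightarrow> Y \<in> padic_mats p"
  using coset_Tp_Sim Sim_in by blast

lemma factor_cosets_left:
  fixes X :: "('n::finite + 'n) padic_mat"
  assumes "prime p" "U \<in> Sim p 0" "X \<in> padic_mats p"
  shows "factor_cosets p (padic_mult p U X) = factor_cosets p X"
proof -
  have *: "factor_cosets p X \<subseteq> factor_cosets p (padic_mult p U X)" if "U \<in> Sim p 0" for U X :: "('n + 'n) padic_mat"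
  proof
    fix C assume "C \<in> factor_cosets p X"
    then obtain Y Z where YZ: "Y \<in> coset_Tp p" "Z \<in> coset_Tp p" "X = padic_mult p Z Y" "C = LC p Y"
      unfolding factor_cosets_def by blast
    have "padic_mult p U X = padic_mult p (padic_mult p U Z) Y"
      by (simp add: YZ(3) padic_mult_assoc)
    then show "C \<in> factor_cosets p (padic_mult p U X)"
      unfolding factor_cosets_def YZ(4) using YZ(1) coset_Tp_mult(1)[OF YZ(2) that] by blast
  qed
  have "padic_mult p (padj p U) (padic_mult p U X) = X"
    using Sim_0_inverse(2)[OF assms(1,2)] assms(3) by (simp add: padic_mult_assoc[symmetric])
  then show ?thesis
    using *[OF assms(2), of X] *[OF Sim_0_inverse(3)[OF assms(1,2)], of "padic_mult p U X"] by simp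
qed

text \<open>Unlike left multiplication, this changes the set; K Y to K Y W is a bijection. Both
  lemmas together show that the number depends on the double coset only, as
  \<open>factor_count\<close> requires.\<close>

lemma card_factor_cosets_right:
  assumes p: "prime p" and W: "W \<in> Sim p 0" and X: "X \<in> padic_mats p"
  shows "card (factor_cosets p (padic_mult p X W)) = card (factor_cosets p X)"
proof -
  define m where "m = (\<lambda>C. (\<lambda>V. padic_mult p V W) ` C)"
  have mLC: "m (LC p Y) = LC p (padic_mult p Y W)" for Y
    by (auto simp: m_def LC_iff image_iff padic_mult_assoc) (metis LC_iff padic_mult_assoc)+
  have inv: "padic_mult p (padic_mult p Y W) (padj p W) = Y" "padic_mult p (padic_mult p Y (padj p W)) W = Y"
    if "Y \<in> padic_mats p" for Y
    using that Sim_0_inverse[OF p W] by (simp_all add: padic_mult_assoc)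
  have "factor_cosets p (padic_mult p X W) = m ` factor_cosets p X"
  proof (intro equalityI subsetI)
    fix C assume "C \<in> factor_cosets p (padic_mult p X W)"
    then obtain Y Z where YZ: "Y \<in> coset_Tp p" "Z \<in> coset_Tp p" "padic_mult p X W = padic_mult p Z Y" "C = LC p Y"
      unfolding factor_cosets_def by blast
    have "X = padic_mult p (padic_mult p X W) (padj p W)"
      using inv(1)[OF X] by simp
    then have "X = padic_mult p Z (padic_mult p Y (padj p W))"
      by (simp add: YZ(3) padic_mult_assoc)
    moreover have "padic_mult p Y (padj p W) \<in> coset_Tp p"
      using coset_Tp_mult(2) YZ(1) Sim_0_inverse(3)[OF p W] by blast
    ultimately have "LC p (padic_mult p Y (padj p W)) \<in> factor_cosets p X"
      unfolding factor_cosets_def using YZ(2) by blast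
    moreover have "C = m (LC p (padic_mult p Y (padj p W)))"
      using inv(2)[OF coset_Tp_in[OF YZ(1)]] by (simp add: mLC YZ(4))
    ultimately show "C \<in> m ` factor_cosets p X" by blast
  next
    fix C assume "C \<in> m ` factor_cosets p X"
    then obtain Y Z where YZ: "Y \<in> coset_Tp p" "Z \<in> coset_Tp p" "X = padic_mult p Z Y" "C = LC p (padic_mult p Y W)"
      unfolding factor_cosets_def using mLC by blast
    then show "C \<in> factor_cosets p (padic_mult p X W)"
      unfolding factor_cosets_def using coset_Tp_mult(2)[OF YZ(1) W] padic_mult_assoc by blast
  qed
  moreover have "inj_on m (factor_cosets p X)"
  proof (rule inj_onI)
    fix C C' assume C: "C \<in> factor_cosets p X" "C' \<in> factor_cosets p X" "m C = m C'"
    have "inj_on (\<lambda>V. padic_mult p V W) (padic_mats p)"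
      by (rule inj_onI) (metis inv(1))
    moreover have "C \<subseteq> padic_mats p" "C' \<subseteq> padic_mats p"
      using C(1,2) LC_in coset_Tp_in unfolding factor_cosets_def by blast+
    ultimately show "C = C'"
      using C(3) inj_on_image_eq_iff unfolding m_def by blast
  qed
  ultimately show ?thesis by (simp add: card_image)
qed

definition factor_count :: "nat \<Rightarrow> ('n::finite + 'n) padic_mat set \<Rightarrow> nat" where
  "factor_count p D = card (factor_cosets p (SOME X. X \<in> D))"

lemma factor_count_DC:
  assumes p: "prime p" and X: "X \<in> padic_mats p" and Y: "Y \<in> DC p X"
  shows "factor_count p (DC p X) = card (factor_cosets p Y)"
proof -
  have *: "card (factor_cosets p Z) = card (factor_cosets p X)" if Z: "Z \<in> DC p X" for Z
  proof -
    obtain U W where U: "U \<in> Sim p 0" "W \<in> Sim p 0" "Z = padic_mult p (padic_mult p U X) W"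
      using Z DC_iff by blast
    show ?thesis
      unfolding U(3) card_factor_cosets_right[OF p U(2) padic_mult_in[OF Sim_in[OF U(1)] X]]
        factor_cosets_left[OF p U(1) X] ..
  qed
  have "(SOME X'. X' \<in> DC p X) \<in> DC p X"
    using someI[of "\<lambda>X'. X' \<in> DC p X"] DC_self[OF X] by blast
  from *[OF this] *[OF Y] show ?thesis by (simp add: factor_count_def)
qed

lemma hecke_repsD:
  assumes p: "prime p" and D: "D \<subseteq> Sim p e" and R: "hecke_reps N p D R" and g: "g \<in> R"
  shows "g \<in> Delta0 N" "padic_of_int p g \<in> D" "g ** sadj g = mat (int p ^ e)"
proof -
  show 1: "g \<in> Delta0 N" using R g by (auto simp: hecke_reps_def)
  have "D = (\<Union>g\<in>R. LC p (padic_of_int p g))"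
    using R unfolding hecke_reps_def by (elim conjE)
  then show 2: "padic_of_int p g \<in> D"
    using g LC_self[OF padic_of_int_in, of p g] by blast
  obtain c where "g ** sadj g = mat c" using 1 Delta0_iff by blast
  then show "g ** sadj g = mat (int p ^ e)"
    using Sim_factor_unique[OF p] 2 D by (metis subsetD)
qed

lemma hecke_reps_unique:
  assumes R: "hecke_reps N p D R" and X: "X \<in> D"
  shows "\<exists>!g. g \<in> R \<and> X \<in> LC p (padic_of_int p g)"
proof -
  have D: "D = (\<Union>g\<in>R. LC p (padic_of_int p g))"
    and disj: "\<forall>g\<in>R. \<forall>h\<in>R. g \<noteq> h \<longrightarrow> LC p (padic_of_int p g) \<inter> LC p (padic_of_int p h) = {}"
    using R[unfolded hecke_reps_def, THEN conjunct2, THEN conjunct2] by (rule conjunct1, rule conjunct2)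
  obtain g where g: "g \<in> R" "X \<in> LC p (padic_of_int p g)"
    using D X by blast
  moreover have "h = g" if "h \<in> R" "X \<in> LC p (padic_of_int p h)" for h
    using disj g that by blast
  ultimately show ?thesis by blast
qed

text \<open>A pair (h, g) corresponds to the coset K g. That coset determines g, and cancelling g
  then determines h. Conversely, for X = Z Y write Y = U g and absorb U into Z before h is
  chosen.\<close>

lemma card_factor_pairs:
  assumes p: "prime p" and R: "hecke_reps N p (coset_Tp p) R" and X: "X \<in> padic_mats p"
  shows "card {x \<in> R \<times> R. padic_of_int p (fst x ** snd x) \<in> LC p X} = card (factor_cosets p X)"
proof (rule bij_betw_same_card[of "\<lambda>x. LC p (padic_of_int p (snd x))"], rule bij_betw_imageI)
  let ?P = "{x \<in> R \<times> R. padic_of_int p (fst x ** snd x) \<in> LC p X}"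
  note RD = hecke_repsD[OF p coset_Tp_Sim R] and RU = hecke_reps_unique[OF R]
  have Sim1: "padic_of_int p g \<in> Sim p 1" if "g \<in> R" for g
    using RD(2)[OF that] coset_Tp_Sim by blast
  show "inj_on (\<lambda>x. LC p (padic_of_int p (snd x))) ?P"
  proof (rule inj_onI)
    fix x y assume x: "x \<in> ?P" and y: "y \<in> ?P" and eq: "LC p (padic_of_int p (snd x)) = LC p (padic_of_int p (snd y))"
    obtain h g h' g' where xy: "x = (h, g)" "y = (h', g')" by fastforce
    have R4: "h \<in> R" "g \<in> R" "h' \<in> R" "g' \<in> R" using x y by (auto simp: xy)
    have "padic_of_int p g \<in> LC p (padic_of_int p g')"
      using eq LC_self[OF padic_of_int_in] by (auto simp: xy)
    then have gg: "g = g'"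
      using RU[OF RD(2)[OF R4(2)]] R4 LC_self[OF padic_of_int_in] by blast
    have "padic_of_int p (h ** g) \<in> LC p (padic_of_int p (h' ** g))"
      using x y LC_sym[OF p X] LC_trans unfolding xy gg by fastforce
    then obtain U where U: "U \<in> Sim p 0" "padic_of_int p (h ** g) = padic_mult p U (padic_of_int p (h' ** g))"
      using LC_iff by blast
    have "padic_of_int p h = padic_mult p U (padic_of_int p h')"
      by (rule Sim_cancel_right[OF p _ _ Sim1[OF R4(2)]]) (use U in \<open>auto simp: padic_of_int_mult padic_mult_assoc Sim_in\<close>)
    then have "padic_of_int p h \<in> LC p (padic_of_int p h')"
      using U(1) LC_iff by blast
    then have "h = h'"
      using RU[OF RD(2)[OF R4(1)]] R4 LC_self[OF padic_of_int_in] by blast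
    then show "x = y" by (simp add: xy gg)
  qed
  show "(\<lambda>x. LC p (padic_of_int p (snd x))) ` ?P = factor_cosets p X"
  proof (intro equalityI subsetI)
    fix C assume "C \<in> (\<lambda>x. LC p (padic_of_int p (snd x))) ` ?P"
    then obtain h g where hg: "h \<in> R" "g \<in> R" "padic_of_int p (h ** g) \<in> LC p X" "C = LC p (padic_of_int p g)"
      by auto
    from LC_sym[OF p X hg(3)] obtain U where U: "U \<in> Sim p 0" "X = padic_mult p U (padic_of_int p (h ** g))"
      using LC_iff by blast
    then have "X = padic_mult p (padic_mult p U (padic_of_int p h)) (padic_of_int p g)"
      by (simp add: padic_mult_assoc padic_of_int_mult)
    then show "C \<in> factor_cosets p X"
      unfolding factor_cosets_def hg(4) using RD(2)[OF hg(2)] coset_Tp_mult(1)[OF RD(2)[OF hg(1)] U(1)] by blast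
  next
    fix C assume "C \<in> factor_cosets p X"
    then obtain Y Z where YZ: "Y \<in> coset_Tp p" "Z \<in> coset_Tp p" "X = padic_mult p Z Y" "C = LC p Y"
      unfolding factor_cosets_def by blast
    obtain g where g: "g \<in> R" "Y \<in> LC p (padic_of_int p g)" using RU[OF YZ(1)] by blast
    then obtain U where U: "U \<in> Sim p 0" "Y = padic_mult p U (padic_of_int p g)" using LC_iff by blast
    obtain h where h: "h \<in> R" "padic_mult p Z U \<in> LC p (padic_of_int p h)"
      using RU[OF coset_Tp_mult(2)[OF YZ(2) U(1)]] by blast
    then obtain V where V: "V \<in> Sim p 0" "padic_mult p Z U = padic_mult p V (padic_of_int p h)" using LC_iff by blast
    have "X = padic_mult p V (padic_of_int p (h ** g))"
      by (simp add: YZ(3) U(2) padic_mult_assoc[symmetric] V(2)) (simp add: padic_mult_assoc padic_of_int_mult)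
    then have "X \<in> LC p (padic_of_int p (h ** g))" using V(1) LC_iff by blast
    then have "padic_of_int p (h ** g) \<in> LC p X" by (rule LC_sym[OF p padic_of_int_in])
    moreover have "C = LC p (padic_of_int p g)"
      using g(2) LC_eq_iff[OF p padic_of_int_in coset_Tp_in[OF YZ(1)]] YZ(4) by blast
    ultimately show "C \<in> (\<lambda>x. LC p (padic_of_int p (snd x))) ` ?P"
      using g(1) h(1) by force
  qed
qed

lemma finite_left_cosets:
  assumes p: "prime p"
  shows "finite (LC p ` coset_Tp p :: ('n::{finite,linorder} + 'n) padic_mat set set)"
proof -
  have "\<not> p dvd 1" using p not_prime_unit by blast
  moreover have "LC p X \<subseteq> coset_Tp p" if "X \<in> coset_Tp p" for X :: "('n + 'n) padic_mat"
    using that LC_subset_DC unfolding coset_Tp_def by blast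
  ultimately obtain R :: "(int, 'n) mat_2n set" where R: "hecke_reps 1 p (coset_Tp p) R"
    using hecke_reps_exists[OF p _ coset_Tp_Sim] by blast
  have "LC p ` coset_Tp p \<subseteq> (\<lambda>g. LC p (padic_of_int p g)) ` R"
    using R LC_eq_iff[OF p padic_of_int_in coset_Tp_in] unfolding hecke_reps_def by blast
  moreover have "finite R" using R by (simp add: hecke_reps_def)
  ultimately show ?thesis by (meson finite_imageI finite_subset)
qed

lemma coset_Tj_0: "coset_Tj p 0 = DC p (padic_of_int p (diag_mat_2n (case_sum (\<lambda>i. 1) (\<lambda>i. (int p)\<^sup>2))))"
proof -
  have "card {k. k < i} < CARD('a)" for i :: 'a
    by (rule psubset_card_mono) auto
  then show ?thesis by (simp add: coset_Tj_def)
qed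

lemma coset_Tj_n: "coset_Tj p CARD('n) = DC p (padic_of_int p (mat (int p) :: (int, 'n::{finite,linorder}) mat_2n))"
proof -
  have "diag_mat_2n (case_sum (\<lambda>i::'n. int p) (\<lambda>i. int p)) = mat (int p)"
    by (simp add: vec_eq_iff forall_plus mat_nth)
  then show ?thesis by (simp add: coset_Tj_def)
qed

text \<open>
  Every left coset in the double coset of \<open>diag(1,p)\<close> divides \<open>p\<close>, since \<open>Y\<^sup>* Y = p\<close>, whereas the coset of \<open>diag(p,1)\<close> does not divide
  \<open>diag(1,p\<^sup>2)\<close>.
\<close>

lemma factor_count_less:
  assumes p: "prime p"
  shows "factor_count p (coset_Tj p 0 :: ('n::{finite,linorder} + 'n) padic_mat set) < factor_count p (coset_Tj p CARD('n) :: ('n + 'n) padic_mat set)"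
proof -
  let ?d = "diag_mat_2n (case_sum (\<lambda>i. 1) (\<lambda>i. int p)) :: (int, 'n) mat_2n"
  let ?dd = "diag_mat_2n (case_sum (\<lambda>i. 1) (\<lambda>i. (int p)\<^sup>2)) :: (int, 'n) mat_2n"
  let ?L = "LC p ` coset_Tp p :: ('n + 'n) padic_mat set set"
  have J: "padic_of_int p symp_J \<in> (Sim p 0 :: ('n + 'n) padic_mat set)" "padic_of_int p (transpose symp_J) \<in> (Sim p 0 :: ('n + 'n) padic_mat set)"
    by (intro Sim_0_of_int; simp add: vec_eq_iff forall_plus matrix_mult_nth sum_UNIV_plus sum_delta_mult mat_nth sum_negf)+
  have "padic_of_int p ?d \<in> coset_Tp p"
    unfolding coset_Tp_def by (rule DC_self[OF padic_of_int_in])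
  moreover have "sadj ?d = symp_J ** ?d ** transpose symp_J"
  proof -
    have "transpose ?d = ?d" by (simp add: vec_eq_iff)
    then show ?thesis by (simp add: sadj_def)
  qed
  ultimately have sd: "padic_of_int p (sadj ?d) \<in> coset_Tp p"
    using coset_Tp_mult J by (metis padic_of_int_mult)
  have padj: "padj p Y \<in> coset_Tp p" if Y: "Y \<in> coset_Tp p" for Y :: "('n + 'n) padic_mat"
  proof -
    obtain U W where U: "U \<in> Sim p 0" "W \<in> Sim p 0" "Y = padic_mult p (padic_mult p U (padic_of_int p ?d)) W"
      using Y DC_iff unfolding coset_Tp_def by blast
    have "padj p Y = padic_mult p (padic_mult p (padj p W) (padic_of_int p (sadj ?d))) (padj p U)"
      by (simp add: U(3) padj_mult padj_of_int padic_mult_assoc)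
    then show ?thesis
      using coset_Tp_mult sd Sim_0_inverse(3)[OF p] U(1,2) by metis
  qed
  have n: "factor_cosets p (padic_of_int p (mat (int p))) = ?L"
  proof -
    have "padic_of_int p (mat (int p)) = padic_mult p (padj p Y) Y" if "Y \<in> coset_Tp p" for Y :: "('n + 'n) padic_mat"
      using Sim_padj_left[OF p subsetD[OF coset_Tp_Sim that]] by simp
    then show ?thesis
      unfolding factor_cosets_def using padj by blast
  qed
  have "LC p (padic_of_int p (sadj ?d)) \<notin> factor_cosets p (padic_of_int p ?dd)"
  proof
    assume "LC p (padic_of_int p (sadj ?d)) \<in> factor_cosets p (padic_of_int p ?dd)"
    then obtain Y Z where YZ: "Y \<in> coset_Tp p" "padic_of_int p ?dd = padic_mult p Z Y" "LC p (padic_of_int p (sadj ?d)) = LC p Y"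
      unfolding factor_cosets_def by blast
    then have "Y \<in> LC p (padic_of_int p (sadj ?d))"
      using LC_self[OF coset_Tp_in[OF YZ(1)]] by blast
    then obtain U where "Y = padic_mult p U (padic_of_int p (sadj ?d))"
      using LC_iff by blast
    then have "padic_of_int p ?dd 1 = padic_mult p (padic_mult p Z U) (padic_of_int p (sadj ?d)) 1"
      using YZ(2) by (simp add: padic_mult_assoc)
    then have "reduce_mat (int p) ?dd = reduce_mat (int p) (padic_mult p Z U 1 ** sadj ?d)"
      by (simp add: padic_of_int_def padic_mult_def)
    then have "int p dvd ?dd $ Inl i $ Inl i - (padic_mult p Z U 1 ** sadj ?d) $ Inl i $ Inl i" for i
      unfolding reduce_mat_eq_iff by blast
    moreover have "(A ** sadj ?d) $ Inl i $ Inl i = A $ Inl i $ Inl i * int p" for A i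
      by (simp add: sadj_diag_mat_2n matrix_mult_nth sum_UNIV_plus sum_delta_mult cong: if_cong)
    ultimately have "int p dvd 1 - padic_mult p Z U 1 $ Inl i $ Inl i * int p" for i :: 'n
      by (metis (no_types, lifting) diag_mat_2n_nth old.sum.simps(5))
    then have "int p dvd 1"
      by (metis dvd_add_left_iff dvd_triv_right diff_add_cancel)
    then show False using p by (simp add: prime_nat_iff)
  qed
  moreover have "factor_cosets p (padic_of_int p ?dd) \<subseteq> ?L"
    by (auto simp: factor_cosets_def)
  ultimately have "factor_cosets p (padic_of_int p ?dd) \<subset> ?L"
    using sd by blast
  then have "card (factor_cosets p (padic_of_int p ?dd)) < card ?L"
    by (rule psubset_card_mono[OF finite_left_cosets[OF p]])
  then show ?thesis
    unfolding coset_Tj_0 coset_Tj_n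
    by (simp add: factor_count_DC[OF p padic_of_int_in DC_self[OF padic_of_int_in]] n)
qed

subsection \<open>Hecke operators\<close>

lemma slash_LC:
  assumes p: "prime p" "\<not> p dvd N" and F: "siegel_modular_form N \<rho> lam F"
    and g: "g \<in> Delta0 N" "g ** sadj g = mat (int p ^ e)" and h: "h \<in> Delta0 N" "h ** sadj h = mat (int p ^ e)"
    and LC: "padic_of_int p g \<in> LC p (padic_of_int p h)" and z: "z \<in> siegel_space"
  shows "slash \<rho> lam (map_matrix of_int g) F z = slash \<rho> lam (map_matrix of_int h) F z"
proof -
  obtain \<gamma> where \<gamma>: "\<gamma> \<in> Gamma0 N" "g = \<gamma> ** h"
    by (rule Gamma0_of_LC_eq[OF p g h LC])
  have pe: "0 < int p ^ e" using p(1) by (simp add: prime_gt_0_nat)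
  have \<rho>: "polynomial_rep \<rho>" using F by (simp add: siegel_modular_form_def)
  have s: "\<gamma> ** sadj \<gamma> = mat 1" using \<gamma>(1) Gamma0_iff by blast
  have "slash \<rho> lam (map_matrix of_int g) F z = slash \<rho> lam (map_matrix of_int h) (slash \<rho> lam (map_matrix of_int \<gamma>) F) z"
    unfolding \<gamma>(2) by (rule slash_slash[OF \<rho> h(2) pe s zero_less_one z, symmetric])
  also have "\<dots> = 1 *s slash \<rho> lam (map_matrix of_int h) F z"
    by (rule slash_smult[OF h(2) pe z]) (simp add: slash_Gamma0[OF F \<gamma>(1)])
  finally show ?thesis by simp
qed

definition reps :: "nat \<Rightarrow> nat \<Rightarrow> ('n::finite + 'n) padic_mat set \<Rightarrow> (int, 'n) mat_2n set" where
  "reps N p D = (SOME R. hecke_reps N p D R)"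

lemma hecke_coset_op_reps:
  "hecke_coset_op N p \<rho> lam D F z = (\<Sum>g\<in>reps N p D. slash \<rho> lam (map_matrix of_int g) F z)"
  by (simp add: hecke_coset_op_def reps_def)

lemma hecke_T_reps:
  "hecke_T N p \<rho> lam F z = (\<Sum>g\<in>reps N p (coset_Tp p). slash \<rho> lam (map_matrix of_int g) F z)"
  by (simp add: hecke_T_def hecke_coset_op_reps coset_Tp_def)

lemma hecke_reps_reps:
  fixes X :: "('n::{finite,linorder} + 'n) padic_mat"
  assumes "prime p" "\<not> p dvd N" "X \<in> Sim p e"
  shows "hecke_reps N p (DC p X) (reps N p (DC p X))"
  unfolding reps_def
  using hecke_reps_exists[OF assms(1,2) DC_Sim[OF assms(3)] LC_subset_DC] by (rule someI_ex)

lemma hecke_reps_coset_Tp: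
  assumes "prime p" "\<not> p dvd N"
  shows "hecke_reps N p (coset_Tp p) (reps N p (coset_Tp p :: ('n::{finite,linorder} + 'n) padic_mat set))"
proof -
  have "padic_of_int p (diag_mat_2n (case_sum (\<lambda>i. 1) (\<lambda>i. int p))) \<in> (coset_Tp p :: ('n + 'n) padic_mat set)"
    unfolding coset_Tp_def by (rule DC_self[OF padic_of_int_in])
  from subsetD[OF coset_Tp_Sim this] show ?thesis
    unfolding coset_Tp_def by (rule hecke_reps_reps[OF assms])
qed

text \<open>The iterated operator is a sum over pairs of representatives. Each product h g has a
  unique pair (D, r) with h g in K r, and it acts as r does; after exchanging the sums, every r is
  met as often as \<open>card_factor_pairs\<close> says.\<close>

theorem hecke_T_square:
  fixes \<rho> :: "'n::{finite,linorder} cmat \<Rightarrow> 'd::finite cmat"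
  assumes p: "prime p" "\<not> p dvd N" and F: "siegel_modular_form N \<rho> lam F" and z: "z \<in> siegel_space"
  shows "hecke_T N p \<rho> lam (hecke_T N p \<rho> lam F) z =
    (\<Sum>D\<in>similitude_p2_cosets p. of_nat (factor_count p D) *s hecke_coset_op N p \<rho> lam D F z)"
proof -
  let ?s = "\<lambda>g. slash \<rho> lam (map_matrix of_int g) F z"
  let ?R1 = "reps N p (coset_Tp p) :: (int, 'n) mat_2n set"
  have \<rho>: "polynomial_rep \<rho>" using F by (simp add: siegel_modular_form_def)
  have R1: "hecke_reps N p (coset_Tp p) ?R1"
    by (rule hecke_reps_coset_Tp[OF p])
  note R1D = hecke_repsD[OF p(1) coset_Tp_Sim R1]
  have p_pos: "0 < int p ^ 1" using p(1) by (simp add: prime_gt_0_nat)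
  have fin1: "finite ?R1" using R1 by (simp add: hecke_reps_def)
  have T: "hecke_T N p \<rho> lam f = (\<lambda>z. \<Sum>g\<in>?R1. slash \<rho> lam (map_matrix of_int g) f z)" for f
    by (simp add: fun_eq_iff hecke_T_reps)
  have "hecke_T N p \<rho> lam (hecke_T N p \<rho> lam F) z = (\<Sum>g\<in>?R1. \<Sum>h\<in>?R1. ?s (h ** g))"
    unfolding T slash_sum[OF fin1]
    by (intro sum.cong refl slash_slash[OF \<rho> _ p_pos _ p_pos z] R1D)
  also have "\<dots> = (\<Sum>x\<in>?R1 \<times> ?R1. ?s (fst x ** snd x))"
    by (subst sum.swap) (simp add: sum.cartesian_product case_prod_unfold)
  finally have lhs: "hecke_T N p \<rho> lam (hecke_T N p \<rho> lam F) z = (\<Sum>x\<in>?R1 \<times> ?R1. ?s (fst x ** snd x))" .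
  let ?C = "similitude_p2_cosets p :: ('n + 'n) padic_mat set set"
  have finC: "finite ?C"
    by (rule finite_subset[OF similitude_p2_cosets_subset[OF p(1)]]) simp
  have C: "D \<subseteq> Sim p 2" "hecke_reps N p D (reps N p D)" if "D \<in> ?C" for D
    using that hecke_reps_reps[OF p] DC_Sim unfolding similitude_p2_cosets_eq[OF p(1)] by blast+
  let ?J = "Sigma ?C (reps N p)"
  let ?P = "\<lambda>x j. padic_of_int p (fst x ** snd x) \<in> LC p (padic_of_int p (snd j))"
  have finJ: "finite ?J"
    using finC C(2) by (auto simp: hecke_reps_def)
  have inner: "(\<Sum>j | j \<in> ?J \<and> ?P x j. ?s (snd j)) = ?s (fst x ** snd x)" if x: "x \<in> ?R1 \<times> ?R1" for x
  proof -
    let ?g = "fst x ** snd x"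
    have xR: "fst x \<in> ?R1" "snd x \<in> ?R1" using x by auto
    have g: "?g \<in> Delta0 N" "?g ** sadj ?g = mat (int p ^ 2)"
      using Delta0_mult[OF R1D(1)[OF xR(1)] R1D(1)[OF xR(2)]] sim_mult[OF R1D(3)[OF xR(1)] R1D(3)[OF xR(2)]]
      by (simp_all add: power2_eq_square)
    have gS: "padic_of_int p ?g \<in> Sim p 2" by (rule Sim_of_int[OF g(2)])
    define D where "D = DC p (padic_of_int p ?g)"
    have D: "D \<in> ?C" using gS by (auto simp: D_def similitude_p2_cosets_eq[OF p(1)])
    have gD: "padic_of_int p ?g \<in> D" unfolding D_def by (rule DC_self[OF padic_of_int_in])
    obtain r where r: "r \<in> reps N p D" "padic_of_int p ?g \<in> LC p (padic_of_int p r)"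
      "\<And>r'. r' \<in> reps N p D \<Longrightarrow> padic_of_int p ?g \<in> LC p (padic_of_int p r') \<Longrightarrow> r' = r"
      using hecke_reps_unique[OF C(2)[OF D] gD] by metis
    have "{j. j \<in> ?J \<and> ?P x j} = {(D, r)}"
    proof (intro equalityI subsetI)
      fix j assume "j \<in> {j. j \<in> ?J \<and> ?P x j}"
      then obtain D' r' where j: "j = (D', r')" "D' \<in> ?C" "r' \<in> reps N p D'" "padic_of_int p ?g \<in> LC p (padic_of_int p r')"
        by auto
      obtain X where X: "X \<in> Sim p 2" "D' = DC p X"
        using j(2) unfolding similitude_p2_cosets_eq[OF p(1)] by blast
      have "padic_of_int p r' \<in> DC p X"
        using hecke_repsD(2)[OF p(1) C[OF j(2)] j(3)] X(2) by simp
      then have "padic_of_int p ?g \<in> DC p X"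
        using LC_subset_DC j(4) by blast
      then have "D' = D"
        unfolding D_def X(2) using DC_eq[OF p(1) Sim_in[OF X(1)]] by simp
      then show "j \<in> {(D, r)}" using j r(3) by blast
    next
      fix j assume "j \<in> {(D, r)}"
      then have "j = (D, r)" by simp
      then show "j \<in> {j. j \<in> ?J \<and> ?P x j}" using D r(1,2) by simp
    qed
    then have "(\<Sum>j | j \<in> ?J \<and> ?P x j. ?s (snd j)) = ?s r" by simp
    also have "\<dots> = ?s ?g"
      by (rule slash_LC[OF p F g hecke_repsD(1,3)[OF p(1) C[OF D] r(1)] r(2) z, symmetric])
    finally show ?thesis .
  qed
  have "(\<Sum>x\<in>?R1 \<times> ?R1. ?s (fst x ** snd x)) = (\<Sum>x\<in>?R1 \<times> ?R1. \<Sum>j | j \<in> ?J \<and> ?P x j. ?s (snd j))"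
    using inner by simp
  also have "\<dots> = (\<Sum>j\<in>?J. \<Sum>x | x \<in> ?R1 \<times> ?R1 \<and> ?P x j. ?s (snd j))"
    by (rule sum.swap_restrict) (use fin1 finJ in auto)
  also have "\<dots> = (\<Sum>j\<in>?J. of_nat (factor_count p (fst j)) *s ?s (snd j))"
  proof (intro sum.cong refl)
    fix j assume "j \<in> ?J"
    then obtain D r where j: "j = (D, r)" "D \<in> ?C" "r \<in> reps N p D" by auto
    obtain X where X: "X \<in> Sim p 2" "D = DC p X"
      using j(2) unfolding similitude_p2_cosets_eq[OF p(1)] by blast
    have "padic_of_int p r \<in> DC p X"
      using hecke_repsD(2)[OF p(1) C[OF j(2)] j(3)] X(2) by simp
    then have "card {x. x \<in> ?R1 \<times> ?R1 \<and> ?P x j} = factor_count p D"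
      using card_factor_pairs[OF p(1) R1, of "padic_of_int p r"] factor_count_DC[OF p(1) Sim_in[OF X(1)]] X(2) by (simp add: j(1))
    then show "(\<Sum>x | x \<in> ?R1 \<times> ?R1 \<and> ?P x j. ?s (snd j)) = of_nat (factor_count p (fst j)) *s ?s (snd j)"
      by (simp add: j(1) vec_eq_iff of_nat_index)
  qed
  also have "\<dots> = (\<Sum>D\<in>?C. \<Sum>r\<in>reps N p D. of_nat (factor_count p D) *s ?s r)"
    by (subst sum.Sigma) (use finC C(2) in \<open>auto simp: hecke_reps_def case_prod_unfold\<close>)
  also have "\<dots> = (\<Sum>D\<in>?C. of_nat (factor_count p D) *s hecke_coset_op N p \<rho> lam D F z)"
    by (simp add: hecke_coset_op_reps vec.scale_sum_right)
  finally show ?thesis using lhs by simp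
qed

text \<open>Since p is central, its double coset is a single left coset. The chosen representative
  need not be the scalar matrix, but \<open>slash_LC\<close> allows the exchange.\<close>

lemma hecke_coset_op_scalar:
  fixes \<rho> :: "'n::{finite,linorder} cmat \<Rightarrow> 'd::finite cmat"
  assumes p: "prime p" "\<not> p dvd N" and F: "siegel_modular_form N \<rho> lam F"
  shows "is_eigenvalue (hecke_coset_op N p \<rho> lam (coset_Tj p CARD('n))) F
    (of_nat p powi ((\<Sum>i\<in>UNIV. lam i) - int (CARD('n) * (CARD('n) + 1))))"
  unfolding is_eigenvalue_def
proof
  fix z :: "'n cmat" assume z: "z \<in> siegel_space"
  let ?h = "mat (int p) :: (int, 'n) mat_2n"
  let ?D = "coset_Tj p CARD('n) :: ('n + 'n) padic_mat set" and ?X = "padic_of_int p ?h"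
  have sh: "?h ** sadj ?h = mat (int p ^ 2)"
    by (simp add: mat_mult_eq) (simp add: vec_eq_iff mat_nth power2_eq_square)
  have h: "?h \<in> Delta0 N"
    using sh p(1) unfolding Delta0_iff by (intro conjI exI[of _ "int p ^ 2"]) (auto simp: mat_nth prime_gt_0_nat)
  have R: "hecke_reps N p ?D (reps N p ?D)"
    unfolding coset_Tj_n by (rule hecke_reps_reps[OF p Sim_of_int[OF sh]])
  have D: "Y \<in> LC p ?X" if "Y \<in> ?D" for Y
  proof -
    obtain U W where U: "U \<in> Sim p 0" "W \<in> Sim p 0" "Y = padic_mult p (padic_mult p U ?X) W"
      using \<open>Y \<in> ?D\<close> DC_iff unfolding coset_Tj_n by blast
    have "Y = padic_mult p (padic_mult p U W) ?X"
      by (simp add: U(3) padic_mult_assoc padic_scalar_comm[OF Sim_in[OF U(2)]])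
    then show ?thesis using Sim_0_mult[OF U(1,2)] LC_iff by blast
  qed
  have XD: "?X \<in> ?D" unfolding coset_Tj_n by (rule DC_self[OF padic_of_int_in])
  obtain g where g: "g \<in> reps N p ?D" "?X \<in> LC p (padic_of_int p g)"
    "\<And>g'. g' \<in> reps N p ?D \<Longrightarrow> ?X \<in> LC p (padic_of_int p g') \<Longrightarrow> g' = g"
    using hecke_reps_unique[OF R XD] by metis
  note RD = hecke_repsD[OF p(1) coset_Tj_Sim R]
  have "g' = g" if "g' \<in> reps N p ?D" for g'
    by (rule g(3)[OF that LC_sym[OF p(1) padic_of_int_in D[OF RD(2)[OF that]]]])
  then have "reps N p ?D = {g}" using g(1) by blast
  then have "hecke_coset_op N p \<rho> lam ?D F z = slash \<rho> lam (map_matrix of_int g) F z"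
    by (simp add: hecke_coset_op_reps)
  also have "\<dots> = slash \<rho> lam (map_matrix of_int ?h) F z"
    by (rule slash_LC[OF p F RD(1,3)[OF g(1)] h sh D[OF RD(2)[OF g(1)]] z])
  also have "\<dots> = of_int (int p) powi ((\<Sum>i\<in>UNIV. lam i) - int (CARD('n) * (CARD('n) + 1))) *s F z"
    by (rule slash_scalar) (use F p(1) in \<open>auto simp: siegel_modular_form_def prime_gt_0_nat\<close>)
  finally show "hecke_coset_op N p \<rho> lam ?D F z = of_nat p powi ((\<Sum>i\<in>UNIV. lam i) - int (CARD('n) * (CARD('n) + 1))) *s F z"
    by simp
qed

lemma eigenvalue_eq:
  assumes "\<exists>z\<in>siegel_space. F z \<noteq> 0" "is_eigenvalue T F a"
  shows "eigenvalue T F = a"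
  unfolding eigenvalue_def
proof (rule the_equality)
  fix b assume "is_eigenvalue T F b"
  then show "b = a" using assms unfolding is_eigenvalue_def by (metis vector_mul_rcancel)
qed (fact assms(2))

lemma hecke_Tj_eq: "hecke_Tj N p \<rho> lam j = hecke_coset_op N p \<rho> lam (coset_Tj p j)"
  by (simp add: hecke_Tj_def coset_Tj_def)

text \<open>Here \<open>c\<close> is free; the multiplicity of T_0(p^2) is substituted for it in the
  end.\<close>

lemma eigenvalue_relation:
  fixes \<rho> :: "'n::{finite,linorder} cmat \<Rightarrow> 'd::finite cmat"
  assumes p: "prime p" "\<not> p dvd N" and F: "hecke_eigenform N \<rho> lam F"
  shows "(eigenvalue (hecke_T N p \<rho> lam) F)\<^sup>2 - c * eigenvalue (hecke_Tp2 N p \<rho> lam) F =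
    (\<Sum>D\<in>similitude_p2_cosets p. (of_nat (factor_count p D) - c) * eigenvalue (hecke_coset_op N p \<rho> lam D) F)"
    and "eigenvalue (hecke_coset_op N p \<rho> lam (coset_Tj p CARD('n))) F = of_nat p powi ((\<Sum>i\<in>UNIV. lam i) - int (CARD('n) * (CARD('n) + 1)))"
proof -
  have M: "siegel_modular_form N \<rho> lam F" and nz: "\<exists>z\<in>siegel_space. F z \<noteq> 0"
    using F by (auto simp: hecke_eigenform_def)
  note ev = eigenvalue_eq[OF nz]
  show "eigenvalue (hecke_coset_op N p \<rho> lam (coset_Tj p CARD('n))) F = of_nat p powi ((\<Sum>i\<in>UNIV. lam i) - int (CARD('n) * (CARD('n) + 1)))"
    by (rule ev[OF hecke_coset_op_scalar[OF p M]])
  have isev: "is_eigenvalue T F (eigenvalue T F)" if "\<exists>a. is_eigenvalue T F a" for T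
    using that ev by blast
  let ?C = "similitude_p2_cosets p :: ('n + 'n) padic_mat set set"
  let ?a = "\<lambda>D. eigenvalue (hecke_coset_op N p \<rho> lam D) F"
  let ?t = "eigenvalue (hecke_T N p \<rho> lam) F" and ?u = "eigenvalue (hecke_Tp2 N p \<rho> lam) F"
  have E: "\<exists>a. is_eigenvalue (hecke_T N p \<rho> lam) F a" "\<exists>a. is_eigenvalue (hecke_Tp2 N p \<rho> lam) F a"
    "\<And>j. j \<le> CARD('n) \<Longrightarrow> \<exists>a. is_eigenvalue (hecke_coset_op N p \<rho> lam (coset_Tj p j)) F a"
    using F p unfolding hecke_eigenform_def hecke_Tj_eq by blast+
  \<comment> \<open>An eigenform has eigenvalues for the T_j(p^2) by definition; that this covers
    every D rests on the classification of the double cosets.\<close>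
  have aD: "hecke_coset_op N p \<rho> lam D F z = ?a D *s F z" if DC: "D \<in> ?C" and zH: "z \<in> siegel_space" for D z
  proof -
    obtain j where j: "j \<le> CARD('n)" "D = coset_Tj p j"
      using subsetD[OF similitude_p2_cosets_subset[OF p(1)] DC] by auto
    show ?thesis
      using isev[OF E(3)[OF j(1)]] zH unfolding j(2) is_eigenvalue_def by simp
  qed
  have t: "hecke_T N p \<rho> lam F z = ?t *s F z" if "z \<in> siegel_space" for z
    using isev[OF E(1)] that by (simp add: is_eigenvalue_def)
  obtain z where z: "z \<in> siegel_space" "F z \<noteq> 0" using nz by blast
  have p1: "0 < int p ^ 1" using p(1) by (simp add: prime_gt_0_nat)
  have R1: "hecke_reps N p (coset_Tp p) (reps N p (coset_Tp p :: ('n + 'n) padic_mat set))"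
    by (rule hecke_reps_coset_Tp[OF p])
  have "hecke_T N p \<rho> lam (hecke_T N p \<rho> lam F) z =
    (\<Sum>g\<in>reps N p (coset_Tp p). ?t *s slash \<rho> lam (map_matrix of_int g) F z)"
    unfolding hecke_T_reps[of N p \<rho> lam "hecke_T N p \<rho> lam F"]
    by (intro sum.cong refl slash_smult[OF hecke_repsD(3)[OF p(1) coset_Tp_Sim R1] p1 z(1)] t)
  also have "\<dots> = ?t *s hecke_T N p \<rho> lam F z"
    by (simp add: hecke_T_reps vec.scale_sum_right)
  finally have "hecke_T N p \<rho> lam (hecke_T N p \<rho> lam F) z = ?t *s hecke_T N p \<rho> lam F z" .
  then have "?t\<^sup>2 *s F z = (\<Sum>D\<in>?C. (of_nat (factor_count p D) * ?a D) *s F z)"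
    using hecke_T_square[OF p M z(1)] t[OF z(1)] aD[OF _ z(1)]
    by (simp add: power2_eq_square vector_smult_assoc)
  also have "\<dots> = (\<Sum>D\<in>?C. of_nat (factor_count p D) * ?a D) *s F z"
    by (rule vec.scale_sum_left[symmetric])
  finally have 1: "?t\<^sup>2 = (\<Sum>D\<in>?C. of_nat (factor_count p D) * ?a D)"
    using z(2) by simp
  have "hecke_Tp2 N p \<rho> lam F z = ?u *s F z"
    using isev[OF E(2)] z(1) by (simp add: is_eigenvalue_def)
  moreover have "hecke_Tp2 N p \<rho> lam F z = (\<Sum>D\<in>?C. ?a D *s F z)"
    unfolding hecke_Tp2_def by (intro sum.cong refl aD z(1))
  ultimately have "?u *s F z = (\<Sum>D\<in>?C. ?a D *s F z)"
    by simp
  also have "\<dots> = (\<Sum>D\<in>?C. ?a D) *s F z"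
    by (rule vec.scale_sum_left[symmetric])
  finally have 2: "?u = (\<Sum>D\<in>?C. ?a D)"
    using z(2) by simp
  show "?t\<^sup>2 - c * ?u = (\<Sum>D\<in>?C. (of_nat (factor_count p D) - c) * ?a D)"
    by (simp add: 1 2 left_diff_distrib sum_subtractf sum_distrib_left)
qed

theorem theorem4p1:
  fixes N p :: nat
    and lam mu :: "'n::{finite,linorder} \<Rightarrow> int"
    and \<rho> :: "'n cmat \<Rightarrow> 'd::finite cmat"
    and \<sigma> :: "'n cmat \<Rightarrow> 'e::finite cmat"
    and F :: "'n cmat \<Rightarrow> complex ^ 'd"
    and G :: "'n cmat \<Rightarrow> complex ^ 'e"
  assumes "N \<ge> 1"
    and "antimono lam" and "antimono mu"
    and "hecke_eigenform N \<rho> lam F"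
    and "hecke_eigenform N \<sigma> mu G"
    and "(\<Sum>j\<in>UNIV. lam j) \<noteq> (\<Sum>j\<in>UNIV. mu j)"
    and "prime p" and "\<not> p dvd N"
  shows "eigenvalue_tuple N \<rho> lam F p \<noteq> eigenvalue_tuple N \<sigma> mu G p"
proof
  assume eq: "eigenvalue_tuple N \<rho> lam F p = eigenvalue_tuple N \<sigma> mu G p"
  let ?C = "similitude_p2_cosets p :: ('n + 'n) padic_mat set set"
  let ?a = "\<lambda>D. eigenvalue (hecke_coset_op N p \<rho> lam D) F" and ?b = "\<lambda>D. eigenvalue (hecke_coset_op N p \<sigma> mu D) G"
  let ?c = "\<lambda>D :: ('n + 'n) padic_mat set. of_nat (factor_count p D) :: complex"
  let ?D = "coset_Tj p CARD('n) :: ('n + 'n) padic_mat set" and ?E = "coset_Tj p 0 :: ('n + 'n) padic_mat set"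
  have mid: "?a (coset_Tj p j) = ?b (coset_Tj p j)" if "1 \<le> j" "j < CARD('n)" for j
  proof -
    have "map (\<lambda>j. ?a (coset_Tj p j)) [1..<CARD('n)] = map (\<lambda>j. ?b (coset_Tj p j)) [1..<CARD('n)]"
      using eq by (simp add: eigenvalue_tuple_def hecke_Tj_eq)
    then show ?thesis using that by (auto dest!: map_eq_conv[THEN iffD1])
  qed
  note rF = eigenvalue_relation[OF assms(7,8,4)] and rG = eigenvalue_relation[OF assms(7,8,5)]
  \<comment> \<open>With c the multiplicity of T_0(p^2), the left sides of both relations are
    expressions in the first two entries of the tuple.\<close>
  have "(\<Sum>D\<in>?C. (?c D - ?c ?E) * ?a D) = (\<Sum>D\<in>?C. (?c D - ?c ?E) * ?b D)"
    unfolding rF(1)[symmetric] rG(1)[symmetric] using eq by (simp add: eigenvalue_tuple_def)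
  then have "0 = (\<Sum>D\<in>?C. (?c D - ?c ?E) * (?a D - ?b D))"
    by (simp add: right_diff_distrib sum_subtractf)
  also have "\<dots> = (\<Sum>D\<in>{?D}. (?c D - ?c ?E) * (?a D - ?b D))"
  proof (rule sum.mono_neutral_right)
    show "finite ?C"
      by (rule finite_subset[OF similitude_p2_cosets_subset[OF assms(7)]]) simp
    have "padic_of_int p (mat (int p) :: (int, 'n) mat_2n) \<in> Sim p 2"
      by (rule Sim_of_int) (simp add: mat_mult_eq, simp add: vec_eq_iff mat_nth power2_eq_square)
    then show "{?D} \<subseteq> ?C"
      unfolding similitude_p2_cosets_eq[OF assms(7)] coset_Tj_n by blast
    \<comment> \<open>For j = 0 the coefficient vanishes by the choice of c; for 1 <= j < n the two
      eigenvalues agree by the equality of the tuples.\<close>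
    show "\<forall>D\<in>?C - {?D}. (?c D - ?c ?E) * (?a D - ?b D) = 0"
    proof
      fix D assume D: "D \<in> ?C - {?D}"
      then have "D \<in> ?C" by simp
      from subsetD[OF similitude_p2_cosets_subset[OF assms(7)] this]
      obtain j where j: "j \<le> CARD('n)" "D = coset_Tj p j"
        by auto
      moreover have "j \<noteq> CARD('n)"
        using D j(2) by blast
      ultimately have "j = 0 \<or> 1 \<le> j \<and> j < CARD('n)"
        by linarith
      then show "(?c D - ?c ?E) * (?a D - ?b D) = 0"
        using mid j(2) by auto
    qed
  qed
  finally have "?a ?D = ?b ?D"
    using factor_count_less[OF assms(7), where 'n = 'n] by simp
  then have "(of_nat p :: complex) powi ((\<Sum>i\<in>UNIV. lam i) - int (CARD('n) * (CARD('n) + 1))) =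
    of_nat p powi ((\<Sum>i\<in>UNIV. mu i) - int (CARD('n) * (CARD('n) + 1)))"
    unfolding rF(2) rG(2) .
  \<comment> \<open>Norms lead to powers of the real number p > 1, which determine their
    exponents.\<close>
  then have "norm ((of_nat p :: complex) powi ((\<Sum>i\<in>UNIV. lam i) - int (CARD('n) * (CARD('n) + 1)))) =
    norm ((of_nat p :: complex) powi ((\<Sum>i\<in>UNIV. mu i) - int (CARD('n) * (CARD('n) + 1))))"
    by (rule arg_cong)
  then have "real p powi ((\<Sum>i\<in>UNIV. lam i) - int (CARD('n) * (CARD('n) + 1))) =
    real p powi ((\<Sum>i\<in>UNIV. mu i) - int (CARD('n) * (CARD('n) + 1)))"
    by (simp add: norm_power_int)
  moreover have "real p > 1"
    using assms(7) prime_gt_1_nat by simp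
  ultimately have "(\<Sum>i\<in>UNIV. lam i) = (\<Sum>i\<in>UNIV. mu i)"
    using power_int_strict_increasing[of _ _ "real p"]
    by (metis diff_add_cancel linorder_neqE order_less_irrefl)
  then show False
    using assms(6) by contradiction
qed

end
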